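(* Let $\mathfrak X$ be a Banach space, $p\in(1,\infty)$, $V\in\mathscr A_p(\mathbb R^n;\mathscr L(\mathfrak X))$, let $\mathscr S\subset\mathscr D$ be a sparse collection of dyadic cubes of $\mathbb R^n$, and for each $Q\in\mathscr S$ let $a_Q$ and $b_Q$ be scalar functions supported in $Q$ and bounded in absolute value by $1$. Then $$Tf:=\sum_{Q\in\mathscr S}a_Q\,\frac1{|Q|}\int_Qb_Qf$$ defines a bounded operator on $L^p(V;\mathfrak X)$.
   Context: Measurability. $f:\mathbb R^n\to\mathfrak X$ is strongly measurable if it is a pointwise limit of simple functions. $L^p(\mathbb R^n;\mathfrak X)$ consists of the strongly measurable $f$ with $\|f(\cdot)\|_{\mathfrak X}\in L^p$. Scalar functions are understood to be measurable. Cubes have sides parallel to the axes. Weights. $V:\mathbb R^n\to\mathscr L(\mathfrak X)$ (bounded linear operators on $\mathfrak X$) is a weight if $V(\cdot)\mathfrak e$ is strongly measurable for every $\mathfrak e\in\mathfrak X$, $V(x)$ is invertible for a.e. $x$, and $V(\cdot)^{-1}\mathfrak e$ is strongly measurable for every $\mathfrak e\in\mathfrak X$. It is a $p$-weight if moreover $\mathbf 1_QV(\cdot)\mathfrak e\in L^p(\mathbb R^n;\mathfrak X)$ for all cubes $Q$ and all $\mathfrak e$. $V^{-*}(x):=(V(x)^{-1})^*\in\mathscr L(\mathfrak X^* )$; the same notions apply to $V^{-*}$ with $\mathfrak X^*$ in place of $\mathfrak X$. Weighted space. $L^p(V;\mathfrak X)$ is the space of strongly measurable $f:\mathbb R^n\to\mathfrak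 X$ with $\|f\|_{L^p(V;\mathfrak X)}:=\|Vf\|_{L^p(\mathbb R^n;\mathfrak X)}<\infty$, where $(Vf)(x)=V(x)f(x)$. $\mathscr A_p$ condition ($1<p<\infty$, $p'=p/(p-1)$). Let $\rho^V_{p,Q}(\mathfrak e):=\big(\frac1{|Q|}\int_Q\|V(x)\mathfrak e\|^p\,dx\big)^{1/p}$, $\rho^{V^{-*}}_{p',Q}(\mathfrak e^* ):=\big(\frac1{|Q|}\int_Q\|V^{-*}(x)\mathfrak e^*\|^{p'}dx\big)^{1/p'}$, and $(\rho^V_{p,Q})^*(\mathfrak e^* ):=\sup_{\mathfrak e\ne0}|\langle\mathfrak e^*,\mathfrak e\rangle|/\rho^V_{p,Q}(\mathfrak e)$. Then $V\in\mathscr A_p(\mathbb R^n;\mathscr L(\mathfrak X))$ means that $V$ is a $p$-weight, $V^{-*}$ is a $p'$-weight, and there is a finite $C$ with $\rho^{V^{-*}}_{p',Q}(\mathfrak e^* )\le C(\rho^V_{p,Q})^*(\mathfrak e^* )$ for all cubes $Q$ and all $\mathfrak e^*\in\mathfrak X^*$. Dyadic cubes: $\mathscr D=\{2^{-j}([0,1)^n+k):j\in\mathbb Z,k\in\mathbb Z^n\}$. A collection $\mathscr S\subset\mathscr D$ is sparse if there are a constant $c>0$ and pairwise disjoint measurable sets $E(Q)\subseteq Q$, $Q\in\mathscr S$, with $|E(Q)|\ge c|Q|$. Each individual operator $f\mapsto a_Q\frac1{|Q|}\int_Qb_Qf$ is initially defined on the dense subspace of $f\in L^p(V;\mathfrak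 X)$ with $b_Qf\in L^1(\mathbb R^n;\mathfrak X)$, and extends to a bounded operator on $L^p(V;\mathfrak X)$; this extension is meant in the series. *)

theory Defs
  imports "HOL-Analysis.Analysis"
begin

section \<open>Banach spaces over the real or complex numbers\<close>

text \<open>
  The library class \<open>banach\<close> only knows real scalars. To treat real and complex Banach spaces
  at once, the scalar field is a type \<open>'k :: {real_normed_field, euclidean_space}\<close>
  (\<open>real\<close> and \<open>complex\<close> are instances and, by Frobenius' theorem, the only ones up to
  isomorphism), acting on a type of class \<open>banach\<close> through \<open>s\<close>. The real case is
  \<open>s = scaleR\<close>.
\<close>

definition banach_scaling :: "('k::{real_normed_field,euclidean_space} \<Rightarrow> 'x::banach \<Rightarrow> 'x) \<Rightarrow> bool"
  where "banach_scaling s \<longleftrightarrow> vector_space s \<and> (\<forall>r x. s (of_real r) x = r *\<^sub>R x) \<and>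
    (\<forall>c x. norm (s c x) = norm c * norm x)"

lemma banach_scaling_scaleR: "banach_scaling (scaleR :: real \<Rightarrow> 'x::banach \<Rightarrow> 'x)"
  by (simp add: banach_scaling_def real_vector.vector_space_axioms)

text \<open>
  The elements of the type \<open>'x \<Rightarrow>\<^sub>L 'k\<close> are bounded but only real-linear; the dual space
  consists of the \<open>'k\<close>-linear ones.
\<close>

definition dual_space :: "('k::{real_normed_field,euclidean_space} \<Rightarrow> 'x::banach \<Rightarrow> 'x) \<Rightarrow> ('x \<Rightarrow>\<^sub>L 'k) set"
  where "dual_space s = {\<phi>. \<forall>c e. blinfun_apply \<phi> (s c e) = c * blinfun_apply \<phi> e}"

definition dual_scale :: "'k::{real_normed_field,euclidean_space} \<Rightarrow> ('x::banach \<Rightarrow>\<^sub>L 'k) \<Rightarrow> ('x \<Rightarrow>\<^sub>L 'k)"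
  where "dual_scale c \<phi> = blinfun_mult_right c o\<^sub>L \<phi>"

text \<open>
  Since the dual space is a carrier set inside a type, operators on a Banach space are functions
  considered on a carrier \<open>E\<close>: either \<open>UNIV\<close> with scaling \<open>s\<close>, or \<open>dual_space s\<close> with
  scaling \<open>dual_scale\<close>.
\<close>

definition bounded_ops :: "('k \<Rightarrow> 'e::real_normed_vector \<Rightarrow> 'e) \<Rightarrow> 'e set \<Rightarrow> ('e \<Rightarrow> 'e) set"
  where "bounded_ops s E = {A. (\<forall>e\<in>E. A e \<in> E) \<and> (\<forall>e\<in>E. \<forall>e'\<in>E. A (e + e') = A e + A e') \<and>
    (\<forall>c. \<forall>e\<in>E. A (s c e) = s c (A e)) \<and> (\<exists>C. \<forall>e\<in>E. norm (A e) \<le> C * norm e)}"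

definition invertible_op :: "('k \<Rightarrow> 'e::real_normed_vector \<Rightarrow> 'e) \<Rightarrow> 'e set \<Rightarrow> ('e \<Rightarrow> 'e) \<Rightarrow> bool"
  where "invertible_op s E A \<longleftrightarrow> (\<exists>B\<in>bounded_ops s E. \<forall>e\<in>E. A (B e) = e \<and> B (A e) = e)"

text \<open>
  Weights are invertible only almost everywhere. The inverse is set to \<open>0\<close> on the exceptional null
  set, so that its strong measurability is not affected by arbitrary values there.
\<close>

definition op_inverse :: "('k \<Rightarrow> 'e::real_normed_vector \<Rightarrow> 'e) \<Rightarrow> 'e set \<Rightarrow> ('e \<Rightarrow> 'e) \<Rightarrow> 'e \<Rightarrow> 'e"
  where "op_inverse s E A = (if invertible_op s E A then inv_into E A else (\<lambda>_. 0))"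

definition adjoint_op :: "('x::real_normed_vector \<Rightarrow> 'x) \<Rightarrow> ('x \<Rightarrow>\<^sub>L 'k::real_normed_vector) \<Rightarrow> ('x \<Rightarrow>\<^sub>L 'k)"
  where "adjoint_op B \<phi> = Blinfun (\<lambda>e. blinfun_apply \<phi> (B e))"


section \<open>Strong measurability, the Bochner integral and Lebesgue spaces\<close>

definition strongly_measurable :: "(real^'n \<Rightarrow> 'e::real_normed_vector) \<Rightarrow> bool"
  where "strongly_measurable f \<longleftrightarrow>
    (\<exists>u. (\<forall>i. simple_function lebesgue (u i)) \<and> (\<forall>x. (\<lambda>i. u i x) \<longlonglongrightarrow> f x))"

text \<open>
  The library's \<open>has_bochner_integral\<close> is restricted to second countable spaces. This is the same
  definition for arbitrary normed spaces, with strong in place of Borel measurability.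
\<close>

definition has_strong_integral :: "(real^'n \<Rightarrow> 'e::real_normed_vector) \<Rightarrow> 'e \<Rightarrow> bool"
  where "has_strong_integral f I \<longleftrightarrow> strongly_measurable f \<and>
    (\<exists>u. (\<forall>i. Bochner_Integration.simple_bochner_integrable lebesgue (u i)) \<and>
      (\<lambda>i. \<integral>\<^sup>+x. ennreal (norm (f x - u i x)) \<partial>lebesgue) \<longlonglongrightarrow> 0 \<and>
      (\<lambda>i. Bochner_Integration.simple_bochner_integral lebesgue (u i)) \<longlonglongrightarrow> I)"

definition strong_integral :: "(real^'n \<Rightarrow> 'e::real_normed_vector) \<Rightarrow> 'e"
  where "strong_integral f = (THE I. has_strong_integral f I)"

definition Lp :: "real \<Rightarrow> (real^'n \<Rightarrow> 'e::real_normed_vector) set"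
  where "Lp p = {f. strongly_measurable f \<and> integrable lebesgue (\<lambda>x. norm (f x) powr p)}"

definition Lp_norm :: "real \<Rightarrow> (real^'n \<Rightarrow> 'e::real_normed_vector) \<Rightarrow> real"
  where "Lp_norm p f = (LINT x|lebesgue. norm (f x) powr p) powr (1 / p)"


section \<open>Cubes and sparse collections\<close>

definition cubes :: "(real^'n) set set"
  where "cubes = {{x. \<forall>i. a $ i \<le> x $ i \<and> x $ i < a $ i + l} | a l. 0 < l}"

definition dyadic_cubes :: "(real^'n) set set"
  where "dyadic_cubes =
    {(\<lambda>y. (2 powi (-j)) *\<^sub>R (y + (\<chi> i. of_int (k i)))) ` {y. \<forall>i. 0 \<le> y $ i \<and> y $ i < 1}
      | (j::int) (k::'n \<Rightarrow> int). True}"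

definition sparse_collection :: "(real^'n) set set \<Rightarrow> bool"
  where "sparse_collection S \<longleftrightarrow> (\<exists>c>0. \<exists>E. disjoint_family_on E S \<and>
    (\<forall>Q\<in>S. E Q \<subseteq> Q \<and> E Q \<in> sets lebesgue \<and> measure lebesgue (E Q) \<ge> c * measure lebesgue Q))"


section \<open>Weights\<close>

definition weight :: "('k \<Rightarrow> 'e::real_normed_vector \<Rightarrow> 'e) \<Rightarrow> 'e set \<Rightarrow> (real^'n \<Rightarrow> 'e \<Rightarrow> 'e) \<Rightarrow> bool"
  where "weight s E W \<longleftrightarrow> (\<forall>x. W x \<in> bounded_ops s E) \<and>
    (\<forall>e\<in>E. strongly_measurable (\<lambda>x. W x e)) \<and>
    (AE x in lebesgue. invertible_op s E (W x)) \<and>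
    (\<forall>e\<in>E. strongly_measurable (\<lambda>x. op_inverse s E (W x) e))"

definition p_weight ::
    "real \<Rightarrow> ('k \<Rightarrow> 'e::real_normed_vector \<Rightarrow> 'e) \<Rightarrow> 'e set \<Rightarrow> (real^'n \<Rightarrow> 'e \<Rightarrow> 'e) \<Rightarrow> bool"
  where "p_weight p s E W \<longleftrightarrow> weight s E W \<and>
    (\<forall>Q\<in>cubes. \<forall>e\<in>E. (\<lambda>x. indicator Q x *\<^sub>R W x e) \<in> Lp p)"

definition inv_adjoint :: "('k::{real_normed_field,euclidean_space} \<Rightarrow> 'x::banach \<Rightarrow> 'x) \<Rightarrow>
    (real^'n \<Rightarrow> 'x \<Rightarrow> 'x) \<Rightarrow> real^'n \<Rightarrow> ('x \<Rightarrow>\<^sub>L 'k) \<Rightarrow> ('x \<Rightarrow>\<^sub>L 'k)"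
  where "inv_adjoint s V x = adjoint_op (op_inverse s UNIV (V x))"

definition rho :: "real \<Rightarrow> (real^'n \<Rightarrow> 'e::real_normed_vector \<Rightarrow> 'e) \<Rightarrow> (real^'n) set \<Rightarrow> 'e \<Rightarrow> real"
  where "rho p W Q e = (1 / measure lebesgue Q * (LINT x:Q|lebesgue. norm (W x e) powr p)) powr (1 / p)"

text \<open>The supremum may be infinite, hence \<open>ennreal\<close>; for a weight, \<open>rho p V Q e > 0\<close> if \<open>e \<noteq> 0\<close>.\<close>

definition rho_dual :: "real \<Rightarrow> (real^'n \<Rightarrow> 'x::banach \<Rightarrow> 'x) \<Rightarrow> (real^'n) set \<Rightarrow>
    ('x \<Rightarrow>\<^sub>L 'k::{real_normed_field,euclidean_space}) \<Rightarrow> ennreal"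
  where "rho_dual p V Q \<phi> = (SUP e\<in>-{0}. ennreal (norm (blinfun_apply \<phi> e) / rho p V Q e))"

definition Ap_weight :: "('k::{real_normed_field,euclidean_space} \<Rightarrow> 'x::banach \<Rightarrow> 'x) \<Rightarrow> real \<Rightarrow>
    (real^'n \<Rightarrow> 'x \<Rightarrow> 'x) \<Rightarrow> bool"
  where "Ap_weight s p V \<longleftrightarrow> (let p' = p / (p - 1) in
    p_weight p s UNIV V \<and>
    p_weight p' dual_scale (dual_space s) (inv_adjoint s V) \<and>
    (\<exists>C\<ge>0. \<forall>Q\<in>cubes. \<forall>\<phi>\<in>dual_space s.
      ennreal (rho p' (inv_adjoint s V) Q \<phi>) \<le> ennreal C * rho_dual p V Q \<phi>))"


section \<open>Operators on the weighted space\<close>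

definition weighted_Lp :: "real \<Rightarrow> (real^'n \<Rightarrow> 'x::banach \<Rightarrow> 'x) \<Rightarrow> (real^'n \<Rightarrow> 'x) set"
  where "weighted_Lp p V = {f. strongly_measurable f \<and> (\<lambda>x. V x (f x)) \<in> Lp p}"

definition weighted_norm :: "real \<Rightarrow> (real^'n \<Rightarrow> 'x::banach \<Rightarrow> 'x) \<Rightarrow> (real^'n \<Rightarrow> 'x) \<Rightarrow> real"
  where "weighted_norm p V f = Lp_norm p (\<lambda>x. V x (f x))"

text \<open>
  Elements of \<open>weighted_Lp p V\<close> are functions, not equivalence classes, so linearity is required
  almost everywhere. Together with the norm bound it implies that \<open>T\<close> respects equality almost
  everywhere.
\<close>

definition bounded_operator :: "('k \<Rightarrow> 'x::banach \<Rightarrow> 'x) \<Rightarrow> real \<Rightarrow> (real^'n \<Rightarrow> 'x \<Rightarrow> 'x) \<Rightarrow>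
    ((real^'n \<Rightarrow> 'x) \<Rightarrow> (real^'n \<Rightarrow> 'x)) \<Rightarrow> bool"
  where "bounded_operator s p V T \<longleftrightarrow>
    (\<forall>f\<in>weighted_Lp p V. T f \<in> weighted_Lp p V) \<and>
    (\<forall>f\<in>weighted_Lp p V. \<forall>g\<in>weighted_Lp p V.
      AE x in lebesgue. T (\<lambda>y. f y + g y) x = T f x + T g x) \<and>
    (\<forall>c. \<forall>f\<in>weighted_Lp p V. AE x in lebesgue. T (\<lambda>y. s c (f y)) x = s c (T f x)) \<and>
    (\<exists>C\<ge>0. \<forall>f\<in>weighted_Lp p V. weighted_norm p V (T f) \<le> C * weighted_norm p V f)"

definition averaging_term :: "('k \<Rightarrow> 'x::banach \<Rightarrow> 'x) \<Rightarrow> (real^'n) set \<Rightarrow> (real^'n \<Rightarrow> 'k) \<Rightarrow>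
    (real^'n \<Rightarrow> 'k) \<Rightarrow> (real^'n \<Rightarrow> 'x) \<Rightarrow> real^'n \<Rightarrow> 'x"
  where "averaging_term s Q a b f x =
    s (a x) ((1 / measure lebesgue Q) *\<^sub>R strong_integral (\<lambda>y. indicator Q y *\<^sub>R s (b y) (f y)))"

definition averaging_domain :: "('k \<Rightarrow> 'x::banach \<Rightarrow> 'x) \<Rightarrow> real \<Rightarrow> (real^'n \<Rightarrow> 'x \<Rightarrow> 'x) \<Rightarrow>
    (real^'n \<Rightarrow> 'k) \<Rightarrow> (real^'n \<Rightarrow> 'x) set"
  where "averaging_domain s p V b = {f \<in> weighted_Lp p V. (\<lambda>y. s (b y) (f y)) \<in> Lp 1}"

text \<open>
  \<open>T\<close> is the bounded extension to the whole weighted space of the operator \<open>A\<close> defined on the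
  dense subspace \<open>D\<close>; by density it is unique up to equality almost everywhere.
\<close>

definition is_bounded_extension :: "('k \<Rightarrow> 'x::banach \<Rightarrow> 'x) \<Rightarrow> real \<Rightarrow> (real^'n \<Rightarrow> 'x \<Rightarrow> 'x) \<Rightarrow>
    (real^'n \<Rightarrow> 'x) set \<Rightarrow> ((real^'n \<Rightarrow> 'x) \<Rightarrow> (real^'n \<Rightarrow> 'x)) \<Rightarrow>
    ((real^'n \<Rightarrow> 'x) \<Rightarrow> (real^'n \<Rightarrow> 'x)) \<Rightarrow> bool"
  where "is_bounded_extension s p V D A T \<longleftrightarrow>
    D \<subseteq> weighted_Lp p V \<and>
    (\<forall>f\<in>weighted_Lp p V. \<forall>\<epsilon>>0. \<exists>g\<in>D. weighted_norm p V (\<lambda>x. f x - g x) < \<epsilon>) \<and>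
    bounded_operator s p V T \<and>
    (\<forall>f\<in>D. AE x in lebesgue. T f x = A f x)"

text \<open>Unconditional convergence of the series \<open>\<Sum>Q\<in>S. t Q\<close> to \<open>h\<close> in the weighted norm.\<close>

definition weighted_has_sum :: "real \<Rightarrow> (real^'n \<Rightarrow> 'x::banach \<Rightarrow> 'x) \<Rightarrow>
    ('i \<Rightarrow> real^'n \<Rightarrow> 'x) \<Rightarrow> 'i set \<Rightarrow> (real^'n \<Rightarrow> 'x) \<Rightarrow> bool"
  where "weighted_has_sum p V t S h \<longleftrightarrow>
    ((\<lambda>F. weighted_norm p V (\<lambda>x. h x - (\<Sum>Q\<in>F. t Q x))) \<longlongrightarrow> 0) (finite_subsets_at_top S)"

end

theory Submission
  imports Defs
begin

text \<open>
  The condition on \<open>V\<close> makes the scalar weights \<open>|V e|^p\<close> and \<open>|V^{-*} \<phi>|^{p'}\<close> comparable on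
  \<open>Q\<close> and on subsets of \<open>Q\<close> of proportional measure, uniformly in \<open>e\<close> and \<open>\<phi>\<close>. Along a sparse
  family they therefore satisfy a Carleson packing condition, and a John-Nirenberg argument shows
  that they still have comparable mass after multiplication by \<open>z^n(Q,x)\<close>, where \<open>n(Q,x)\<close> counts
  the cubes of the family that contain \<open>x\<close> and are strictly contained in \<open>Q\<close>, and \<open>z > 1\<close>.

  Write \<open>e_Q\<close> for the average over \<open>Q\<close> of \<open>b_Q f\<close>. Duality, Hoelder's inequality with the
  weight \<open>z^n\<close> on the dual side, and the Hahn-Banach theorem for the seminorm \<open>rho\<close> bound the
  integral of \<open>|V e_Q|^p\<close> over \<open>Q\<close> by that of \<open>z^(-(p-1) n) |V f|^p\<close>. On the other side,
  \<open>(\<Sum> |V e_Q|)^p\<close> is dominated by \<open>\<Sum> z^n |V e_Q|^p\<close>, because the numbers \<open>n(Q,x)\<close> of the cubes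
  containing \<open>x\<close> are distinct. Summing the geometric series \<open>\<Sum> z^(-(p-1) n(Q,x))\<close> gives the estimate
  for \<open>\<Sum> |V e_Q|\<close>. No reverse Hoelder inequality or maximal function is needed, and absolute
  convergence yields unconditional convergence of the series.
\<close>

text \<open>In infinite dimensions the seminorms \<open>rho p V Q\<close> cannot in general be
  replaced by reducing operators, and b_Q f need not be integrable for f in the weighted space: only
  V^{-*} \<phi> for single functionals \<phi> is controlled, not the operator norm of V^{-1}. Hence
  a vector e is never compared with f directly but is recorded by the inequalities
  \<open>pairing_bound\<close> for all functionals. These survive limits, so they hold for the
  extended averages too, and a single norming functional turns them into a bound for V e.

  The constant z = 1 + 1/(2C) comes from the packing constant C: with it the recursion for the
  integrals of z^n w closes with the factor 2. C is the larger of the constants of the two weights,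
  so one z serves Hoelder's inequality on the dual side and the final sum on the side of V. The
  weights \<eta>^n that split the sum are then forced by \<eta>^(1-p) = z.

  Finite subfamilies come first, with a bound independent of the subfamily: there n is bounded, so
  all integrals with z^n are finite a priori.\<close>

abbreviation vol :: "(real^'n) set \<Rightarrow> real"
  where "vol \<equiv> measure lebesgue"

section \<open>Strongly measurable functions and the Bochner integral\<close>

abbreviation simple_integral_lebesgue :: "(real^'n \<Rightarrow> 'e::real_vector) \<Rightarrow> 'e"
  where "simple_integral_lebesgue \<equiv> Bochner_Integration.simple_bochner_integral lebesgue"

abbreviation simple_integrable_lebesgue :: "(real^'n \<Rightarrow> 'e::real_vector) \<Rightarrow> bool"
  where "simple_integrable_lebesgue \<equiv> Bochner_Integration.simple_bochner_integrable lebesgue"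

lemma simple_function_lebesgueI:
  assumes "finite (range u)" "\<And>y. {x. u x = y} \<in> sets lebesgue"
  shows "simple_function lebesgue u"
proof -
  have "u -` {y} = {x. u x = y}" for y by auto
  then show ?thesis using assms by (simp add: simple_function_def)
qed

lemma strongly_measurableI:
  assumes "\<And>i. simple_function lebesgue (u i)" "\<And>x. (\<lambda>i. u i x) \<longlonglongrightarrow> f x"
  shows "strongly_measurable f"
  unfolding strongly_measurable_def using assms by (intro exI[of _ u]) simp

lemma strongly_measurable_dist:
  assumes "strongly_measurable f"
  shows "(\<lambda>x. dist (f x) d) \<in> borel_measurable lebesgue"
proof -
  obtain u where u: "\<And>i. simple_function lebesgue (u i)" "\<And>x. (\<lambda>i. u i x) \<longlonglongrightarrow> f x"
    using assms unfolding strongly_measurable_def by auto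
  show ?thesis
  proof (rule borel_measurable_LIMSEQ_metric)
    show "(\<lambda>x. dist (u i x) d) \<in> borel_measurable lebesgue" for i
      by (rule borel_measurable_simple_function, rule simple_function_compose1[OF u(1)])
    show "(\<lambda>i. dist (u i x) d) \<longlonglongrightarrow> dist (f x) d" for x
      by (intro tendsto_intros u)
  qed
qed

lemma strongly_measurable_norm [measurable_dest]:
  assumes "strongly_measurable f"
  shows "(\<lambda>x. norm (f x)) \<in> borel_measurable lebesgue"
  using strongly_measurable_dist[OF assms, of 0] by simp

lemma strongly_measurable_separable_range:
  assumes "strongly_measurable f"
  shows "\<exists>D. countable D \<and> range f \<subseteq> closure D"
proof -
  obtain u where u: "\<And>i. simple_function lebesgue (u i)" "\<And>x. (\<lambda>i. u i x) \<longlonglongrightarrow> f x"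
    using assms unfolding strongly_measurable_def by auto
  have "countable (\<Union>i. range (u i))"
    using u(1) by (intro countable_UN) (auto simp: simple_function_def intro: countable_finite)
  moreover have "range f \<subseteq> closure (\<Union>i. range (u i))"
  proof safe
    fix x
    show "f x \<in> closure (\<Union>i. range (u i))"
      unfolding closure_sequential using u(2)[of x] by (intro exI[of _ "\<lambda>i. u i x"]) auto
  qed
  ultimately show ?thesis by blast
qed

text \<open>Pettis's criterion by a nearest-point scheme: \<open>u i x\<close> is the nearest to f x
  among the first i + 1 points of an enumerated dense set. Putting 0 first in the enumeration yields
  the bound by 2 norm (f x), the domination needed for integrals.\<close>

lemma simple_approximation:
  fixes f :: "real^'n \<Rightarrow> 'e::real_normed_vector"
  assumes D: "countable D" "range f \<subseteq> closure D"
    and m: "\<And>d. (\<lambda>x. dist (f x) d) \<in> borel_measurable lebesgue"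
  shows "\<exists>u. (\<forall>i. simple_function lebesgue (u i)) \<and> (\<forall>x. (\<lambda>i. u i x) \<longlonglongrightarrow> f x) \<and>
    (\<forall>i x. norm (u i x) \<le> 2 * norm (f x))"
proof -
  define e where "e n = (case n of 0 \<Rightarrow> 0 | Suc n \<Rightarrow> from_nat_into (insert 0 D) n)" for n
  have e0: "e 0 = 0" by (simp add: e_def)
  have dense: "\<exists>n. dist (f x) (e n) < r" if r: "r > 0" for x r
  proof -
    have "f x \<in> closure D" using D(2) by (metis rangeI subsetD)
    then obtain d where d: "d \<in> D" "dist d (f x) < r" using r closure_approachable by blast
    obtain n where "from_nat_into (insert 0 D) n = d"
      using from_nat_into_surj[of "insert 0 D" d] D(1) d(1) by (metis countable_insert insertI2)
    then have "e (Suc n) = d" by (simp add: e_def)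
    with d show ?thesis by (metis dist_commute)
  qed
  define P where "P i x k \<longleftrightarrow> k \<le> i \<and> (\<forall>j\<le>i. dist (f x) (e k) \<le> dist (f x) (e j))" for i x k
  \<comment> \<open>Ties are broken by the least index, so that the choice is measurable.\<close>
  define k where "k i x = (LEAST k. P i x k)" for i x
  have ex: "\<exists>k. P i x k" for i x
  proof -
    obtain k where "is_arg_min (\<lambda>k. dist (f x) (e k)) (\<lambda>k. k \<in> {..i}) k"
      using ex_is_arg_min_if_finite[of "{..i}"] by auto
    then have "P i x k" unfolding P_def is_arg_min_def by (auto simp: not_less)
    then show ?thesis ..
  qed
  have Pk: "P i x (k i x)" for i x unfolding k_def using ex by (rule LeastI_ex)
  have [measurable]: "Measurable.pred lebesgue (\<lambda>x. P i x n)" for i n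
    unfolding P_def using m by measurable
  have [measurable]: "k i \<in> measurable lebesgue (count_space UNIV)" for i
    unfolding k_def[abs_def] by measurable
  define u where "u i x = e (k i x)" for i x
  have "simple_function lebesgue (u i)" for i
  proof (rule simple_function_lebesgueI)
    have "range (u i) \<subseteq> e ` {..i}" using Pk unfolding u_def P_def by auto
    then show "finite (range (u i))" using finite_subset by blast
    have "Measurable.pred lebesgue (\<lambda>x. u i x = y)" for y unfolding u_def by measurable
    then show "{x. u i x = y} \<in> sets lebesgue" for y by (simp add: pred_def)
  qed
  moreover have "(\<lambda>i. u i x) \<longlonglongrightarrow> f x" for x
  proof (rule metric_LIMSEQ_I)
    fix r :: real assume "r > 0"
    then obtain n where n: "dist (f x) (e n) < r" using dense by blast
    have "dist (u i x) (f x) < r" if "n \<le> i" for i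
      using Pk[of i x] n that unfolding P_def u_def by (metis dist_commute le_less_trans)
    then show "\<exists>no. \<forall>n\<ge>no. dist (u n x) (f x) < r" by blast
  qed
  moreover have "norm (u i x) \<le> 2 * norm (f x)" for i x
  proof -
    have "dist (f x) (u i x) \<le> dist (f x) 0"
      using Pk[of i x] unfolding P_def u_def e0[symmetric] by auto
    then have "norm (f x - u i x) \<le> norm (f x)" by (simp add: dist_norm)
    moreover have "norm (u i x) \<le> norm (f x) + norm (f x - u i x)"
      by (metis norm_triangle_sub norm_minus_commute)
    ultimately show ?thesis by simp
  qed
  ultimately show ?thesis by blast
qed

lemma strongly_measurable_approximation:
  assumes "strongly_measurable f"
  obtains u where "\<And>i. simple_function lebesgue (u i)" "\<And>x. (\<lambda>i. u i x) \<longlonglongrightarrow> f x"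
    "\<And>i x. norm (u i x) \<le> 2 * norm (f x)"
proof -
  obtain D where "countable D" "range f \<subseteq> closure D"
    using strongly_measurable_separable_range[OF assms] by blast
  from simple_approximation[OF this strongly_measurable_dist[OF assms]] that show thesis by metis
qed

lemma strongly_measurable_simple_function:
  assumes "simple_function lebesgue u"
  shows "strongly_measurable u"
  unfolding strongly_measurable_def using assms by (intro exI[of _ "\<lambda>_. u"]) simp

text \<open>A diagonal choice of simple functions fails for pointwise limits. Separability of the
  range and measurability of the distances both pass to the limit, and
  \<open>simple_approximation\<close> recovers simple functions from them.\<close>

lemma strongly_measurable_LIMSEQ:
  assumes u: "\<And>i. strongly_measurable (u i)" and lim: "\<And>x. (\<lambda>i::nat. u i x) \<longlonglongrightarrow> f x"
  shows "strongly_measurable f"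
proof -
  obtain D where D: "\<And>i. countable (D i)" "\<And>i. range (u i) \<subseteq> closure (D i)"
    using strongly_measurable_separable_range[OF u] by metis
  have "range f \<subseteq> closure (\<Union>i. D i)"
  proof safe
    fix x
    have "u i x \<in> closure (\<Union>i. D i)" for i
      using D(2)[of i] closure_mono[of "D i" "\<Union>i. D i"] by blast
    then show "f x \<in> closure (\<Union>i. D i)"
      using lim[of x] closed_sequentially[OF closed_closure, of "\<lambda>i. u i x"] by blast
  qed
  moreover have "countable (\<Union>i. D i)" using D(1) by auto
  moreover have "(\<lambda>x. dist (f x) d) \<in> borel_measurable lebesgue" for d
    by (rule borel_measurable_LIMSEQ_metric[OF strongly_measurable_dist[OF u]])
      (rule tendsto_dist[OF lim tendsto_const])
  ultimately show ?thesis
    using simple_approximation[of "\<Union>i. D i" f] unfolding strongly_measurable_def by blast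
qed

lemma strongly_measurable_compose2:
  assumes f: "strongly_measurable f" and g: "strongly_measurable g"
    and h: "\<And>a b x y. a \<longlonglongrightarrow> x \<Longrightarrow> b \<longlonglongrightarrow> y \<Longrightarrow> (\<lambda>i. h (a i) (b i)) \<longlonglongrightarrow> h x y"
  shows "strongly_measurable (\<lambda>x. h (f x) (g x))"
proof -
  obtain u where u: "\<And>i. simple_function lebesgue (u i)" "\<And>x. (\<lambda>i. u i x) \<longlonglongrightarrow> f x"
    using f unfolding strongly_measurable_def by auto
  obtain v where v: "\<And>i. simple_function lebesgue (v i)" "\<And>x. (\<lambda>i. v i x) \<longlonglongrightarrow> g x"
    using g unfolding strongly_measurable_def by auto
  have "simple_function lebesgue (\<lambda>x. h (u i x) (v i x))" for i
    by (rule simple_function_compose2[OF u(1) v(1)])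
  moreover have "(\<lambda>i. h (u i x) (v i x)) \<longlonglongrightarrow> h (f x) (g x)" for x
    by (rule h[OF u(2) v(2)])
  ultimately show ?thesis by (rule strongly_measurableI)
qed

lemma strongly_measurable_const: "strongly_measurable (\<lambda>_. c)"
  unfolding strongly_measurable_def by (intro exI[of _ "\<lambda>_ _. c"]) auto

lemma strongly_measurable_add:
  "strongly_measurable f \<Longrightarrow> strongly_measurable g \<Longrightarrow> strongly_measurable (\<lambda>x. f x + g x)"
  by (rule strongly_measurable_compose2[where h="(+)"]) (auto intro: tendsto_intros)

lemma strongly_measurable_diff:
  "strongly_measurable f \<Longrightarrow> strongly_measurable g \<Longrightarrow> strongly_measurable (\<lambda>x. f x - g x)"
  by (rule strongly_measurable_compose2[where h="(-)"]) (auto intro: tendsto_intros)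

lemma strongly_measurable_sum:
  "(\<And>i. i \<in> A \<Longrightarrow> strongly_measurable (f i)) \<Longrightarrow> strongly_measurable (\<lambda>x. \<Sum>i\<in>A. f i x)"
  by (induction A rule: infinite_finite_induct)
    (auto intro: strongly_measurable_const strongly_measurable_add)

lemma borel_measurable_imp_strongly_measurable:
  fixes f :: "real^'n \<Rightarrow> 'b::{real_normed_vector, second_countable_topology}"
  assumes "f \<in> borel_measurable lebesgue"
  shows "strongly_measurable f"
  using borel_measurable_implies_sequence_metric[OF assms, of 0] unfolding strongly_measurable_def by auto

lemma strongly_measurable_imp_borel_measurable:
  assumes "strongly_measurable f"
  shows "f \<in> borel_measurable lebesgue"
proof -
  obtain u where u: "\<And>i. simple_function lebesgue (u i)" "\<And>x. (\<lambda>i. u i x) \<longlonglongrightarrow> f x"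
    using assms unfolding strongly_measurable_def by auto
  show ?thesis by (rule borel_measurable_LIMSEQ_metric[OF borel_measurable_simple_function[OF u(1)] u(2)])
qed

lemma strongly_measurable_indicator:
  assumes "A \<in> sets lebesgue" "strongly_measurable f"
  shows "strongly_measurable (\<lambda>x. indicator A x *\<^sub>R f x)"
proof -
  have "strongly_measurable (indicator A :: _ \<Rightarrow> real)"
    using assms(1) by (intro borel_measurable_imp_strongly_measurable) simp
  then show ?thesis using assms(2)
    by (rule strongly_measurable_compose2[where h="(*\<^sub>R)"]) (auto intro: tendsto_intros)
qed

lemma strongly_measurable_bounded_linear:
  assumes "bounded_linear h" "strongly_measurable f"
  shows "strongly_measurable (\<lambda>x. h (f x))"
  using assms(2,2)
  by (rule strongly_measurable_compose2[where h="\<lambda>a b. h a"])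
    (auto intro: bounded_linear.tendsto[OF assms(1)])

text \<open>The operators are measurable only vector by vector, so W x is first applied to simple
  functions, where it is a finite sum of functions W x y cut off to level sets. Continuity of each W
  x handles the limit.\<close>

lemma strongly_measurable_apply:
  assumes W: "\<And>e. strongly_measurable (\<lambda>x. W x e)" and bl: "\<And>x. bounded_linear (W x)"
    and f: "strongly_measurable f"
  shows "strongly_measurable (\<lambda>x. W x (f x))"
proof -
  obtain u where u: "\<And>i. simple_function lebesgue (u i)" "\<And>x. (\<lambda>i. u i x) \<longlonglongrightarrow> f x"
    using f unfolding strongly_measurable_def by auto
  have "strongly_measurable (\<lambda>x. W x (u i x))" for i
  proof -
    have fin: "finite (range (u i))" using u(1)[of i] by (simp add: simple_function_def)
    have s: "u i -` {y} \<in> sets lebesgue" if "y \<in> range (u i)" for y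
      using u(1)[of i] that by (auto simp: simple_function_def)
    have "W x (u i x) = (\<Sum>y\<in>range (u i). indicator (u i -` {y}) x *\<^sub>R W x y)" for x
    proof -
      have "(\<Sum>y\<in>range (u i). indicator (u i -` {y}) x *\<^sub>R W x y)
          = (\<Sum>y\<in>range (u i). if y = u i x then W x y else 0)"
        by (intro sum.cong) (auto simp: indicator_def)
      then show ?thesis using fin by simp
    qed
    moreover have "strongly_measurable (\<lambda>x. \<Sum>y\<in>range (u i). indicator (u i -` {y}) x *\<^sub>R W x y)"
      by (intro strongly_measurable_sum strongly_measurable_indicator W s)
    ultimately show ?thesis by simp
  qed
  then show ?thesis
    by (rule strongly_measurable_LIMSEQ) (rule bounded_linear.tendsto[OF bl u(2)])
qed

section \<open>The integral of strongly measurable functions\<close>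

text \<open>The image of an approximating sequence of simple functions is one for the image of f,
  whose values lie in a Euclidean space, where the library's integral applies. Uniqueness and
  linearity of vector integrals are later read off from this.\<close>

lemma has_strong_integral_bounded_linear:
  fixes \<phi> :: "'e::real_normed_vector \<Rightarrow> 'k::euclidean_space"
  assumes "has_strong_integral f I" "bounded_linear \<phi>"
  shows "has_bochner_integral lebesgue (\<lambda>x. \<phi> (f x)) (\<phi> I)"
proof -
  obtain u where f: "strongly_measurable f"
    and u: "\<And>i. simple_integrable_lebesgue (u i)"
      "(\<lambda>i. \<integral>\<^sup>+x. ennreal (norm (f x - u i x)) \<partial>lebesgue) \<longlonglongrightarrow> 0"
      "(\<lambda>i. simple_integral_lebesgue (u i)) \<longlonglongrightarrow> I"
    using assms unfolding has_strong_integral_def by auto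
  interpret \<phi>: bounded_linear \<phi> by fact
  obtain K where K: "K > 0" "\<And>x. norm (\<phi> x) \<le> norm x * K" using \<phi>.pos_bounded by auto
  have sm: "strongly_measurable (u i)" for i
    using u(1)[of i] by cases (rule strongly_measurable_simple_function)
  have [measurable]: "(\<lambda>x. norm (f x - u i x)) \<in> borel_measurable lebesgue" for i
    by (intro strongly_measurable_norm strongly_measurable_diff f sm)
  show ?thesis
  proof (rule has_bochner_integral.intros)
    show "(\<lambda>x. \<phi> (f x)) \<in> borel_measurable lebesgue"
      using strongly_measurable_bounded_linear[OF assms(2) f]
      by (rule strongly_measurable_imp_borel_measurable)
    show "simple_integrable_lebesgue (\<lambda>x. \<phi> (u i x))" for i
      using Bochner_Integration.simple_bochner_integrable_compose2[OF _ u(1)[of i] u(1)[of i], of "\<lambda>a b. \<phi> a"]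
      by (simp add: \<phi>.zero)
    show "(\<lambda>i. simple_integral_lebesgue (\<lambda>x. \<phi> (u i x))) \<longlonglongrightarrow> \<phi> I"
      using \<phi>.tendsto[OF u(3)] Bochner_Integration.simple_bochner_integral_linear[OF \<phi>.linear_axioms u(1)] by simp
    have le: "(\<integral>\<^sup>+x. ennreal (norm (\<phi> (f x) - \<phi> (u i x))) \<partial>lebesgue)
        \<le> ennreal K * (\<integral>\<^sup>+x. ennreal (norm (f x - u i x)) \<partial>lebesgue)" for i
    proof -
      have "(\<integral>\<^sup>+x. ennreal (norm (\<phi> (f x) - \<phi> (u i x))) \<partial>lebesgue)
        \<le> (\<integral>\<^sup>+x. ennreal K * ennreal (norm (f x - u i x)) \<partial>lebesgue)"
        using K by (intro nn_integral_mono) (auto simp: \<phi>.diff[symmetric] ennreal_mult[symmetric] ac_simps)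
      also have "\<dots> = ennreal K * (\<integral>\<^sup>+x. ennreal (norm (f x - u i x)) \<partial>lebesgue)"
        by (intro nn_integral_cmult) auto
      finally show ?thesis .
    qed
    show "(\<lambda>i. \<integral>\<^sup>+x. ennreal (norm (\<phi> (f x) - \<phi> (u i x))) \<partial>lebesgue) \<longlonglongrightarrow> 0"
      by (rule tendsto_sandwich[OF _ always_eventually[OF allI[OF le]] tendsto_const])
        (use ennreal_tendsto_cmult[OF _ u(2)] in auto)
  qed
qed

text \<open>Both simple integrals are compared through the common f, so approximants close to f in
  L^1 have close integrals. This is the Cauchy property behind the existence of the
  integral.\<close>

lemma simple_bochner_integral_dist_le:
  fixes f :: "real^'n \<Rightarrow> 'e::real_normed_vector"
  assumes f: "strongly_measurable f"
    and s: "simple_integrable_lebesgue s"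
    and t: "simple_integrable_lebesgue t"
  shows "ennreal (norm (simple_integral_lebesgue s
      - simple_integral_lebesgue t)) \<le>
    (\<integral>\<^sup>+ x. norm (f x - s x) \<partial>lebesgue) + (\<integral>\<^sup>+ x. norm (f x - t x) \<partial>lebesgue)"
proof -
  have sm: "strongly_measurable u" if "simple_integrable_lebesgue u"
    for u :: "real^'n \<Rightarrow> 'e"
    using that by cases (rule strongly_measurable_simple_function)
  have [measurable]: "(\<lambda>x. norm (f x - s x)) \<in> borel_measurable lebesgue"
    "(\<lambda>x. norm (f x - t x)) \<in> borel_measurable lebesgue"
    by (intro strongly_measurable_norm strongly_measurable_diff f sm s t)+
  have d: "simple_integrable_lebesgue (\<lambda>x. s x - t x)"
    using Bochner_Integration.simple_bochner_integrable_compose2[OF _ s t, of "(-)"] by simp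
  have "norm (simple_integral_lebesgue s
      - simple_integral_lebesgue t)
      \<le> simple_integral_lebesgue (\<lambda>x. norm (s x - t x))"
    using Bochner_Integration.simple_bochner_integral_norm_bound[OF d]
    by (simp add: Bochner_Integration.simple_bochner_integral_diff s t)
  then have "ennreal (norm (simple_integral_lebesgue s
      - simple_integral_lebesgue t))
      \<le> ennreal (simple_integral_lebesgue (\<lambda>x. norm (s x - t x)))"
    by (rule ennreal_leI)
  also have "\<dots> = (\<integral>\<^sup>+x. norm (s x - t x) \<partial>lebesgue)"
    using Bochner_Integration.simple_bochner_integrable_compose2[OF _ s t, of "\<lambda>x y. norm (x - y)"]
    by (intro Bochner_Integration.simple_bochner_integral_eq_nn_integral) auto
  also have "\<dots> \<le> (\<integral>\<^sup>+x. ennreal (norm (f x - s x)) + ennreal (norm (f x - t x)) \<partial>lebesgue)"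
  proof (intro nn_integral_mono)
    fix x
    have "norm (s x - t x) \<le> norm (f x - s x) + norm (f x - t x)"
      by (metis order.refl norm_diff_triangle_le norm_minus_commute)
    then show "ennreal (norm (s x - t x)) \<le> ennreal (norm (f x - s x)) + ennreal (norm (f x - t x))"
      by (simp flip: ennreal_plus)
  qed
  also have "\<dots> = (\<integral>\<^sup>+ x. norm (f x - s x) \<partial>lebesgue) + (\<integral>\<^sup>+ x. norm (f x - t x) \<partial>lebesgue)"
    by (rule nn_integral_add) auto
  finally show ?thesis .
qed

text \<open>Simple approximants bounded by 2 norm f converge in L^1 by dominated convergence, with
  dominating function 3 norm f. Completeness of the space provides the limit of their
  integrals.\<close>

lemma has_strong_integral_exists:
  fixes f :: "real^'n \<Rightarrow> 'e::banach"
  assumes f: "strongly_measurable f" and int: "integrable lebesgue (\<lambda>x. norm (f x))"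
  shows "\<exists>I. has_strong_integral f I"
proof -
  obtain u where u: "\<And>i. simple_function lebesgue (u i)" "\<And>x. (\<lambda>i. u i x) \<longlonglongrightarrow> f x"
    "\<And>i x. norm (u i x) \<le> 2 * norm (f x)"
    by (rule strongly_measurable_approximation[OF f]) (rule that)
  have sm: "strongly_measurable (u i)" for i
    by (intro strongly_measurable_simple_function u)
  have [measurable]: "(\<lambda>x. norm (f x)) \<in> borel_measurable lebesgue"
    "(\<lambda>x. norm (u i x)) \<in> borel_measurable lebesgue"
    "(\<lambda>x. norm (f x - u i x)) \<in> borel_measurable lebesgue" for i
    by (intro strongly_measurable_norm strongly_measurable_diff f sm)+
  have fin: "(\<integral>\<^sup>+x. ennreal (2 * norm (f x)) \<partial>lebesgue) < \<infinity>"
    using integrableD(2)[OF integrable_mult_right[OF int, of 2]] by (simp add: abs_mult less_top)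
  have fin3: "(\<integral>\<^sup>+x. ennreal (3 * norm (f x)) \<partial>lebesgue) < \<infinity>"
    using integrableD(2)[OF integrable_mult_right[OF int, of 3]] by (simp add: abs_mult less_top)
  have sbi: "simple_integrable_lebesgue (u i)" for i
  proof (rule Bochner_Integration.simple_bochner_integrableI_bounded[OF u(1)])
    have "(\<integral>\<^sup>+x. ennreal (norm (u i x)) \<partial>lebesgue) \<le> (\<integral>\<^sup>+x. ennreal (2 * norm (f x)) \<partial>lebesgue)"
      by (intro nn_integral_mono ennreal_leI u)
    then show "(\<integral>\<^sup>+x. ennreal (norm (u i x)) \<partial>lebesgue) < \<infinity>" using fin by (rule le_less_trans)
  qed
  have "(\<lambda>i. \<integral>\<^sup>+x. ennreal (norm (f x - u i x)) \<partial>lebesgue) \<longlonglongrightarrow> (\<integral>\<^sup>+x. 0 \<partial>(lebesgue :: (real^'n) measure))"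
  proof (rule nn_integral_dominated_convergence[where w="\<lambda>x. ennreal (3 * norm (f x))"])
    show "AE x in lebesgue. ennreal (norm (f x - u i x)) \<le> ennreal (3 * norm (f x))" for i
    proof (intro AE_I2 ennreal_leI)
      fix x
      show "norm (f x - u i x) \<le> 3 * norm (f x)"
        using norm_triangle_ineq4[of "f x" "u i x"] u(3)[of i x] by linarith
    qed
    show "AE x in lebesgue. (\<lambda>i. ennreal (norm (f x - u i x))) \<longlonglongrightarrow> 0"
    proof (intro AE_I2)
      fix x
      have "(\<lambda>i. norm (f x - u i x)) \<longlonglongrightarrow> 0"
        using tendsto_norm_zero[OF LIM_zero[OF u(2)[of x]]] by (simp add: norm_minus_commute)
      then show "(\<lambda>i. ennreal (norm (f x - u i x))) \<longlonglongrightarrow> 0"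
        using tendsto_ennrealI by force
    qed
  qed (use fin3 in auto)
  then have lim: "(\<lambda>i. \<integral>\<^sup>+x. ennreal (norm (f x - u i x)) \<partial>lebesgue) \<longlonglongrightarrow> 0" by simp
  let ?I = "\<lambda>i. simple_integral_lebesgue (u i)"
  have "Cauchy ?I"
  proof (rule metric_CauchyI)
    fix r :: real assume r: "r > 0"
    have "\<forall>\<^sub>F i in sequentially. (\<integral>\<^sup>+x. ennreal (norm (f x - u i x)) \<partial>lebesgue) < ennreal (r/2)"
      using lim r by (intro order_tendstoD) auto
    then obtain N where N: "\<And>i. i \<ge> N \<Longrightarrow> (\<integral>\<^sup>+x. ennreal (norm (f x - u i x)) \<partial>lebesgue) < ennreal (r/2)"
      unfolding eventually_sequentially by blast
    have "dist (?I m) (?I n) < r" if "m \<ge> N" "n \<ge> N" for m n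
    proof -
      have "ennreal (norm (?I m - ?I n)) < ennreal (r/2) + ennreal (r/2)"
        using simple_bochner_integral_dist_le[OF f sbi sbi] N[OF that(1)] N[OF that(2)]
        by (meson add_strict_mono le_less_trans)
      also have "\<dots> = ennreal r" using r by (simp flip: ennreal_plus)
      finally show ?thesis using r by (simp add: dist_norm ennreal_less_iff)
    qed
    then show "\<exists>M. \<forall>m\<ge>M. \<forall>n\<ge>M. dist (?I m) (?I n) < r" by blast
  qed
  then obtain I where "?I \<longlonglongrightarrow> I" using Cauchy_convergent convergent_def by blast
  then show ?thesis unfolding has_strong_integral_def using f sbi lim by blast
qed

section \<open>Seminorms and the Hahn-Banach theorem\<close>

text \<open>Baire's theorem: the closed sublevel sets of integer levels exhaust the space, so one of
  them contains a ball around some a. Subtracting a gives q <= 2 n on a ball around 0, and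
  homogeneity does the rest. It is applied to \<open>rho\<close>, whose continuity is not known
  beforehand.\<close>

lemma lower_semicontinuous_seminorm_bounded:
  fixes q :: "'x::banach \<Rightarrow> real"
  assumes add: "\<And>x y. q (x + y) \<le> q x + q y" and scale: "\<And>r x. q (r *\<^sub>R x) = \<bar>r\<bar> * q x"
    and closed: "\<And>c. closed {x. q x \<le> c}"
  shows "\<exists>K>0. \<forall>x. q x \<le> K * norm x"
proof -
  have "\<exists>n::nat. \<exists>a r. r > 0 \<and> ball a r \<subseteq> {x. q x \<le> real n}"
  proof (rule ccontr)
    assume no: "\<not> ?thesis"
    have "Met_TC.mtopology closure_of \<Inter>(range (\<lambda>n::nat. - {x. q x \<le> real n})) = (UNIV :: 'x set)"
    proof (rule Met_TC.metric_Baire_category)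
      fix T assume "T \<in> range (\<lambda>n::nat. - {x. q x \<le> real n})"
      then obtain n :: nat where T: "T = - {x. q x \<le> real n}" by blast
      have "closure T = UNIV"
      proof -
        have "interior {x. q x \<le> real n} = {}"
          using no unfolding interior_def by (force simp: open_contains_ball)
        then show ?thesis unfolding T closure_complement by simp
      qed
      then show "openin Met_TC.mtopology T \<and> Met_TC.mtopology closure_of T = (UNIV :: 'x set)"
        using closed[of "real n"] unfolding T by (simp add: open_Compl)
    qed (auto simp: complete_UNIV)
    moreover have "\<Inter>(range (\<lambda>n::nat. - {x. q x \<le> real n})) = {}"
      using real_arch_simple by blast
    ultimately show False by simp
  qed
  then obtain n :: nat and a r where r: "r > 0" "ball a r \<subseteq> {x. q x \<le> real n}" by blast
  have qm: "q (- x) = q x" for x using scale[of "-1" x] by simp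
  have small: "q x \<le> 2 * real n" if "norm x < r" for x
  proof -
    have "a + x \<in> ball a r" "a \<in> ball a r" using that r(1) by (auto simp: dist_norm)
    then have "q (a + x) \<le> real n" "q a \<le> real n" using r(2) by blast+
    then show ?thesis using add[of "a + x" "- a"] qm[of a] by simp
  qed
  have "q x \<le> (4 * real n / r + 1) * norm x" for x
  proof (cases "x = 0")
    case True
    then show ?thesis using scale[of 0 x] by simp
  next
    case False
    define t where "t = r / (2 * norm x)"
    have t: "t > 0" using False r(1) by (simp add: t_def)
    have "norm (t *\<^sub>R x) < r" using False r(1) by (simp add: t_def)
    then have "t * q x \<le> 2 * real n" using small[of "t *\<^sub>R x"] scale[of t x] t by simp
    then have "q x \<le> 2 * real n / t" using t by (simp add: field_simps)
    also have "\<dots> = (4 * real n / r) * norm x" using False r(1) by (simp add: t_def)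
    finally show ?thesis by (simp add: distrib_right add_increasing2)
  qed
  moreover have "4 * real n / r + 1 > 0" using r(1) by (simp add: add_nonneg_pos)
  ultimately show ?thesis by blast
qed

section \<open>The Hahn-Banach theorem via minimal sublinear functionals\<close>

definition sublinear :: "('x::real_vector \<Rightarrow> real) \<Rightarrow> bool"
  where "sublinear p \<longleftrightarrow> (\<forall>x y. p (x + y) \<le> p x + p y) \<and> (\<forall>r\<ge>0. \<forall>x. p (r *\<^sub>R x) = r * p x)"

text \<open>Applying the inequality for multiples to 1 / r and r x reverses it. Infima yield just
  the one inequality.\<close>

lemma sublinearI:
  assumes add: "\<And>x y. p (x + y) \<le> p x + p y" and zero: "p 0 = 0"
    and scale: "\<And>r x. r > 0 \<Longrightarrow> p (r *\<^sub>R x) \<le> r * p x"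
  shows "sublinear p"
proof -
  have "p (r *\<^sub>R x) = r * p x" if "r \<ge> 0" for r x
  proof (cases "r = 0")
    case False
    then have r: "r > 0" using that by simp
    have "p ((1/r) *\<^sub>R (r *\<^sub>R x)) \<le> (1/r) * p (r *\<^sub>R x)"
      using r by (intro scale) simp
    then have "r * p x \<le> p (r *\<^sub>R x)" using r by (simp add: field_simps)
    then show ?thesis using scale[OF r, of x] by simp
  qed (simp add: zero)
  then show ?thesis using add by (simp add: sublinear_def)
qed

lemma sublinear_zero:
  assumes "sublinear p"
  shows "p 0 = 0"
proof -
  have "p (0 *\<^sub>R 0) = 0 * p 0" using assms unfolding sublinear_def by blast
  then show ?thesis by simp
qed

lemma sublinear_minus:
  assumes "sublinear p"
  shows "- p (- x) \<le> p x"
proof -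
  have "p (x + (- x)) \<le> p x + p (- x)" using assms unfolding sublinear_def by blast
  then show ?thesis using sublinear_zero[OF assms] by simp
qed

text \<open>The largest sublinear functional below a sublinear p whose value at -y is at most -p y:
  t = 0 gives the bound by p, and t = 1 at x = -y gives the second.\<close>

definition lowering :: "('x::real_vector \<Rightarrow> real) \<Rightarrow> 'x \<Rightarrow> 'x \<Rightarrow> real"
  where "lowering p y x = (INF t\<in>{0..}. p (x + t *\<^sub>R y) - t * p y)"

lemma lowering_le:
  assumes p: "sublinear p" and t: "t \<ge> 0"
  shows "lowering p y x \<le> p (x + t *\<^sub>R y) - t * p y"
  unfolding lowering_def
proof (rule cINF_lower)
  \<comment> \<open>A lower bound independent of t, so that the infimum over the reals is a genuine
    one.\<close>
  have "- p (- x) \<le> p (x + t *\<^sub>R y) - t * p y" if "t \<ge> 0" for t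
  proof -
    have "p (t *\<^sub>R y) \<le> p (x + t *\<^sub>R y) + p (- x)"
    proof -
      have "p ((x + t *\<^sub>R y) + (- x)) \<le> p (x + t *\<^sub>R y) + p (- x)"
        using p unfolding sublinear_def by blast
      then show ?thesis by simp
    qed
    then show ?thesis using p that by (simp add: sublinear_def)
  qed
  then show "bdd_below ((\<lambda>t. p (x + t *\<^sub>R y) - t * p y) ` {0..})"
    by (intro bdd_belowI2[of _ "- p (- x)"]) auto
qed (use t in auto)

lemma lowering_ge:
  assumes "\<And>t. t \<ge> 0 \<Longrightarrow> m \<le> p (x + t *\<^sub>R y) - t * p y"
  shows "m \<le> lowering p y x"
  unfolding lowering_def using assms by (intro cINF_greatest) auto

text \<open>Parameters t and t' for two vectors combine to t + t' for their sum, and t becomes r t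
  for a multiple.\<close>

lemma lowering_sublinear:
  assumes p: "sublinear p"
  shows "sublinear (lowering p y)"
proof (rule sublinearI)
  fix x x'
  have "lowering p y (x + x') - (p (x + t *\<^sub>R y) - t * p y) \<le> p (x' + t' *\<^sub>R y) - t' * p y"
    if "t \<ge> 0" "t' \<ge> 0" for t t'
  proof -
    have "lowering p y (x + x') \<le> p ((x + x') + (t + t') *\<^sub>R y) - (t + t') * p y"
      using that by (intro lowering_le p) simp
    moreover have "p ((x + t *\<^sub>R y) + (x' + t' *\<^sub>R y)) \<le> p (x + t *\<^sub>R y) + p (x' + t' *\<^sub>R y)"
      using p unfolding sublinear_def by blast
    moreover have "(x + x') + (t + t') *\<^sub>R y = (x + t *\<^sub>R y) + (x' + t' *\<^sub>R y)"
      by (simp add: algebra_simps)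
    ultimately show ?thesis by (simp add: algebra_simps)
  qed
  then have "lowering p y (x + x') - (p (x + t *\<^sub>R y) - t * p y) \<le> lowering p y x'" if "t \<ge> 0" for t
    using that by (intro lowering_ge) auto
  then have "lowering p y (x + x') - lowering p y x' \<le> p (x + t *\<^sub>R y) - t * p y" if "t \<ge> 0" for t
    using that by (smt (verit))
  then have "lowering p y (x + x') - lowering p y x' \<le> lowering p y x"
    by (rule lowering_ge)
  then show "lowering p y (x + x') \<le> lowering p y x + lowering p y x'" by simp
next
  have "p (0 + t *\<^sub>R y) - t * p y = 0" if "t \<ge> 0" for t
    using p that by (simp add: sublinear_def)
  then have "0 \<le> lowering p y 0" by (intro lowering_ge) simp
  moreover have "lowering p y 0 \<le> 0"
    using lowering_le[OF p order_refl, of y 0] sublinear_zero[OF p] by simp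
  ultimately show "lowering p y 0 = 0" by simp
next
  fix r :: real and x assume r: "r > 0"
  have "lowering p y (r *\<^sub>R x) / r \<le> p (x + t *\<^sub>R y) - t * p y" if t: "t \<ge> 0" for t
  proof -
    have "lowering p y (r *\<^sub>R x) \<le> p (r *\<^sub>R x + (r * t) *\<^sub>R y) - (r * t) * p y"
      using r t by (intro lowering_le p) simp
    also have "r *\<^sub>R x + (r * t) *\<^sub>R y = r *\<^sub>R (x + t *\<^sub>R y)" by (simp add: algebra_simps)
    also have "p \<dots> = r * p (x + t *\<^sub>R y)" using p r by (simp add: sublinear_def)
    finally show ?thesis using r by (simp add: field_simps)
  qed
  then have "lowering p y (r *\<^sub>R x) / r \<le> lowering p y x" by (rule lowering_ge)
  then show "lowering p y (r *\<^sub>R x) \<le> r * lowering p y x" using r by (simp add: field_simps)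
qed

text \<open>A minimal sublinear functional agrees with all its lowerings, which makes it odd.\<close>

lemma minimal_sublinear_imp_linear:
  assumes p: "sublinear p" and min: "\<And>p'. sublinear p' \<Longrightarrow> (\<And>x. p' x \<le> p x) \<Longrightarrow> p' = p"
  shows "linear p"
proof -
  have "p (- y) \<le> - p y" for y
  proof -
    have "lowering p y = p"
      using lowering_le[OF p order_refl, of y] by (intro min lowering_sublinear p) auto
    then show ?thesis
      using lowering_le[OF p zero_le_one, of y "- y"] sublinear_zero[OF p] by simp
  qed
  then have odd: "p (- y) = - p y" for y using sublinear_minus[OF p, of "y"] by (smt (verit))
  have add: "p (x + y) \<le> p x + p y" for x y using p by (simp add: sublinear_def)
  show ?thesis
  proof (rule linearI)
    fix x y
    show "p (x + y) = p x + p y" using add[of x y] add[of "x + y" "- y"] odd by simp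
  next
    fix r x
    show "p (r *\<^sub>R x) = r *\<^sub>R p x"
    proof (cases "r \<ge> 0")
      case True then show ?thesis using p by (simp add: sublinear_def)
    next
      case False
      then have "p ((- r) *\<^sub>R x) = (- r) * p x" using p unfolding sublinear_def
        by (metis neg_0_le_iff_le nle_le)
      then show ?thesis using odd[of "r *\<^sub>R x"] by simp
    qed
  qed
qed

text \<open>Zorn's lemma on the functionals below q. The pointwise infimum of a chain is finite, as
  -q (-x) bounds every member from below at x, and it is subadditive because of two members the
  smaller one serves both points.\<close>

lemma exists_minimal_sublinear:
  assumes q: "sublinear (q :: 'x::real_vector \<Rightarrow> real)"
  shows "\<exists>p. sublinear p \<and> (\<forall>x. p x \<le> q x) \<and> (\<forall>p'. sublinear p' \<longrightarrow> (\<forall>x. p' x \<le> p x) \<longrightarrow> p' = p)"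
proof -
  define A where "A = {p. sublinear p \<and> (\<forall>x. p x \<le> q x)}"
  \<comment> \<open>The order is reversed, so that maximal elements in Zorn's lemma are minimal
    functionals.\<close>
  define R where "R = (\<lambda>p p' :: 'x \<Rightarrow> real. \<forall>x. p' x \<le> p x)"
  have "\<exists>m\<in>A. \<forall>a\<in>A. R m a \<longrightarrow> a = m"
  proof (rule predicate_Zorn)
    show "partial_order_on A (relation_of R A)"
      unfolding partial_order_on_def preorder_on_def refl_on_def trans_def antisym_def relation_of_def R_def
      by (auto simp: fun_eq_iff intro: order_trans antisym)
    fix C assume "C \<in> Chains (relation_of R A)"
    then have CA: "C \<subseteq> A" and ch: "\<And>p p'. p \<in> C \<Longrightarrow> p' \<in> C \<Longrightarrow> R p p' \<or> R p' p"
      unfolding Chains_def relation_of_def by auto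
    show "\<exists>u\<in>A. \<forall>a\<in>C. R a u"
    proof (cases "C = {}")
      case True then show ?thesis using q unfolding A_def by auto
    next
      case False
      define u where "u x = (INF p\<in>C. p x)" for x
      have sub: "sublinear p" and leq: "p x \<le> q x" if "p \<in> C" for p x using that CA unfolding A_def by auto
      have "- q (- x) \<le> p x" if "p \<in> C" for p x
        using sublinear_minus[OF sub[OF that], of x] leq[OF that, of "- x"] by simp
      then have "bdd_below ((\<lambda>p. p x) ` C)" for x by (intro bdd_belowI2[of _ "- q (- x)"]) auto
      then have low: "u x \<le> p x" if "p \<in> C" for p x unfolding u_def using that by (intro cINF_lower)
      have great: "m \<le> u x" if "\<And>p. p \<in> C \<Longrightarrow> m \<le> p x" for m x
        unfolding u_def using that False by (intro cINF_greatest)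
      have "sublinear u"
      proof (rule sublinearI)
        fix x y
        have "u (x + y) - p1 x \<le> p2 y" if p12: "p1 \<in> C" "p2 \<in> C" for p1 p2
        proof -
          obtain p where "p \<in> C" "p x \<le> p1 x" "p y \<le> p2 y"
            using ch[OF p12] p12 unfolding R_def by blast
          moreover have "p (x + y) \<le> p x + p y" using sub[OF \<open>p \<in> C\<close>] by (simp add: sublinear_def)
          moreover have "u (x + y) \<le> p (x + y)" using low[OF \<open>p \<in> C\<close>] .
          ultimately show ?thesis by linarith
        qed
        then have "u (x + y) - p1 x \<le> u y" if "p1 \<in> C" for p1 using that by (intro great)
        then have "u (x + y) - u y \<le> u x" by (intro great) (smt (verit))
        then show "u (x + y) \<le> u x + u y" by simp
      next
        have "0 \<le> u 0" by (intro great) (simp add: sublinear_zero[OF sub])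
        moreover have "u 0 \<le> 0" using False low sublinear_zero[OF sub] by (metis ex_in_conv)
        ultimately show "u 0 = 0" by simp
      next
        fix r :: real and x assume r: "r > 0"
        have "u (r *\<^sub>R x) / r \<le> u x"
        proof (rule great)
          fix p assume "p \<in> C"
          then have "u (r *\<^sub>R x) \<le> r * p x" using low[of p "r *\<^sub>R x"] sub[of p] r by (simp add: sublinear_def)
          then show "u (r *\<^sub>R x) / r \<le> p x" using r by (simp add: field_simps)
        qed
        then show "u (r *\<^sub>R x) \<le> r * u x" using r by (simp add: field_simps)
      qed
      moreover have "u x \<le> q x" for x using False low leq by (metis ex_in_conv order_trans)
      ultimately have "u \<in> A" unfolding A_def by simp
      then show ?thesis using low unfolding R_def by blast
    qed
  qed
  then obtain m where m: "m \<in> A" "\<And>a. a \<in> A \<Longrightarrow> R m a \<Longrightarrow> a = m" by blast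
  have "p' = m" if "sublinear p'" "\<forall>x. p' x \<le> m x" for p'
  proof (rule m(2))
    show "p' \<in> A" using m(1) that unfolding A_def by (auto intro: order_trans)
    show "R m p'" using that unfolding R_def by simp
  qed
  then show ?thesis using m(1) unfolding A_def by blast
qed

text \<open>Descending from the lowering of q at e instead of from q fixes the value at e: a linear
  g below the lowering has g (-e) <= -q e, hence g e >= q e.\<close>

theorem Hahn_Banach_seminorm:
  fixes q :: "'x::real_vector \<Rightarrow> real"
  assumes q: "sublinear q"
  shows "\<exists>g. linear g \<and> (\<forall>x. g x \<le> q x) \<and> g e = q e"
proof -
  obtain g where g: "sublinear g" "\<And>x. g x \<le> lowering q e x"
    "\<And>p'. sublinear p' \<Longrightarrow> (\<And>x. p' x \<le> g x) \<Longrightarrow> p' = g"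
    using exists_minimal_sublinear[OF lowering_sublinear[OF q, of e]] by blast
  have lin: "linear g" using g by (intro minimal_sublinear_imp_linear) auto
  have le: "g x \<le> q x" for x using g(2)[of x] lowering_le[OF q order_refl, of e x] by simp
  have "g (- e) \<le> - q e"
    using g(2)[of "- e"] lowering_le[OF q zero_le_one, of e "- e"] sublinear_zero[OF q] by simp
  then have "q e \<le> g e" using linear_neg[OF lin, of e] by simp
  then show ?thesis using lin le by (meson antisym)
qed

text \<open>
  The trace form \<open>(c, d) \<mapsto> (c * d) \<bullet> 1\<close> of the scalar field is nondegenerate, so every real
  functional is the trace of a scalar-linear one. This costs a constant depending on the field only.
\<close>

theorem Hahn_Banach_dual_space:
  fixes s :: "'k::{real_normed_field,euclidean_space} \<Rightarrow> 'x::banach \<Rightarrow> 'x"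
  assumes "banach_scaling s"
  shows "\<exists>\<kappa>>0. \<forall>q K e. (\<forall>x y. q (x + y) \<le> q x + q y) \<longrightarrow> (\<forall>c x. q (s c x) = norm c * q x) \<longrightarrow>
    (\<forall>x. q x \<le> K * norm x) \<longrightarrow>
    (\<exists>\<phi>\<in>dual_space s. (\<forall>x. norm (blinfun_apply \<phi> x) \<le> \<kappa> * q x) \<and> q e \<le> norm (blinfun_apply \<phi> e))"
proof -
  interpret vs: vector_space s using assms by (simp add: banach_scaling_def)
  have sr: "s (of_real r) x = r *\<^sub>R x" for r x using assms by (simp add: banach_scaling_def)
  have sc: "s (r *\<^sub>R c) x = r *\<^sub>R s c x" for r c x
    using sr[of r] by (simp add: scaleR_conv_of_real flip: vs.scale_scale)
  have sc': "s c (r *\<^sub>R x) = r *\<^sub>R s c x" for r c x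
    by (metis sr vs.scale_left_commute)
  have lin_s: "linear (\<lambda>d. s d x)" for x
    by (intro linearI) (auto simp: vs.scale_left_distrib sc)
  have lin_s': "linear (s d)" for d
    by (intro linearI) (auto simp: vs.scale_right_distrib sc')
  have one: "(1::'k) \<bullet> 1 = 1" by (simp add: dot_square_norm)
  \<comment> \<open>\<open>L c\<close> holds the coordinates of the real functional that sends d to
    (c * d) \<bullet> 1. Nondegeneracy makes \<open>L\<close> injective, and its inverse
    \<open>M\<close> finds the scalar with prescribed traces.\<close>
  define L :: "'k \<Rightarrow> 'k" where "L c = (\<Sum>b\<in>Basis. ((c * b) \<bullet> 1) *\<^sub>R b)" for c
  have Lb: "L c \<bullet> b = (c * b) \<bullet> 1" if "b \<in> Basis" for b c
    using that unfolding L_def by simp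
  have linL: "linear L" unfolding L_def
    by (intro linearI) (auto simp: algebra_simps inner_add_left sum.distrib scaleR_sum_right)
  have trace: "(c * d) \<bullet> 1 = (\<Sum>b\<in>Basis. (d \<bullet> b) * (L c \<bullet> b))" for c d
  proof -
    have "c * d = c * (\<Sum>b\<in>Basis. (d \<bullet> b) *\<^sub>R b)" by (simp only: euclidean_representation)
    also have "\<dots> \<bullet> 1 = (\<Sum>b\<in>Basis. (d \<bullet> b) * (L c \<bullet> b))"
      by (simp add: sum_distrib_left inner_sum_left Lb)
    finally show ?thesis .
  qed
  have nondeg: "c = 0" if "L c = 0" for c
  proof (rule ccontr)
    assume "c \<noteq> 0"
    then have "(c * inverse c) \<bullet> 1 = 1" using one by simp
    then show False using trace[of c "inverse c"] that by simp
  qed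
  then have "inj L" using linL by (simp add: linear_injective_0)
  then obtain M where M: "linear M" "\<And>x. M (L x) = x" "\<And>x. L (M x) = x"
    using linear_injective_isomorphism[OF linL] by blast
  obtain B where B: "B > 0" "\<And>x. norm (M x) \<le> B * norm x"
    using linear_bounded_pos[OF M(1)] by blast
  \<comment> \<open>B bounds \<open>M\<close>, and the dimension counts the basis elements, each
    contributing at most q x because it has norm 1.\<close>
  define \<kappa> where "\<kappa> = B * real DIM('k)"
  have "\<exists>\<phi>\<in>dual_space s. (\<forall>x. norm (blinfun_apply \<phi> x) \<le> \<kappa> * q x) \<and> q e \<le> norm (blinfun_apply \<phi> e)"
    if q: "\<forall>x y. q (x + y) \<le> q x + q y" "\<forall>c x. q (s c x) = norm c * q x" "\<forall>x. q x \<le> K * norm x"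
    for q K e
  proof -
    have "q (r *\<^sub>R x) = \<bar>r\<bar> * q x" for r x using q(2) sr[of r x] by (metis norm_of_real)
    then have "sublinear q" using q(1) by (simp add: sublinear_def)
    then obtain g where g: "linear g" "\<And>x. g x \<le> q x" "g e = q e"
      using Hahn_Banach_seminorm by blast
    interpret g: linear g by fact
    have qneg: "q (- x) = q x" for x using q(2) by (metis norm_minus_cancel norm_one mult_1 vs.scale_minus_left vs.scale_one)
    have gabs: "\<bar>g x\<bar> \<le> q x" for x using g(2)[of x] g(2)[of "- x"] qneg by (simp add: g.neg abs_le_iff)
    \<comment> \<open>The traces of the scalar \<phi> x against the basis are prescribed to be g (s
      b x), so that \<phi> x times d has trace g (s d x) for every d.\<close>
    define v :: "'x \<Rightarrow> 'k" where "v x = (\<Sum>b\<in>Basis. g (s b x) *\<^sub>R b)" for x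
    have linv: "linear v" unfolding v_def
      by (intro linearI) (auto simp: vs.scale_right_distrib sc' g.add g.scale scaleR_left_distrib sum.distrib scaleR_sum_right)
    have normv: "norm (v x) \<le> real DIM('k) * q x" for x
    proof -
      have "norm (v x) \<le> (\<Sum>b\<in>(Basis::'k set). norm (g (s b x) *\<^sub>R b))" unfolding v_def by (rule norm_sum)
      also have "\<dots> \<le> (\<Sum>b\<in>(Basis::'k set). q x)"
      proof (rule sum_mono)
        fix b :: 'k assume "b \<in> Basis"
        then show "norm (g (s b x) *\<^sub>R b) \<le> q x" using gabs[of "s b x"] q(2) by simp
      qed
      finally show ?thesis by simp
    qed
    define \<phi> where "\<phi> x = M (v x)" for x
    have nphi: "norm (\<phi> x) \<le> \<kappa> * q x" for x
      using order_trans[OF B(2)[of "v x"] mult_left_mono[OF normv[of x], of B]] B(1)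
      unfolding \<phi>_def \<kappa>_def by (simp add: mult.assoc)
    have rep: "(\<phi> x * d) \<bullet> 1 = g (s d x)" for x d
    proof -
      have "(\<phi> x * d) \<bullet> 1 = (\<Sum>b\<in>Basis. (d \<bullet> b) * g (s b x))"
        unfolding trace \<phi>_def M(3) v_def by (intro sum.cong) auto
      also have "\<dots> = g (s (\<Sum>b\<in>Basis. (d \<bullet> b) *\<^sub>R b) x)"
        by (simp add: linear_sum[OF lin_s] sc g.sum g.scale del: euclidean_representation)
      finally show ?thesis by (simp only: euclidean_representation)
    qed
    have lin\<phi>: "linear \<phi>" unfolding \<phi>_def using linear_compose[OF linv M(1)] by (simp add: o_def)
    have bl: "bounded_linear \<phi>"
    proof (rule bounded_linear_intro[where K="\<kappa> * K"])
      show "norm (\<phi> x) \<le> norm x * (\<kappa> * K)" for x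
        using order_trans[OF nphi[of x] mult_left_mono[OF q(3)[rule_format, of x], of \<kappa>]] B(1)
        by (simp add: \<kappa>_def ac_simps)
    qed (auto simp: linear_add[OF lin\<phi>] linear_scale[OF lin\<phi>])
    have uniq: "c = c'" if "\<And>d. (c * d) \<bullet> 1 = (c' * d) \<bullet> 1" for c c' :: 'k
    proof -
      have "L c = L c'" unfolding L_def using that by simp
      then show ?thesis by (metis M(2))
    qed
    \<comment> \<open>Both sides have trace g (s (c * d) x) against every d, which determines the
      scalar.\<close>
    have "\<phi> (s c x) = c * \<phi> x" for c x
      by (rule uniq) (metis rep vs.scale_scale mult.assoc mult.commute)
    then have "Blinfun \<phi> \<in> dual_space s" unfolding dual_space_def by (simp add: bounded_linear_Blinfun_apply[OF bl])
    moreover have "q e \<le> norm (\<phi> e)"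
      using rep[of e 1] norm_cauchy_schwarz[of "\<phi> e" 1] g(3) by simp
    ultimately show ?thesis using nphi bounded_linear_Blinfun_apply[OF bl] by (intro bexI[of _ "Blinfun \<phi>"]) auto
  qed
  moreover have "\<kappa> > 0" using B(1) by (simp add: \<kappa>_def)
  ultimately show ?thesis by (intro exI[of _ \<kappa>]) blast
qed

section \<open>Inequalities for scalar functions\<close>

lemmas integrable_dominated = Bochner_Integration.integrable_bound

text \<open>Young's inequality for the functions divided by their norms. If a norm vanishes, so does
  the product almost everywhere.\<close>

lemma Hoelder_integral:
  fixes f g :: "'a \<Rightarrow> real"
  assumes p: "1 < p" and [measurable]: "f \<in> borel_measurable M" "g \<in> borel_measurable M"
    and nn: "\<And>x. 0 \<le> f x" "\<And>x. 0 \<le> g x"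
    and int: "integrable M (\<lambda>x. f x powr p)" "integrable M (\<lambda>x. g x powr (p / (p - 1)))"
  shows "integrable M (\<lambda>x. f x * g x)"
    and "(\<integral>x. f x * g x \<partial>M) \<le>
      (\<integral>x. f x powr p \<partial>M) powr (1 / p) * (\<integral>x. g x powr (p / (p - 1)) \<partial>M) powr ((p - 1) / p)"
proof -
  define q where "q = p / (p - 1)"
  have q: "1 < q" "1 / p + 1 / q = 1" and iq: "1 / q = (p - 1) / p"
    using p by (auto simp: q_def field_simps)
  have young: "f x * g x \<le> f x powr p / p + g x powr q / q" for x
    by (rule Youngs_inequality[OF p q nn])
  have int2: "integrable M (\<lambda>x. g x powr q)" using int(2) by (simp add: q_def)
  show fg: "integrable M (\<lambda>x. f x * g x)"
  proof (rule integrable_dominated)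
    show "integrable M (\<lambda>x. f x powr p / p + g x powr q / q)"
      using int(1) int2 by simp
    show "AE x in M. norm (f x * g x) \<le> norm (f x powr p / p + g x powr q / q)"
      using young nn by (intro AE_I2) (smt (verit) mult_nonneg_nonneg real_norm_def)
  qed measurable
  define A B where "A = (\<integral>x. f x powr p \<partial>M)" and "B = (\<integral>x. g x powr q \<partial>M)"
  have AB: "0 \<le> A" "0 \<le> B" by (simp_all add: A_def B_def)
  have "(\<integral>x. f x * g x \<partial>M) \<le> A powr (1 / p) * B powr (1 / q)"
  proof (cases "A = 0 \<or> B = 0")
    case True
    have "AE x in M. f x * g x = 0"
    proof (cases "A = 0")
      case True
      then have "AE x in M. f x powr p = 0"
        using integral_nonneg_eq_0_iff_AE[OF int(1)] by (simp add: A_def)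
      then show ?thesis by eventually_elim simp
    next
      case False
      then have "AE x in M. g x powr q = 0"
        using True integral_nonneg_eq_0_iff_AE[OF int2] by (simp add: B_def)
      then show ?thesis by eventually_elim simp
    qed
    then have "(\<integral>x. f x * g x \<partial>M) = 0" by (rule integral_eq_zero_AE)
    then show ?thesis by simp
  next
    case False
    then have AB: "0 < A" "0 < B" using AB by auto
    define a b where "a = A powr (1 / p)" and "b = B powr (1 / q)"
    have ab: "0 < a" "0 < b" "a powr p = A" "b powr q = B"
      using AB p q by (auto simp: a_def b_def powr_powr)
    have "(f x / a) * (g x / b) \<le> f x powr p / A / p + g x powr q / B / q" for x
    proof -
      have "(f x / a) * (g x / b) \<le> (f x / a) powr p / p + (g x / b) powr q / q"
        using nn ab by (intro Youngs_inequality[OF p q]) auto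
      then show ?thesis using nn ab by (simp add: powr_divide)
    qed
    then have "(\<integral>x. (f x / a) * (g x / b) \<partial>M) \<le> (\<integral>x. f x powr p / A / p + g x powr q / B / q \<partial>M)"
      using fg int(1) int2 by (intro integral_mono) (auto simp: )
    also have "\<dots> = (\<integral>x. f x powr p / A / p \<partial>M) + (\<integral>x. g x powr q / B / q \<partial>M)"
      using int(1) int2 by (intro Bochner_Integration.integral_add) auto
    also have "\<dots> = 1 / p + 1 / q" using AB by (simp add: A_def[symmetric] B_def[symmetric])
    finally have "(\<integral>x. (f x / a) * (g x / b) \<partial>M) \<le> 1" using q by simp
    moreover have "(\<lambda>x. (f x / a) * (g x / b)) = (\<lambda>x. f x * g x / (a * b))" by (auto simp: field_simps)
    ultimately have "(\<integral>x. f x * g x \<partial>M) / (a * b) \<le> 1" by simp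
    then show ?thesis using ab by (simp add: a_def b_def field_simps)
  qed
  then show "(\<integral>x. f x * g x \<partial>M) \<le>
      (\<integral>x. f x powr p \<partial>M) powr (1 / p) * (\<integral>x. g x powr (p / (p - 1)) \<partial>M) powr ((p - 1) / p)"
    by (simp only: A_def B_def iq flip: q_def)
qed

text \<open>Hoelder's inequality for counting measure, with v split into \<eta>^((1-p)/p) v and
  \<eta>^((p-1)/p). When the sum of the \<eta> stays bounded, a power of a sum is traded for a sum
  of powers at the cost of the weights \<eta>^(1-p).\<close>

lemma weighted_sum_powr_le:
  fixes v \<eta> :: "'i \<Rightarrow> real"
  assumes p: "1 < p" and F: "finite F" and nn: "\<And>i. i \<in> F \<Longrightarrow> 0 < \<eta> i" "\<And>i. i \<in> F \<Longrightarrow> 0 \<le> v i"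
  shows "(\<Sum>i\<in>F. v i) powr p \<le> (\<Sum>i\<in>F. \<eta> i) powr (p - 1) * (\<Sum>i\<in>F. \<eta> i powr (1 - p) * v i powr p)"
proof -
  let ?M = "count_space F" and ?q = "p / (p - 1)"
  define f g where "f i = (if i \<in> F then \<eta> i powr ((1 - p) / p) * v i else 0)"
    and "g i = (if i \<in> F then \<eta> i powr ((p - 1) / p) else 0)" for i
  have fg: "f i * g i = v i" and fp: "f i powr p = \<eta> i powr (1 - p) * v i powr p"
    and gq: "g i powr ?q = \<eta> i" if "i \<in> F" for i
  proof -
    show "f i * g i = v i"
      using nn[OF that] that p by (simp add: f_def g_def powr_add[symmetric] ac_simps add_divide_distrib[symmetric])
    show "f i powr p = \<eta> i powr (1 - p) * v i powr p"
      using nn[OF that] that p by (simp add: f_def powr_mult powr_powr)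
    show "g i powr ?q = \<eta> i" using nn[OF that] that p by (simp add: g_def powr_powr)
  qed
  have "(\<integral>i. f i * g i \<partial>?M) \<le> (\<integral>i. f i powr p \<partial>?M) powr (1 / p) * (\<integral>i. g i powr ?q \<partial>?M) powr ((p - 1) / p)"
    using p F nn by (intro Hoelder_integral integrable_count_space) (auto simp: f_def g_def)
  then have "(\<Sum>i\<in>F. v i) \<le> (\<Sum>i\<in>F. \<eta> i powr (1 - p) * v i powr p) powr (1 / p) * (\<Sum>i\<in>F. \<eta> i) powr ((p - 1) / p)"
    using F by (simp add: lebesgue_integral_count_space_finite fg fp gq cong: sum.cong)
  then have "(\<Sum>i\<in>F. v i) powr p \<le> ((\<Sum>i\<in>F. \<eta> i powr (1 - p) * v i powr p) powr (1 / p) * (\<Sum>i\<in>F. \<eta> i) powr ((p - 1) / p)) powr p"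
    using p nn by (intro powr_mono2 sum_nonneg) auto
  also have "\<dots> = (\<Sum>i\<in>F. \<eta> i) powr (p - 1) * (\<Sum>i\<in>F. \<eta> i powr (1 - p) * v i powr p)"
  proof -
    have "(\<Sum>i\<in>F. \<eta> i powr (1 - p) * v i powr p) \<ge> 0" by (intro sum_nonneg) auto
    then show ?thesis using p by (simp add: powr_mult powr_powr)
  qed
  finally show ?thesis .
qed

lemma powr_add_le:
  fixes a b p :: real
  assumes "0 \<le> a" "0 \<le> b" "0 \<le> p"
  shows "(a + b) powr p \<le> 2 powr p * (a powr p + b powr p)"
proof -
  have "(a + b) powr p \<le> (2 * max a b) powr p" using assms by (intro powr_mono2) auto
  also have "\<dots> = 2 powr p * max a b powr p" using assms by (simp add: powr_mult)
  also have "\<dots> \<le> 2 powr p * (a powr p + b powr p)"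
    by (intro mult_left_mono) (auto simp: max_def)
  finally show ?thesis .
qed

lemma integrable_powr_add:
  fixes f g :: "'a \<Rightarrow> real"
  assumes p: "0 < p" and [measurable]: "f \<in> borel_measurable M" "g \<in> borel_measurable M"
    and nn: "\<And>x. 0 \<le> f x" "\<And>x. 0 \<le> g x"
    and int: "integrable M (\<lambda>x. f x powr p)" "integrable M (\<lambda>x. g x powr p)"
  shows "integrable M (\<lambda>x. (f x + g x) powr p)"
proof (rule integrable_dominated)
  show "integrable M (\<lambda>x. 2 powr p * (f x powr p + g x powr p))" using int by simp
  show "AE x in M. norm ((f x + g x) powr p) \<le> norm (2 powr p * (f x powr p + g x powr p))"
    using powr_add_le[OF nn(1) nn(2), of p] p by (intro AE_I2) simp
qed measurable

text \<open>With h = (f + g)^(p-1), Hoelder's inequality applies to f h and g h, and h^(p/(p-1)) is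
  again the integrand on the left.\<close>

lemma Minkowski_integral:
  fixes f g :: "'a \<Rightarrow> real"
  assumes p: "1 < p" and [measurable]: "f \<in> borel_measurable M" "g \<in> borel_measurable M"
    and nn: "\<And>x. 0 \<le> f x" "\<And>x. 0 \<le> g x"
    and int: "integrable M (\<lambda>x. f x powr p)" "integrable M (\<lambda>x. g x powr p)"
  shows "(\<integral>x. (f x + g x) powr p \<partial>M) powr (1 / p) \<le>
    (\<integral>x. f x powr p \<partial>M) powr (1 / p) + (\<integral>x. g x powr p \<partial>M) powr (1 / p)"
proof -
  define h where "h x = (f x + g x) powr (p - 1)" for x
  have [measurable]: "h \<in> borel_measurable M" unfolding h_def by measurable
  have hq: "h x powr (p / (p - 1)) = (f x + g x) powr p" for x
    using p by (simp add: h_def powr_powr)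
  have split: "(f x + g x) powr p = f x * h x + g x * h x" for x
    using nn[of x] powr_mult_base[of "f x + g x" "p - 1"] by (simp add: h_def distrib_right)
  note int' = integrable_powr_add[OF _ assms(2,3) nn int]
  define S where "S = (\<integral>x. (f x + g x) powr p \<partial>M)"
  have fh: "integrable M (\<lambda>x. f x * h x)"
    "(\<integral>x. f x * h x \<partial>M) \<le> (\<integral>x. f x powr p \<partial>M) powr (1 / p) * S powr ((p - 1) / p)"
    using Hoelder_integral[OF p, of f M h, unfolded hq] p nn int int' by (auto simp: S_def h_def)
  have gh: "integrable M (\<lambda>x. g x * h x)"
    "(\<integral>x. g x * h x \<partial>M) \<le> (\<integral>x. g x powr p \<partial>M) powr (1 / p) * S powr ((p - 1) / p)"
    using Hoelder_integral[OF p, of g M h, unfolded hq] p nn int int' by (auto simp: S_def h_def)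
  have "S = (\<integral>x. f x * h x \<partial>M) + (\<integral>x. g x * h x \<partial>M)"
    unfolding S_def split using fh(1) gh(1) by (rule Bochner_Integration.integral_add)
  then have le: "S \<le> ((\<integral>x. f x powr p \<partial>M) powr (1 / p) + (\<integral>x. g x powr p \<partial>M) powr (1 / p)) * S powr ((p - 1) / p)"
    using fh(2) gh(2) by (simp add: distrib_right)
  have "S \<ge> 0" by (simp add: S_def)
  show ?thesis
  proof (cases "S = 0")
    case False
    then have S: "S > 0" using \<open>S \<ge> 0\<close> by simp
    have "S = S powr (1 / p) * S powr ((p - 1) / p)"
      using S p by (simp flip: powr_add add_divide_distrib)
    then have "S powr (1 / p) * S powr ((p - 1) / p) \<le>
      ((\<integral>x. f x powr p \<partial>M) powr (1 / p) + (\<integral>x. g x powr p \<partial>M) powr (1 / p)) * S powr ((p - 1) / p)"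
      using le by simp
    then show ?thesis using S unfolding S_def[symmetric] by (simp add: mult_le_cancel_right_pos)
  qed (simp add: S_def[symmetric])
qed

section \<open>Families of nested or disjoint sets\<close>

text \<open>In a finite chain the number of members strictly below a given one takes the values 0,
  ..., card C - 1 once each.\<close>

lemma sum_power_card_chain:
  fixes z :: "'a::comm_semiring_1"
  assumes C: "finite C" and chain: "\<And>A B. A \<in> C \<Longrightarrow> B \<in> C \<Longrightarrow> A \<subseteq> B \<or> B \<subseteq> A"
  shows "(\<Sum>A\<in>C. z ^ card {B\<in>C. B \<subset> A}) = (\<Sum>i<card C. z ^ i)"
proof -
  define r where "r A = card {B\<in>C. B \<subset> A}" for A
  have less: "r A < r B" if "A \<in> C" "A \<subset> B" for A B
    unfolding r_def using C that by (intro psubset_card_mono) auto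
  have inj: "inj_on r C"
    by (rule inj_onI) (metis chain less less_irrefl psubsetI)
  have "r ` C \<subseteq> {..<card C}"
  proof safe
    fix A assume "A \<in> C"
    then show "r A < card C" unfolding r_def using C by (intro psubset_card_mono) auto
  qed
  then have "r ` C = {..<card C}" using card_image[OF inj] by (intro card_subset_eq) auto
  then have "(\<Sum>i<card C. z ^ i) = (\<Sum>A\<in>C. z ^ r A)"
    using sum.reindex[OF inj, of "\<lambda>i. z ^ i"] by simp
  then show ?thesis by (simp add: r_def)
qed

definition laminar :: "'a set set \<Rightarrow> bool"
  where "laminar F \<longleftrightarrow> (\<forall>Q\<in>F. \<forall>R\<in>F. Q \<inter> R = {} \<or> Q \<subseteq> R \<or> R \<subseteq> Q)"

text \<open>The number n(Q,x) of the overview. It counts from below: for a finite laminar F the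
  smallest member at x has depth 0, and the depths of the members at x are consecutive.\<close>

definition depth :: "'a set set \<Rightarrow> 'a set \<Rightarrow> 'a \<Rightarrow> nat"
  where "depth F Q x = card {R\<in>F. x \<in> R \<and> R \<subset> Q}"

text \<open>The members at x strictly inside Q form a chain whose ranks are their own depths, so the
  sum is geometric: z^n - 1 = (z - 1) (1 + ... + z^(n-1)).\<close>

lemma power_depth:
  fixes z :: real
  assumes F: "finite F" "laminar F"
  shows "indicator Q x * z ^ depth F Q x =
    indicator Q x + (z - 1) * (\<Sum>R\<in>{R\<in>F. R \<subset> Q}. indicator R x * z ^ depth F R x)"
proof (cases "x \<in> Q")
  case True
  let ?C = "{R\<in>F. x \<in> R \<and> R \<subset> Q}"
  have "(\<Sum>R\<in>{R\<in>F. R \<subset> Q}. indicator R x * z ^ depth F R x) = (\<Sum>R\<in>?C. z ^ depth F R x)"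
    using F(1) by (intro sum.mono_neutral_cong_right) (auto simp: indicator_def split: if_splits)
  also have "\<dots> = (\<Sum>R\<in>?C. z ^ card {B\<in>?C. B \<subset> R})"
    unfolding depth_def by (intro sum.cong refl arg_cong[where f="\<lambda>A. z ^ card A"]) auto
  also have "\<dots> = (\<Sum>i<card ?C. z ^ i)"
    using F by (intro sum_power_card_chain) (auto simp: laminar_def)
  finally show ?thesis
    using True power_diff_1_eq[of z "card ?C"] by (simp add: depth_def)
next
  case False
  then have "(\<Sum>R\<in>{R\<in>F. R \<subset> Q}. indicator R x * z ^ depth F R x) = 0"
    by (intro sum.neutral) (auto simp: indicator_def)
  then show ?thesis using False by simp
qed

lemma sum_power_depth_le:
  fixes z :: real
  assumes F: "finite F" "laminar F" and z: "0 \<le> z" "z < 1"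
  shows "(\<Sum>Q\<in>F. indicator Q x * z ^ depth F Q x) \<le> 1 / (1 - z)"
proof -
  let ?C = "{R\<in>F. x \<in> R}"
  have "(\<Sum>Q\<in>F. indicator Q x * z ^ depth F Q x) = (\<Sum>Q\<in>?C. z ^ depth F Q x)"
    using F(1) by (intro sum.mono_neutral_cong_right) (auto simp: indicator_def split: if_splits)
  also have "\<dots> = (\<Sum>R\<in>?C. z ^ card {B\<in>?C. B \<subset> R})"
    unfolding depth_def by (intro sum.cong refl arg_cong[where f="\<lambda>A. z ^ card A"]) auto
  also have "\<dots> = (\<Sum>i<card ?C. z ^ i)"
    using F by (intro sum_power_card_chain) (auto simp: laminar_def)
  also have "\<dots> = (1 - z ^ card ?C) / (1 - z)" using z by (simp add: sum_gp_strict)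
  also have "\<dots> \<le> 1 / (1 - z)" using z by (intro divide_right_mono) auto
  finally show ?thesis .
qed

lemma depth_le_card: "finite F \<Longrightarrow> depth F Q x \<le> card F"
  unfolding depth_def by (intro card_mono) auto

lemma depth_measurable:
  assumes F: "finite F" "F \<subseteq> sets M"
  shows "depth F Q \<in> measurable M (count_space UNIV)"
proof -
  have "depth F Q = (\<lambda>x. \<Sum>R\<in>{R\<in>F. R \<subset> Q}. indicator R x)"
  proof
    fix x
    have "(\<Sum>R\<in>{R\<in>F. R \<subset> Q}. indicator R x) = (\<Sum>R\<in>{R\<in>F. x \<in> R \<and> R \<subset> Q}. 1::nat)"
      using F(1) by (intro sum.mono_neutral_cong_right) (auto simp: indicator_def split: if_splits)
    then show "depth F Q x = (\<Sum>R\<in>{R\<in>F. R \<subset> Q}. indicator R x)" by (simp add: depth_def)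
  qed
  moreover have "(\<lambda>x. \<Sum>R\<in>{R\<in>F. R \<subset> Q}. indicator R x :: nat) \<in> borel_measurable M"
    using F by (intro borel_measurable_sum borel_measurable_indicator) auto
  ultimately show ?thesis by (simp add: cong: measurable_cong_sets[OF refl sets_borel_eq_count_space[symmetric]])
qed

text \<open>
  A form of the John-Nirenberg inequality: integrating the identity of \<open>power_depth\<close> gives a
  recursion along the family.
\<close>

lemma exponential_depth_integral:
  fixes w :: "'a \<Rightarrow> real"
  assumes F: "finite F" "laminar F" "F \<subseteq> sets M"
    and w: "w \<in> borel_measurable M" "\<And>x. 0 \<le> w x"
    and int: "\<And>Q. Q \<in> F \<Longrightarrow> integrable M (\<lambda>x. indicator Q x * w x)"
    and C: "0 < C" and packing: "\<And>Q. Q \<in> F \<Longrightarrow>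
      (\<Sum>R\<in>{R\<in>F. R \<subset> Q}. \<integral>x. indicator R x * w x \<partial>M) \<le> C * (\<integral>x. indicator Q x * w x \<partial>M)"
    and z: "z = 1 + 1 / (2 * C)" and Q: "Q \<in> F"
  shows "integrable M (\<lambda>x. indicator Q x * (z ^ depth F Q x * w x))"
    and "(\<integral>x. indicator Q x * (z ^ depth F Q x * w x) \<partial>M) \<le> 2 * (\<integral>x. indicator Q x * w x \<partial>M)"
proof -
  note [measurable] = depth_measurable[OF F(1,3)] w(1)
  have z1: "z \<ge> 1" using z C by simp
  have intd: "integrable M (\<lambda>x. indicator Q x * (z ^ depth F Q x * w x))" if "Q \<in> F" for Q
  proof (rule integrable_dominated)
    show "integrable M (\<lambda>x. z ^ card F * (indicator Q x * w x))" using int[OF that] by simp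
    show "(\<lambda>x. indicator Q x * (z ^ depth F Q x * w x)) \<in> borel_measurable M"
    proof -
      have [measurable]: "Q \<in> sets M" using that F(3) by auto
      show ?thesis by measurable
    qed
    show "AE x in M. norm (indicator Q x * (z ^ depth F Q x * w x)) \<le> norm (z ^ card F * (indicator Q x * w x))"
    proof (rule AE_I2)
      fix x
      have "z ^ depth F Q x \<le> z ^ card F" using z1 depth_le_card[OF F(1)] by (rule power_increasing[rotated])
      then show "norm (indicator Q x * (z ^ depth F Q x * w x)) \<le> norm (z ^ card F * (indicator Q x * w x))"
        using z1 w(2)[of x] by (auto simp: indicator_def abs_mult intro: mult_right_mono)
    qed
  qed
  show "integrable M (\<lambda>x. indicator Q x * (z ^ depth F Q x * w x))" by (rule intd[OF Q])
  show "(\<integral>x. indicator Q x * (z ^ depth F Q x * w x) \<partial>M) \<le> 2 * (\<integral>x. indicator Q x * w x \<partial>M)"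
    using Q
  \<comment> \<open>Induction from the minimal sets upwards.\<close>
  proof (induction "card {R\<in>F. R \<subset> Q}" arbitrary: Q rule: less_induct)
    case less
    let ?D = "{R\<in>F. R \<subset> Q}"
    have "indicator Q x * (z ^ depth F Q x * w x) =
        indicator Q x * w x + (z - 1) * (\<Sum>R\<in>?D. indicator R x * (z ^ depth F R x * w x))" for x
      using arg_cong[OF power_depth[OF F(1,2), of Q x z], of "\<lambda>t. t * w x"]
      by (simp add: algebra_simps sum_distrib_left sum_distrib_right)
    then have "(\<integral>x. indicator Q x * (z ^ depth F Q x * w x) \<partial>M) =
        (\<integral>x. indicator Q x * w x + (z - 1) * (\<Sum>R\<in>?D. indicator R x * (z ^ depth F R x * w x)) \<partial>M)"
      by simp
    also have "\<dots> = (\<integral>x. indicator Q x * w x \<partial>M) + (z - 1) * (\<Sum>R\<in>?D. \<integral>x. indicator R x * (z ^ depth F R x * w x) \<partial>M)"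
      using int[OF less.prems] intd by (subst Bochner_Integration.integral_add) auto
    also have "(\<Sum>R\<in>?D. \<integral>x. indicator R x * (z ^ depth F R x * w x) \<partial>M) \<le> (\<Sum>R\<in>?D. 2 * (\<integral>x. indicator R x * w x \<partial>M))"
    proof (rule sum_mono)
      fix R assume R: "R \<in> ?D"
      then have "card {R'\<in>F. R' \<subset> R} < card ?D"
        using F(1) by (intro psubset_card_mono) auto
      then show "(\<integral>x. indicator R x * (z ^ depth F R x * w x) \<partial>M) \<le> 2 * (\<integral>x. indicator R x * w x \<partial>M)"
        using less.hyps[of R] R by simp
    qed
    also have "\<dots> \<le> 2 * (C * (\<integral>x. indicator Q x * w x \<partial>M))"
      using packing[OF less.prems] by (simp flip: sum_distrib_left)
    finally have "(\<integral>x. indicator Q x * (z ^ depth F Q x * w x) \<partial>M) \<le>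
        (\<integral>x. indicator Q x * w x \<partial>M) + (z - 1) * (2 * (C * (\<integral>x. indicator Q x * w x \<partial>M)))"
      using z1 by (simp add: mult_left_mono)
    \<comment> \<open>Since (z - 1) * 2 C = 1, the second term equals the first, and the factor 2
      reproduces itself: this is the origin of z.\<close>
    also have "\<dots> = 2 * (\<integral>x. indicator Q x * w x \<partial>M)" using z C by simp
    finally show ?case .
  qed
qed

section \<open>Cubes\<close>

lemma cube_measure:
  fixes Q :: "(real^'n) set"
  assumes "Q \<in> cubes"
  shows "Q \<in> lmeasurable" "0 < vol Q"
proof -
  obtain a :: "real^'n" and l where Q: "Q = {x. \<forall>i. a $ i \<le> x $ i \<and> x $ i < a $ i + l}" and l: "0 < l"
    using assms unfolding cubes_def by auto
  define b where "b = (\<chi> i. a $ i + l)"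
  have "Q = (\<Inter>i. {x. a $ i \<le> x $ i} \<inter> {x. x $ i < a $ i + l})" unfolding Q by auto
  moreover have "{x. a $ i \<le> x $ i} \<inter> {x. x $ i < a $ i + l} \<in> sets borel" for i
    by (intro sets.Int borel_closed borel_open closed_halfspace_component_ge_cart open_halfspace_component_lt_cart)
  ultimately have "Q \<in> sets borel" by (auto intro!: sets.countable_INT'')
  then have Qs: "Q \<in> sets lebesgue" by simp
  have sub: "box a b \<subseteq> Q" "Q \<subseteq> cbox a b"
    unfolding Q b_def by (auto simp: mem_box_cart less_imp_le)
  show m: "Q \<in> lmeasurable"
    using Qs sub(2) by (rule fmeasurableI2[OF lmeasurable_cbox, rotated -1])
  have "box a b \<noteq> {}" using l by (auto simp: b_def interval_ne_empty_cart)
  then have "0 < vol (box a b)"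
    using open_not_negligible[OF open_box, of a b] negligible_iff_measure0[OF lmeasurable_box, of a b]
    by (metis zero_less_measure_iff)
  also have "\<dots> \<le> vol Q" using sub(1) m by (intro measure_mono_fmeasurable) auto
  finally show "0 < vol Q" .
qed

text \<open>Coding a cube of side 2^(-j) by the integer vector of the floors of 2^j x reduces
  nesting to integer division and countability to that of the codes.\<close>

lemma dyadic_cube_floor:
  "(\<lambda>y. (2 powi (-j)) *\<^sub>R (y + (\<chi> i. of_int (k i)))) ` {y::real^'n. \<forall>i. 0 \<le> y $ i \<and> y $ i < 1}
    = {x. \<forall>i. \<lfloor>2 powi j * x $ i\<rfloor> = k i}"
proof safe
  fix y :: "real^'n" and i assume "\<forall>i. 0 \<le> y $ i \<and> y $ i < 1"
  then show "\<lfloor>2 powi j * ((2 powi (-j)) *\<^sub>R (y + (\<chi> i. of_int (k i)))) $ i\<rfloor> = k i"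
    by (simp add: power_int_minus floor_eq_iff mult.assoc[symmetric])
next
  fix x :: "real^'n" assume x: "\<forall>i. \<lfloor>2 powi j * x $ i\<rfloor> = k i"
  show "x \<in> (\<lambda>y. (2 powi (-j)) *\<^sub>R (y + (\<chi> i. of_int (k i)))) ` {y. \<forall>i. 0 \<le> y $ i \<and> y $ i < 1}"
  proof (rule image_eqI)
    show "x = (2 powi (-j)) *\<^sub>R ((\<chi> i. 2 powi j * x $ i - of_int (k i)) + (\<chi> i. of_int (k i)))"
      by (simp add: vec_eq_iff power_int_minus)
    show "(\<chi> i. 2 powi j * x $ i - of_int (k i)) \<in> {y. \<forall>i. 0 \<le> y $ i \<and> y $ i < 1}"
      using x by (simp add: floor_eq_iff algebra_simps)
  qed
qed

lemma dyadic_cubes_floor: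
  "dyadic_cubes = {{x::real^'n. \<forall>i. \<lfloor>2 powi j * x $ i\<rfloor> = k i} | j k. True}"
  unfolding dyadic_cubes_def dyadic_cube_floor ..

lemma dyadic_cube_in_cubes:
  fixes Q :: "(real^'n) set"
  assumes "Q \<in> dyadic_cubes"
  shows "Q \<in> cubes"
proof -
  obtain j :: int and k where Q: "Q = {x::real^'n. \<forall>i. \<lfloor>2 powi j * x $ i\<rfloor> = k i}"
    using assms unfolding dyadic_cubes_floor by auto
  have "Q = {x. \<forall>i. (\<chi> i. of_int (k i) / 2 powi j) $ i \<le> x $ i \<and>
      x $ i < (\<chi> i. of_int (k i) / 2 powi j) $ i + 1 / 2 powi j}"
    unfolding Q by (auto simp: floor_eq_iff field_simps)
  then show ?thesis unfolding cubes_def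
    by (intro CollectI exI[of _ "\<chi> i. of_int (k i) / 2 powi j"] exI[of _ "1 / 2 powi j"] conjI) auto
qed

text \<open>The floor at a coarser scale is the finer floor divided in the integers by a power of 2.
  Hence the finer code of a common point determines its coarser code, and the finer cube lies inside
  the coarser one.\<close>

lemma laminar_dyadic_cubes: "laminar (dyadic_cubes :: (real^'n) set set)"
proof -
  have nested: "{x::real^'n. \<forall>i. \<lfloor>2 powi j * x $ i\<rfloor> = k i} \<subseteq> {x. \<forall>i. \<lfloor>2 powi j' * x $ i\<rfloor> = k' i}"
    if le: "j' \<le> j" and y: "\<forall>i. \<lfloor>2 powi j * y $ i\<rfloor> = k i" "\<forall>i. \<lfloor>2 powi j' * y $ i\<rfloor> = k' i"
    for j j' :: int and k k' and y :: "real^'n"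
  proof safe
    fix x :: "real^'n" and i assume x: "\<forall>i. \<lfloor>2 powi j * x $ i\<rfloor> = k i"
    define d where "d = nat (j - j')"
    have j: "j = j' + int d" using le by (simp add: d_def)
    have red: "\<lfloor>2 powi j' * t\<rfloor> = \<lfloor>2 powi j * t\<rfloor> div 2 ^ d" for t :: real
    proof -
      have "2 powi j' * t = 2 powi j * t / real_of_int (2 ^ d)"
        unfolding j by (simp add: power_int_add)
      then show ?thesis using floor_divide_real_eq_div[of "2 ^ d" "2 powi j * t"] by simp
    qed
    show "\<lfloor>2 powi j' * x $ i\<rfloor> = k' i"
      using x y red[of "x $ i"] red[of "y $ i"] by simp
  qed
  show ?thesis unfolding laminar_def
  proof (intro ballI)
    fix Q R :: "(real^'n) set" assume QR: "Q \<in> dyadic_cubes" "R \<in> dyadic_cubes"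
    obtain j k where Q: "Q = {x. \<forall>i. \<lfloor>2 powi j * x $ i\<rfloor> = k i}"
      using QR(1) unfolding dyadic_cubes_floor by auto
    obtain j' k' where R: "R = {x. \<forall>i. \<lfloor>2 powi j' * x $ i\<rfloor> = k' i}"
      using QR(2) unfolding dyadic_cubes_floor by auto
    show "Q \<inter> R = {} \<or> Q \<subseteq> R \<or> R \<subseteq> Q"
    proof (cases "Q \<inter> R = {}")
      case False
      then obtain y :: "real^'n" where "\<forall>i. \<lfloor>2 powi j * y $ i\<rfloor> = k i" "\<forall>i. \<lfloor>2 powi j' * y $ i\<rfloor> = k' i"
        unfolding Q R by blast
      then show ?thesis using nested[of j' j y k k'] nested[of j j' y k' k] unfolding Q R by (cases "j' \<le> j") auto
    qed simp
  qed
qed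

lemma countable_dyadic_cubes: "countable (dyadic_cubes :: (real^'n) set set)"
proof -
  have "countable (range (\<lambda>(j::int, v::int^'n). {x::real^'n. \<forall>i. \<lfloor>2 powi j * x $ i\<rfloor> = v $ i}))"
    by simp
  moreover have "dyadic_cubes \<subseteq> range (\<lambda>(j::int, v::int^'n). {x::real^'n. \<forall>i. \<lfloor>2 powi j * x $ i\<rfloor> = v $ i})"
  proof
    fix Q :: "(real^'n) set" assume "Q \<in> dyadic_cubes"
    then obtain j k where "Q = {x. \<forall>i. \<lfloor>2 powi j * x $ i\<rfloor> = k i}"
      unfolding dyadic_cubes_floor by auto
    then show "Q \<in> range (\<lambda>(j::int, v::int^'n). {x::real^'n. \<forall>i. \<lfloor>2 powi j * x $ i\<rfloor> = v $ i})"
      by (intro image_eqI[of _ _ "(j, \<chi> i. k i)"]) auto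
  qed
  ultimately show ?thesis by (rule countable_subset[rotated])
qed

section \<open>Sparse families and packing\<close>

text \<open>\<open>sparse_collection\<close> with its witnesses made explicit: all finite
  subfamilies share c and the sets E, which keeps later constants uniform.\<close>

definition sparse_family :: "real \<Rightarrow> ((real^'n) set \<Rightarrow> (real^'n) set) \<Rightarrow> (real^'n) set set \<Rightarrow> bool"
  where "sparse_family c E F \<longleftrightarrow> disjoint_family_on E F \<and>
    (\<forall>Q\<in>F. E Q \<subseteq> Q \<and> E Q \<in> sets lebesgue \<and> c * vol Q \<le> vol (E Q))"

text \<open>Replacing R by E R costs a factor D, and the sets E R are disjoint parts of Q.\<close>

lemma carleson_packing:
  fixes w :: "real^'n \<Rightarrow> real"
  assumes F: "finite F" and Fc: "F \<subseteq> cubes" and disj: "disjoint_family_on E F"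
    and E: "\<And>Q. Q \<in> F \<Longrightarrow> E Q \<subseteq> Q \<and> E Q \<in> sets lebesgue"
    and w: "w \<in> borel_measurable lebesgue" "\<And>x. 0 \<le> w x"
    and int: "\<And>Q. Q \<in> F \<Longrightarrow> integrable lebesgue (\<lambda>x. indicator Q x * w x)"
    and D: "\<And>Q. Q \<in> F \<Longrightarrow> (LINT x|lebesgue. indicator Q x * w x) \<le> D * (LINT x|lebesgue. indicator (E Q) x * w x)"
    and D0: "0 < D" and Q: "Q \<in> F"
  shows "(\<Sum>R\<in>{R\<in>F. R \<subset> Q}. LINT x|lebesgue. indicator R x * w x) \<le> D * (LINT x|lebesgue. indicator Q x * w x)"
proof -
  note [measurable] = w(1)
  let ?D = "{R\<in>F. R \<subset> Q}"
  have intE: "integrable lebesgue (\<lambda>x. indicator (E R) x * w x)" if "R \<in> F" for R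
    by (rule integrable_dominated[OF int[OF that]])
      (use E[OF that] in \<open>auto simp: indicator_def\<close>)
  have "(\<Sum>R\<in>?D. LINT x|lebesgue. indicator R x * w x) \<le> (\<Sum>R\<in>?D. D * (LINT x|lebesgue. indicator (E R) x * w x))"
    by (intro sum_mono D) auto
  also have "\<dots> = D * (LINT x|lebesgue. (\<Sum>R\<in>?D. indicator (E R) x * w x))"
    using intE by (subst Bochner_Integration.integral_sum) (auto simp: sum_distrib_left)
  also have "\<dots> \<le> D * (LINT x|lebesgue. indicator Q x * w x)"
  proof (intro mult_left_mono integral_mono)
    show "integrable lebesgue (\<lambda>x. \<Sum>R\<in>?D. indicator (E R) x * w x)" using intE by auto
    show "integrable lebesgue (\<lambda>x. indicator Q x * w x)" by (rule int[OF Q])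
    fix x
    have "(\<Sum>R\<in>?D. indicator (E R) x) = indicat_real (\<Union>R\<in>?D. E R) x"
      using F disj by (intro indicator_UN_disjoint[symmetric]) (auto simp: disjoint_family_on_def)
    also have "\<dots> \<le> indicator Q x" using E by (auto simp: indicator_def)
    finally show "(\<Sum>R\<in>?D. indicator (E R) x * w x) \<le> indicator Q x * w x"
      unfolding sum_distrib_right[symmetric] using w(2) by (intro mult_right_mono)
  qed (use D0 in auto)
  finally show ?thesis .
qed

section \<open>Weights of class A-p\<close>

lemma bounded_ops_bounded_linear:
  assumes s: "banach_scaling s" and A: "A \<in> bounded_ops s UNIV"
  shows "bounded_linear A"
proof -
  obtain C where C: "\<And>e. norm (A e) \<le> C * norm e" using A unfolding bounded_ops_def by blast
  have sr: "r *\<^sub>R x = s (of_real r) x" for r x using s by (simp add: banach_scaling_def)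
  show ?thesis
  proof (rule bounded_linear_intro[where K=C])
    show "A (r *\<^sub>R x) = r *\<^sub>R A x" for r x unfolding sr using A by (simp add: bounded_ops_def)
    show "norm (A x) \<le> norm x * C" for x using C[of x] by (simp add: mult.commute)
  qed (use A in \<open>simp add: bounded_ops_def\<close>)
qed

text \<open>Writing e as the inverse applied to V e moves the inverse onto the functional: \<phi> e
  is V^{-*} \<phi> evaluated at V e. Boundedness of the inverse gives the lower bound for V.\<close>

lemma inv_adjoint_pairing:
  assumes s: "banach_scaling s" and inv: "invertible_op s UNIV (V x)"
  shows "norm (blinfun_apply \<phi> e) \<le> norm (inv_adjoint s V x \<phi>) * norm (V x e)"
    and "\<exists>K. \<forall>e. norm e \<le> K * norm (V x e)"
proof -
  obtain B where B: "B \<in> bounded_ops s UNIV" "\<And>e. V x (B e) = e" "\<And>e. B (V x e) = e"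
    using inv unfolding invertible_op_def by auto
  have "inv_into UNIV (V x) = B"
    using B(2,3) by (intro inv_equality) auto
  then have oi: "op_inverse s UNIV (V x) = B" using inv by (simp add: op_inverse_def)
  have blB: "bounded_linear B" by (rule bounded_ops_bounded_linear[OF s B(1)])
  then have "bounded_linear (\<lambda>e. blinfun_apply \<phi> (B e))"
    by (rule bounded_linear_compose[OF blinfun.bounded_linear_right])
  then have "blinfun_apply (inv_adjoint s V x \<phi>) (V x e) = blinfun_apply \<phi> e"
    by (simp add: inv_adjoint_def adjoint_op_def oi bounded_linear_Blinfun_apply B(3))
  then show "norm (blinfun_apply \<phi> e) \<le> norm (inv_adjoint s V x \<phi>) * norm (V x e)"
    by (metis norm_blinfun)
  obtain K where "\<And>e. norm (B e) \<le> norm e * K" using bounded_linear.bounded[OF blB] by blast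
  then show "\<exists>K. \<forall>e. norm e \<le> K * norm (V x e)"
    using B(3) by (intro exI[of _ K]) (metis mult.commute)
qed

lemma AE_exists_in_cube:
  fixes Q :: "(real^'n) set"
  assumes Q: "Q \<in> cubes" and ae: "AE x in lebesgue. P x"
  shows "\<exists>x\<in>Q. P x"
proof (rule ccontr)
  assume "\<not> ?thesis"
  then have "AE x in lebesgue. x \<notin> Q" using ae by (auto elim: eventually_mono)
  then have "emeasure lebesgue Q = 0"
    using cube_measure(1)[OF Q] by (subst emeasure_eq_0_AE[symmetric]) (auto simp: fmeasurable_def)
  then show False using cube_measure(2)[OF Q] by (simp add: measure_def)
qed

lemma mult_root_powr:
  fixes t m r :: real
  assumes "0 \<le> t" "0 < m" "r \<noteq> 0"
  shows "m * ((t / m) powr (1 / r)) powr r = t"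
  using assms by (simp add: powr_powr)

locale Ap_space =
  fixes s :: "'k::{real_normed_field,euclidean_space} \<Rightarrow> 'x::banach \<Rightarrow> 'x"
    and p :: real
    and V :: "real^'n \<Rightarrow> 'x \<Rightarrow> 'x"
  assumes scaling: "banach_scaling s" and p1: "1 < p" and Ap: "Ap_weight s p V"
begin

abbreviation (input) q :: real where "q \<equiv> p / (p - 1)"
abbreviation W :: "real^'n \<Rightarrow> ('x \<Rightarrow>\<^sub>L 'k) \<Rightarrow> ('x \<Rightarrow>\<^sub>L 'k)" where "W \<equiv> inv_adjoint s V"

abbreviation wLp :: "(real^'n \<Rightarrow> 'x) set" where "wLp \<equiv> weighted_Lp p V"
abbreviation wnorm :: "(real^'n \<Rightarrow> 'x) \<Rightarrow> real" where "wnorm \<equiv> weighted_norm p V"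

text \<open>Unlike \<open>rho\<close> this is not normalised, hence monotone in E, and it is meant
  for the parts E Q of cubes as well as for the cubes.\<close>

definition mass :: "(real^'n) set \<Rightarrow> 'x \<Rightarrow> real"
  where "mass E e = (LINT x|lebesgue. indicator E x * norm (V x e) powr p)"

definition dual_mass :: "(real^'n) set \<Rightarrow> ('x \<Rightarrow>\<^sub>L 'k) \<Rightarrow> real"
  where "dual_mass E \<phi> = (LINT x|lebesgue. indicator E x * norm (W x \<phi>) powr q)"

lemma q1: "1 < q" and inverse_q: "1 / q = (p - 1) / p"
  using p1 by (auto simp: field_simps)

lemma pV: "p_weight p s UNIV V" and pW: "p_weight q dual_scale (dual_space s) W"
  using Ap unfolding Ap_weight_def Let_def by auto

lemma V_linear: "bounded_linear (V x)"
  using pV scaling unfolding p_weight_def weight_def by (auto intro: bounded_ops_bounded_linear)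

lemma V_scale: "V x (s c e) = s c (V x e)"
  using pV unfolding p_weight_def weight_def bounded_ops_def by auto

lemma norm_scale: "norm (s c x) = norm c * norm x"
  using scaling by (simp add: banach_scaling_def)

lemma V_measurable: "strongly_measurable (\<lambda>x. V x e)"
  using pV unfolding p_weight_def weight_def by auto

lemma norm_V_measurable [measurable]: "(\<lambda>x. norm (V x e)) \<in> borel_measurable lebesgue"
  by (rule strongly_measurable_norm[OF V_measurable])

lemma norm_W_measurable:
  assumes "\<phi> \<in> dual_space s"
  shows "(\<lambda>x. norm (W x \<phi>)) \<in> borel_measurable lebesgue"
proof (rule strongly_measurable_norm)
  show "strongly_measurable (\<lambda>x. W x \<phi>)"
    using pW assms unfolding p_weight_def weight_def by blast
qed

lemma AE_invertible: "AE x in lebesgue. invertible_op s UNIV (V x)"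
  using pV unfolding p_weight_def weight_def by auto

lemma AE_pairing: "AE x in lebesgue. norm (blinfun_apply \<phi> (f x)) \<le> norm (W x \<phi>) * norm (V x (f x))"
  using AE_invertible by eventually_elim (rule inv_adjoint_pairing(1)[OF scaling])

lemma indicator_powr: "(indicat_real Q x * t) powr r = indicator Q x * t powr r"
  by (simp add: indicator_def)

lemma mass_integrable_cube: "Q \<in> cubes \<Longrightarrow> integrable lebesgue (\<lambda>x. indicator Q x * norm (V x e) powr p)"
  using pV unfolding p_weight_def Lp_def by (auto simp: indicator_powr)

lemma dual_mass_integrable_cube:
  "Q \<in> cubes \<Longrightarrow> \<phi> \<in> dual_space s \<Longrightarrow> integrable lebesgue (\<lambda>x. indicator Q x * norm (W x \<phi>) powr q)"
  using pW unfolding p_weight_def Lp_def by (auto simp: indicator_powr)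

lemma mass_integrable:
  assumes Q: "Q \<in> cubes" and E: "E \<subseteq> Q" "E \<in> sets lebesgue"
  shows "integrable lebesgue (\<lambda>x. indicator E x * norm (V x e) powr p)"
  by (rule integrable_dominated[OF mass_integrable_cube[OF Q, of e]])
    (use E in \<open>auto simp: indicator_def\<close>)

lemma dual_mass_integrable:
  assumes Q: "Q \<in> cubes" and \<phi>: "\<phi> \<in> dual_space s" and E: "E \<subseteq> Q" "E \<in> sets lebesgue"
  shows "integrable lebesgue (\<lambda>x. indicator E x * norm (W x \<phi>) powr q)"
proof -
  note [measurable] = norm_W_measurable[OF \<phi>]
  show ?thesis
    by (rule integrable_dominated[OF dual_mass_integrable_cube[OF Q \<phi>]])
      (use E in \<open>auto simp: indicator_def\<close>)
qed

lemma mass_nonneg: "0 \<le> mass E e" and dual_mass_nonneg: "0 \<le> dual_mass E \<phi>"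
  by (auto simp: mass_def dual_mass_def)

lemma rho_mass: "rho p V Q e = (mass Q e / vol Q) powr (1 / p)"
  by (simp add: rho_def mass_def set_lebesgue_integral_def)

lemma rho_dual_mass: "rho q W Q \<phi> = (dual_mass Q \<phi> / vol Q) powr (1 / q)"
  by (simp add: rho_def dual_mass_def set_lebesgue_integral_def)

lemma rho_powr: "Q \<in> cubes \<Longrightarrow> vol Q * rho p V Q e powr p = mass Q e"
  unfolding rho_mass using p1 mass_nonneg[of Q e] cube_measure(2)[of Q] by (intro mult_root_powr) auto

lemma rho_dual_powr: "Q \<in> cubes \<Longrightarrow> vol Q * rho q W Q \<phi> powr q = dual_mass Q \<phi>"
  unfolding rho_dual_mass using q1 dual_mass_nonneg[of Q \<phi>] cube_measure(2)[of Q]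
  by (intro mult_root_powr) auto

text \<open>The supremum in \<open>rho_dual\<close> gives way to any K that dominates \<phi> by
  \<open>rho\<close>. Hahn-Banach functionals and \<open>set_pairing\<close> supply such a
  K.\<close>

lemma Ap_constant: "\<exists>C>0. \<forall>Q\<in>cubes. \<forall>\<phi>\<in>dual_space s. \<forall>K\<ge>0.
    (\<forall>e. norm (blinfun_apply \<phi> e) \<le> K * rho p V Q e) \<longrightarrow> rho q W Q \<phi> \<le> C * K"
proof -
  obtain C where C: "C \<ge> 0" "\<And>Q \<phi>. Q \<in> cubes \<Longrightarrow> \<phi> \<in> dual_space s \<Longrightarrow>
      ennreal (rho q W Q \<phi>) \<le> ennreal C * rho_dual p V Q \<phi>"
    using Ap unfolding Ap_weight_def Let_def by auto
  have "rho q W Q \<phi> \<le> (C + 1) * K"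
    if Q: "Q \<in> cubes" and \<phi>: "\<phi> \<in> dual_space s" and K: "K \<ge> 0"
      and le: "\<forall>e. norm (blinfun_apply \<phi> e) \<le> K * rho p V Q e" for Q \<phi> K
  proof -
    \<comment> \<open>Where \<open>rho\<close> vanishes the quotient is 0 by convention, and K >= 0
      suffices.\<close>
    have "norm (blinfun_apply \<phi> e) / rho p V Q e \<le> K" for e
    proof (cases "rho p V Q e = 0")
      case False
      then have "rho p V Q e > 0" by (simp add: rho_mass)
      then show ?thesis using le[rule_format, of e] by (simp add: field_simps)
    qed (use K in simp)
    then have "rho_dual p V Q \<phi> \<le> ennreal K" unfolding rho_dual_def by (intro SUP_least ennreal_leI)
    then have "ennreal (rho q W Q \<phi>) \<le> ennreal C * ennreal K"
      using C(2)[OF Q \<phi>] by (meson mult_left_mono order_trans zero_le)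
    then have "rho q W Q \<phi> \<le> C * K" using C(1) K by (simp add: ennreal_mult[symmetric] ennreal_le_iff)
    also have "\<dots> \<le> (C + 1) * K" using K by (simp add: mult_right_mono)
    finally show ?thesis .
  qed
  then show ?thesis using C(1) by (intro exI[of _ "C + 1"]) auto
qed

text \<open>The factors u^(1/q) and u^(-1/q) = u^((1-p)/p) are distributed over the two functions.
  For u = 1 this is the plain inequality; for u = z^n growth tolerated by the dual weight becomes
  decay on the side of G.\<close>

lemma weighted_Hoelder:
  assumes \<phi>: "\<phi> \<in> dual_space s" and E [measurable]: "E \<in> sets lebesgue"
    and G [measurable]: "G \<in> borel_measurable lebesgue" and Gn: "\<And>x. 0 \<le> G x"
    and u [measurable]: "u \<in> borel_measurable lebesgue" and un: "\<And>x. 0 < u x"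
    and iW: "integrable lebesgue (\<lambda>x. indicator E x * (u x * norm (W x \<phi>) powr q))"
    and iG: "integrable lebesgue (\<lambda>x. indicator E x * (u x powr (1 - p) * G x powr p))"
  shows "integrable lebesgue (\<lambda>x. indicator E x * (norm (W x \<phi>) * G x))"
    and "(LINT x|lebesgue. indicator E x * (norm (W x \<phi>) * G x)) \<le>
      (LINT x|lebesgue. indicator E x * (u x powr (1 - p) * G x powr p)) powr (1 / p) *
      (LINT x|lebesgue. indicator E x * (u x * norm (W x \<phi>) powr q)) powr (1 / q)"
proof -
  note [measurable] = norm_W_measurable[OF \<phi>]
  define f g where "f x = indicator E x * (u x powr ((1 - p) / p) * G x)"
    and "g x = indicator E x * (u x powr (1 / q) * norm (W x \<phi>))" for x
  have [measurable]: "f \<in> borel_measurable lebesgue" "g \<in> borel_measurable lebesgue"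
    unfolding f_def g_def by measurable
  have fg: "f x * g x = indicator E x * (norm (W x \<phi>) * G x)" for x
  proof -
    have "u x powr ((1 - p) / p) * u x powr (1 / q) = 1"
      using un[of x] p1 by (simp add: powr_add[symmetric] add_divide_distrib[symmetric])
    then show ?thesis by (auto simp: f_def g_def indicator_def)
  qed
  have fp: "f x powr p = indicator E x * (u x powr (1 - p) * G x powr p)" for x
    using p1 Gn[of x] by (simp add: f_def powr_mult powr_powr indicator_def)
  have gq: "g x powr q = indicator E x * (u x * norm (W x \<phi>) powr q)" for x
    using q1 p1 un[of x] by (simp add: g_def powr_mult powr_powr indicator_def)
  have nn: "f x \<ge> 0" "g x \<ge> 0" for x using Gn by (auto simp: f_def g_def)
  note H = Hoelder_integral[OF p1, of f lebesgue g, unfolded fg fp gq, OF _ _ nn iG iW]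
  show "integrable lebesgue (\<lambda>x. indicator E x * (norm (W x \<phi>) * G x))" by (rule H(1)) auto
  show "(LINT x|lebesgue. indicator E x * (norm (W x \<phi>) * G x)) \<le>
      (LINT x|lebesgue. indicator E x * (u x powr (1 - p) * G x powr p)) powr (1 / p) *
      (LINT x|lebesgue. indicator E x * (u x * norm (W x \<phi>) powr q)) powr (1 / q)"
    using H(2) by (simp add: inverse_q)
qed

lemmas V_add = linear_add[OF bounded_linear.linear[OF V_linear]]
  and V_diff = linear_diff[OF bounded_linear.linear[OF V_linear]]
  and V_scaleR = linear_scale[OF bounded_linear.linear[OF V_linear]]
  and V_zero = linear_0[OF bounded_linear.linear[OF V_linear]]

section \<open>On each cube, \<open>rho\<close> is a norm equivalent to the given one\<close>

lemma rho_nonneg: "0 \<le> rho p V Q e" and rho_dual_nonneg: "0 \<le> rho q W Q \<phi>"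
  by (simp_all add: rho_mass rho_dual_mass)

lemma rho_add:
  assumes Q: "Q \<in> cubes"
  shows "rho p V Q (e + e') \<le> rho p V Q e + rho p V Q e'"
proof -
  have [measurable]: "Q \<in> sets lebesgue" using cube_measure(1)[OF Q] by (rule fmeasurableD)
  define f where "f e x = indicator Q x * norm (V x e)" for e x
  have f_nn: "0 \<le> f e x" for e x by (simp add: f_def)
  have [measurable]: "f e \<in> borel_measurable lebesgue" for e unfolding f_def by measurable
  have fp: "f e x powr p = indicator Q x * norm (V x e) powr p" for e x
    by (simp add: f_def indicator_powr)
  have int: "integrable lebesgue (\<lambda>x. f e x powr p)" for e
    unfolding fp by (rule mass_integrable_cube[OF Q])
  have root: "rho p V Q e = (LINT x|lebesgue. f e x powr p) powr (1 / p) / vol Q powr (1 / p)" for e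
    using mass_nonneg[of Q e] by (simp add: rho_mass powr_divide fp flip: mass_def)
  have "(LINT x|lebesgue. f (e + e') x powr p) \<le> (LINT x|lebesgue. (f e x + f e' x) powr p)"
  proof (rule integral_mono)
    show "integrable lebesgue (\<lambda>x. (f e x + f e' x) powr p)"
      using p1 by (intro integrable_powr_add int f_nn) auto
    fix x
    have "f (e + e') x \<le> f e x + f e' x"
      using norm_triangle_ineq[of "V x e" "V x e'"] by (simp add: f_def indicator_def V_add)
    then show "f (e + e') x powr p \<le> (f e x + f e' x) powr p" using p1 f_nn by (intro powr_mono2) auto
  qed (rule int)
  then have "(LINT x|lebesgue. f (e + e') x powr p) powr (1 / p) \<le> (LINT x|lebesgue. (f e x + f e' x) powr p) powr (1 / p)"
    using p1 by (intro powr_mono2) auto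
  also have "\<dots> \<le> (LINT x|lebesgue. f e x powr p) powr (1 / p) + (LINT x|lebesgue. f e' x powr p) powr (1 / p)"
    by (intro Minkowski_integral p1 f_nn int) auto
  finally show ?thesis
    unfolding root by (simp add: divide_right_mono flip: add_divide_distrib)
qed

text \<open>Stated for vectors with proportional norms under V, so that it covers real multiples and
  multiples by \<open>s\<close> alike.\<close>

lemma rho_homogeneous:
  assumes "\<And>x. norm (V x e') = t * norm (V x e)" "0 \<le> t"
  shows "rho p V Q e' = t * rho p V Q e"
proof -
  have "mass Q e' = t powr p * mass Q e"
  proof -
    have "indicator Q x * norm (V x e') powr p = t powr p * (indicator Q x * norm (V x e) powr p)" for x
      using assms by (simp add: powr_mult)
    then show ?thesis unfolding mass_def by (simp only: integral_mult_right_zero)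
  qed
  then show ?thesis
    using assms(2) p1 mass_nonneg[of Q e] by (simp add: rho_mass powr_mult powr_powr powr_divide)
qed

lemma rho_le_iff:
  assumes Q: "Q \<in> cubes" and c: "0 \<le> c"
  shows "rho p V Q e \<le> c \<longleftrightarrow> mass Q e \<le> vol Q * c powr p"
proof -
  have "rho p V Q e \<le> c \<longleftrightarrow> rho p V Q e powr p \<le> c powr p"
    using p1 c rho_nonneg[of Q e] by (meson less_le_trans linorder_not_le order_less_le powr_less_mono2 powr_mono2 zero_less_one)
  also have "\<dots> \<longleftrightarrow> mass Q e \<le> vol Q * c powr p"
    unfolding rho_powr[OF Q, symmetric] using cube_measure(2)[OF Q] by simp
  finally show ?thesis .
qed

text \<open>Fatou's lemma along a convergent sequence, as V x is continuous for each x. Continuity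
  of \<open>rho\<close> itself only follows afterwards, by Baire's theorem.\<close>

lemma rho_sublevel_closed:
  assumes Q: "Q \<in> cubes"
  shows "closed {e. rho p V Q e \<le> c}"
proof (cases "c \<ge> 0")
  case False
  then have "{e. rho p V Q e \<le> c} = {}" using rho_nonneg order_trans by blast
  then show ?thesis by simp
next
  case True
  have [measurable]: "Q \<in> sets lebesgue" using cube_measure(1)[OF Q] by (rule fmeasurableD)
  have ennreal_mass: "ennreal (mass Q e) = (\<integral>\<^sup>+x. ennreal (indicator Q x * norm (V x e) powr p) \<partial>lebesgue)" for e
    unfolding mass_def by (rule nn_integral_eq_integral[symmetric, OF mass_integrable_cube[OF Q]]) auto
  show ?thesis unfolding closed_sequential_limits
  proof safe
    fix u e assume u: "\<forall>n. u n \<in> {e. rho p V Q e \<le> c}" and lim: "u \<longlonglongrightarrow> e"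
    have "ennreal (mass Q e) = (\<integral>\<^sup>+x. liminf (\<lambda>n. ennreal (indicator Q x * norm (V x (u n)) powr p)) \<partial>lebesgue)"
      unfolding ennreal_mass
    proof (intro nn_integral_cong)
      fix x
      have "(\<lambda>n. ennreal (indicator Q x * norm (V x (u n)) powr p)) \<longlonglongrightarrow> ennreal (indicator Q x * norm (V x e) powr p)"
        using p1 by (intro tendsto_ennrealI tendsto_mult tendsto_const tendsto_powr' tendsto_norm
            bounded_linear.tendsto[OF V_linear lim]) auto
      then show "ennreal (indicator Q x * norm (V x e) powr p) = liminf (\<lambda>n. ennreal (indicator Q x * norm (V x (u n)) powr p))"
        by (simp add: lim_imp_Liminf del: ennreal_mult'' tendsto_ennreal_iff)
    qed
    also have "\<dots> \<le> liminf (\<lambda>n. \<integral>\<^sup>+x. ennreal (indicator Q x * norm (V x (u n)) powr p) \<partial>lebesgue)"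
      by (rule nn_integral_liminf) measurable
    also have "\<dots> \<le> liminf (\<lambda>n::nat. ennreal (vol Q * c powr p))"
      unfolding ennreal_mass[symmetric] using u rho_le_iff[OF Q True]
      by (intro Liminf_mono always_eventually allI ennreal_leI) auto
    finally have "mass Q e \<le> vol Q * c powr p"
      by (simp add: Liminf_const ennreal_le_iff)
    then show "rho p V Q e \<le> c" using rho_le_iff[OF Q True] by blast
  qed
qed

text \<open>No integrable majorant for the operator norm of V is at hand; finiteness at each e and
  lower semicontinuity have to suffice. The bound makes functionals dominated by \<open>rho\<close>
  continuous.\<close>

lemma rho_bounded:
  assumes Q: "Q \<in> cubes"
  shows "\<exists>K>0. \<forall>e. rho p V Q e \<le> K * norm e"
proof (rule lower_semicontinuous_seminorm_bounded)
  show "rho p V Q (e + e') \<le> rho p V Q e + rho p V Q e'" for e e' by (rule rho_add[OF Q])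
  show "rho p V Q (r *\<^sub>R e) = \<bar>r\<bar> * rho p V Q e" for r e
    by (rule rho_homogeneous) (simp_all add: V_scaleR)
  show "closed {e. rho p V Q e \<le> c}" for c by (rule rho_sublevel_closed[OF Q])
qed

text \<open>Here \<kappa> stems from the passage to scalar-linear functionals, so it depends neither
  on Q nor on e.\<close>

lemma norming_functional:
  "\<exists>\<kappa>>0. \<forall>Q\<in>cubes. \<forall>e. \<exists>\<phi>\<in>dual_space s.
    (\<forall>y. norm (blinfun_apply \<phi> y) \<le> \<kappa> * rho p V Q y) \<and> rho p V Q e \<le> norm (blinfun_apply \<phi> e)"
proof -
  obtain \<kappa> where \<kappa>: "\<kappa> > 0" "\<And>q K e. (\<forall>x y. q (x + y) \<le> q x + q y) \<Longrightarrow> (\<forall>c x. q (s c x) = norm c * q x) \<Longrightarrow>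
    (\<forall>x. q x \<le> K * norm x) \<Longrightarrow>
    (\<exists>\<phi>\<in>dual_space s. (\<forall>x. norm (blinfun_apply \<phi> x) \<le> \<kappa> * q x) \<and> q e \<le> norm (blinfun_apply \<phi> e))"
    using Hahn_Banach_dual_space[OF scaling] by blast
  have "\<exists>\<phi>\<in>dual_space s. (\<forall>y. norm (blinfun_apply \<phi> y) \<le> \<kappa> * rho p V Q y) \<and> rho p V Q e \<le> norm (blinfun_apply \<phi> e)"
    if Q: "Q \<in> cubes" for Q e
  proof -
    obtain K where K: "\<forall>e. rho p V Q e \<le> K * norm e" using rho_bounded[OF Q] by blast
    have "rho p V Q (s c x) = norm c * rho p V Q x" for c x
      by (rule rho_homogeneous) (simp_all add: V_scale norm_scale)
    then show ?thesis using rho_add[OF Q] K by (intro \<kappa>(2)) auto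
  qed
  then show ?thesis using \<kappa>(1) by blast
qed

text \<open>
  If \<open>rho p V Q\<close> is summable along unit vectors \<open>e n\<close>, then \<open>V x (e n)\<close> tends to \<open>0\<close> at some
  \<open>x\<close> where \<open>V x\<close> is invertible, which is impossible.
\<close>

lemma norm_le_rho:
  assumes Q: "Q \<in> cubes"
  shows "\<exists>K>0. \<forall>e. norm e \<le> K * rho p V Q e"
proof (rule ccontr)
  assume no: "\<not> ?thesis"
  have "\<exists>e. norm e = 1 \<and> rho p V Q e < (1/2) ^ n" for n
  proof -
    obtain e where e: "norm e > 2 ^ n * rho p V Q e" using no by (meson not_le zero_less_numeral zero_less_power)
    moreover have "0 \<le> 2 ^ n * rho p V Q e" by (simp add: rho_nonneg)
    ultimately have e0: "norm e > 0" by linarith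
    have "rho p V Q ((1 / norm e) *\<^sub>R e) = (1 / norm e) * rho p V Q e"
      by (rule rho_homogeneous) (simp_all add: V_scaleR)
    also have "\<dots> < (1/2) ^ n" using e e0 by (simp add: field_simps power_divide)
    finally show ?thesis using e0 by (intro exI[of _ "(1 / norm e) *\<^sub>R e"]) simp
  qed
  then obtain e where e: "\<And>n. norm (e n) = 1" "\<And>n. rho p V Q (e n) < (1/2) ^ n" by metis
  have [measurable]: "Q \<in> sets lebesgue" using cube_measure(1)[OF Q] by (rule fmeasurableD)
  let ?f = "\<lambda>n x. indicator Q x * norm (V x (e n)) powr p"
  define r where "r = (1/2::real) powr p"
  have r: "0 < r" "r < 1" unfolding r_def using p1 powr_less_mono2[of p "1/2" 1] by auto
  have "mass Q (e n) \<le> vol Q * r ^ n" for n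
  proof -
    have "rho p V Q (e n) powr p \<le> ((1/2) ^ n) powr p"
      using p1 e(2)[of n] rho_nonneg by (intro powr_mono2) auto
    also have "\<dots> = r ^ n" unfolding r_def by (simp add: powr_realpow[symmetric] powr_powr mult.commute)
    finally show ?thesis unfolding rho_powr[OF Q, symmetric] using cube_measure(2)[OF Q] by simp
  qed
  then have "(\<Sum>n. ennreal (mass Q (e n))) \<le> (\<Sum>n. ennreal (vol Q * r ^ n))"
    by (intro suminf_le ennreal_leI) auto
  also have "\<dots> < \<infinity>"
    using r by (subst suminf_ennreal2) (auto intro!: summable_mult summable_geometric)
  finally have fin: "(\<Sum>n. ennreal (mass Q (e n))) < \<infinity>" .
  have "(\<integral>\<^sup>+x. (\<Sum>n. ennreal (?f n x)) \<partial>lebesgue) = (\<Sum>n. ennreal (mass Q (e n)))"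
    unfolding mass_def using nn_integral_eq_integral[OF mass_integrable_cube[OF Q]]
    by (subst nn_integral_suminf) auto
  then have "AE x in lebesgue. (\<Sum>n. ennreal (?f n x)) \<noteq> \<infinity>"
    using fin by (intro nn_integral_PInf_AE) auto
  then have "AE x in lebesgue. (\<Sum>n. ennreal (?f n x)) \<noteq> \<infinity> \<and> invertible_op s UNIV (V x)"
    using AE_invertible by (rule AE_conjI)
  from AE_exists_in_cube[OF Q this] obtain x
    where x: "x \<in> Q" "(\<Sum>n. ennreal (?f n x)) \<noteq> \<infinity>" "invertible_op s UNIV (V x)"
    by blast
  have "summable (\<lambda>n. ?f n x)" using x(2) by (intro summable_suminf_not_top) auto
  then have "(\<lambda>n. norm (V x (e n)) powr p) \<longlonglongrightarrow> 0" using summable_LIMSEQ_zero x(1) by fastforce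
  then have "(\<lambda>n. (norm (V x (e n)) powr p) powr (1 / p)) \<longlonglongrightarrow> 0 powr (1 / p)"
    using p1 by (intro tendsto_powr') auto
  then have lim: "(\<lambda>n. norm (V x (e n))) \<longlonglongrightarrow> 0" using p1 by (simp add: powr_powr)
  obtain K where K: "\<And>e. norm e \<le> K * norm (V x e)" using inv_adjoint_pairing(2)[of s V x, OF scaling x(3)] by blast
  have "(\<lambda>n. K * norm (V x (e n))) \<longlonglongrightarrow> K * 0" by (intro tendsto_intros lim)
  then have "1 \<le> K * 0" using K[of "e _"] e(1) by (intro LIMSEQ_le_const) auto
  then show False by simp
qed

section \<open>Comparison of a cube with its large subsets\<close>

text \<open>The pointwise pairing for a constant vector is integrated over E and followed by
  Hoelder's inequality. This links the two weights on any part E of Q.\<close>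

lemma set_pairing:
  assumes Q: "Q \<in> cubes" and E: "E \<subseteq> Q" "E \<in> sets lebesgue" and \<phi>: "\<phi> \<in> dual_space s"
  shows "norm (blinfun_apply \<phi> e) * vol E \<le> mass E e powr (1 / p) * dual_mass E \<phi> powr (1 / q)"
proof -
  have mE: "E \<in> lmeasurable" using cube_measure(1)[OF Q] E by (metis fmeasurableI2)
  note H = weighted_Hoelder[OF \<phi> E(2), of "\<lambda>x. norm (V x e)" "\<lambda>_. 1",
      simplified, OF dual_mass_integrable[OF Q \<phi> E] mass_integrable[OF Q E]]
  have "norm (blinfun_apply \<phi> e) * vol E = (LINT x|lebesgue. indicator E x * norm (blinfun_apply \<phi> e))"
    using mE by simp
  also have "\<dots> \<le> (LINT x|lebesgue. indicator E x * (norm (W x \<phi>) * norm (V x e)))"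
  proof (rule integral_mono_AE)
    show "integrable lebesgue (\<lambda>x. indicator E x * norm (blinfun_apply \<phi> e))"
      using mE by (intro integrable_mult_left integrable_real_indicator) (auto simp: fmeasurable_def)
    show "AE x in lebesgue. indicator E x * norm (blinfun_apply \<phi> e) \<le> indicator E x * (norm (W x \<phi>) * norm (V x e))"
      using AE_pairing[of \<phi> "\<lambda>_. e"] by eventually_elim (auto simp: indicator_def)
  qed (rule H(1))
  also have "\<dots> \<le> mass E e powr (1 / p) * dual_mass E \<phi> powr (1 / q)"
    using H(2) by (simp add: mass_def dual_mass_def)
  finally show ?thesis .
qed

lemma mass_mono: "Q \<in> cubes \<Longrightarrow> E \<subseteq> Q \<Longrightarrow> E \<in> sets lebesgue \<Longrightarrow> mass E e \<le> mass Q e"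
  unfolding mass_def by (intro integral_mono mass_integrable mass_integrable_cube) (auto simp: indicator_def)

lemma dual_mass_mono:
  "Q \<in> cubes \<Longrightarrow> \<phi> \<in> dual_space s \<Longrightarrow> E \<subseteq> Q \<Longrightarrow> E \<in> sets lebesgue \<Longrightarrow> dual_mass E \<phi> \<le> dual_mass Q \<phi>"
  unfolding dual_mass_def by (intro integral_mono dual_mass_integrable dual_mass_integrable_cube) (auto simp: indicator_def)

text \<open>By \<open>set_pairing\<close>, \<phi> is dominated by \<open>rho\<close> on Q with a
  constant that involves the weights only through the dual mass of E. The A_p condition turns this
  into a bound for the dual average over the whole of Q.\<close>

lemma dual_mass_comparison:
  assumes c: "0 < c"
  shows "\<exists>D>0. \<forall>Q\<in>cubes. \<forall>E\<in>sets lebesgue. E \<subseteq> Q \<longrightarrow> c * vol Q \<le> vol E \<longrightarrow>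
    (\<forall>\<phi>\<in>dual_space s. dual_mass Q \<phi> \<le> D * dual_mass E \<phi>)"
proof -
  obtain C where C: "C > 0" "\<And>Q \<phi> K. Q \<in> cubes \<Longrightarrow> \<phi> \<in> dual_space s \<Longrightarrow> K \<ge> 0 \<Longrightarrow>
      (\<forall>e. norm (blinfun_apply \<phi> e) \<le> K * rho p V Q e) \<Longrightarrow> rho q W Q \<phi> \<le> C * K"
    using Ap_constant by blast
  have "dual_mass Q \<phi> \<le> (C / c) powr q * dual_mass E \<phi>"
    if Q: "Q \<in> cubes" and E: "E \<in> sets lebesgue" "E \<subseteq> Q" and m: "c * vol Q \<le> vol E"
      and \<phi>: "\<phi> \<in> dual_space s" for Q E \<phi>
  proof -
    let ?m = "vol Q" and ?A = "dual_mass E \<phi> powr (1 / q)"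
    have m0: "?m > 0" by (rule cube_measure(2)[OF Q])
    \<comment> \<open>\<open>set_pairing\<close> divided by c |Q|, with the mass of Q expressed by
      \<open>rho\<close>.\<close>
    define K where "K = ?m powr (1 / p) * ?A / (c * ?m)"
    have "norm (blinfun_apply \<phi> e) \<le> K * rho p V Q e" for e
    proof -
      have "norm (blinfun_apply \<phi> e) * (c * ?m) \<le> norm (blinfun_apply \<phi> e) * vol E"
        using m by (rule mult_left_mono) simp
      also have "\<dots> \<le> mass E e powr (1 / p) * ?A" by (rule set_pairing[OF Q E(2,1) \<phi>])
      also have "\<dots> \<le> mass Q e powr (1 / p) * ?A"
        using mass_mono[OF Q E(2,1)] mass_nonneg p1 by (intro mult_right_mono powr_mono2) auto
      also have "mass Q e powr (1 / p) = ?m powr (1 / p) * rho p V Q e"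
        using p1 m0 mass_nonneg[of Q e] by (simp add: rho_mass powr_divide)
      finally show ?thesis using m0 c by (simp add: K_def field_simps)
    qed
    then have "rho q W Q \<phi> \<le> C * K" using m0 c by (intro C(2) Q \<phi>) (auto simp: K_def)
    then have "rho q W Q \<phi> powr q \<le> (C * K) powr q" using q1 rho_dual_nonneg by (intro powr_mono2) auto
    then have "dual_mass Q \<phi> \<le> ?m * (C * K) powr q"
      unfolding rho_dual_powr[OF Q, symmetric] using m0 by simp
    also have "?m * (C * K) powr q = (C / c) powr q * (?m * (?m powr (1 / p - 1) * ?A) powr q)"
    proof -
      have "C * K = (C / c) * (?m powr (1 / p - 1) * ?A)"
        using m0 by (simp add: K_def powr_diff)
      then have "(C * K) powr q = (C / c) powr q * (?m powr (1 / p - 1) * ?A) powr q"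
        using C(1) c by (simp only: powr_mult)
      then show ?thesis by (simp only: mult.left_commute)
    qed
    \<comment> \<open>The powers of |Q| cancel, as (1/p - 1) q = -1.\<close>
    also have "?m * (?m powr (1 / p - 1) * ?A) powr q = dual_mass E \<phi>"
    proof -
      have "(1 / p - 1) * q = - 1" using p1 by (simp add: field_simps)
      then have "(?m powr (1 / p - 1) * ?A) powr q = ?m powr (- 1) * dual_mass E \<phi>"
        using p1 dual_mass_nonneg[of E \<phi>] m0 unfolding powr_mult powr_powr by simp
      then show ?thesis using m0 by (simp add: powr_minus field_simps)
    qed
    finally show ?thesis .
  qed
  then show ?thesis using C(1) c by (intro exI[of _ "(C / c) powr q"]) auto
qed

text \<open>Hahn-Banach and the A_p condition combined: a functional that norms e for
  \<open>rho\<close> and whose dual average is at most C. Upper bounds for \<open>mass\<close> are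
  obtained by testing with it.\<close>

definition norming_constant :: "real \<Rightarrow> bool"
  where "norming_constant C \<longleftrightarrow> 0 < C \<and> (\<forall>Q\<in>cubes. \<forall>e. \<exists>\<phi>\<in>dual_space s.
    rho p V Q e \<le> norm (blinfun_apply \<phi> e) \<and> dual_mass Q \<phi> \<le> C powr q * vol Q)"

lemma norming_constant_exists: "\<exists>C. norming_constant C"
proof -
  obtain C where C: "C > 0" "\<And>Q \<phi> K. Q \<in> cubes \<Longrightarrow> \<phi> \<in> dual_space s \<Longrightarrow> K \<ge> 0 \<Longrightarrow>
      (\<forall>e. norm (blinfun_apply \<phi> e) \<le> K * rho p V Q e) \<Longrightarrow> rho q W Q \<phi> \<le> C * K"
    using Ap_constant by blast
  obtain \<kappa> where \<kappa>: "\<kappa> > 0" "\<And>Q e. Q \<in> cubes \<Longrightarrow> \<exists>\<phi>\<in>dual_space s.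
      (\<forall>y. norm (blinfun_apply \<phi> y) \<le> \<kappa> * rho p V Q y) \<and> rho p V Q e \<le> norm (blinfun_apply \<phi> e)"
    using norming_functional by blast
  have "\<exists>\<phi>\<in>dual_space s. rho p V Q e \<le> norm (blinfun_apply \<phi> e) \<and>
    dual_mass Q \<phi> \<le> (C * \<kappa>) powr q * vol Q" if Q: "Q \<in> cubes" for Q e
  proof -
    obtain \<phi> where \<phi>: "\<phi> \<in> dual_space s" "\<forall>y. norm (blinfun_apply \<phi> y) \<le> \<kappa> * rho p V Q y"
      "rho p V Q e \<le> norm (blinfun_apply \<phi> e)" using \<kappa>(2)[OF Q] by blast
    have "rho q W Q \<phi> \<le> C * \<kappa>" using \<kappa>(1) by (intro C(2) Q \<phi>(1,2)) simp
    then have "rho q W Q \<phi> powr q \<le> (C * \<kappa>) powr q" using q1 rho_dual_nonneg by (intro powr_mono2) auto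
    then have "dual_mass Q \<phi> \<le> (C * \<kappa>) powr q * vol Q"
      unfolding rho_dual_powr[OF Q, symmetric] using cube_measure(2)[OF Q] by simp
    then show ?thesis using \<phi> by blast
  qed
  then show ?thesis using C(1) \<kappa>(1) unfolding norming_constant_def by (intro exI[of _ "C * \<kappa>"]) auto
qed

text \<open>The functional that norms e on Q is paired with e on E. Its dual mass on E is at most
  that on Q, which is controlled, so the mass of E has to carry the inequality.\<close>

lemma mass_comparison:
  assumes c: "0 < c"
  shows "\<exists>D>0. \<forall>Q\<in>cubes. \<forall>E\<in>sets lebesgue. E \<subseteq> Q \<longrightarrow> c * vol Q \<le> vol E \<longrightarrow>
    (\<forall>e. mass Q e \<le> D * mass E e)"
proof -
  obtain C where C: "C > 0" "\<And>Q e. Q \<in> cubes \<Longrightarrow> \<exists>\<phi>\<in>dual_space s. rho p V Q e \<le> norm (blinfun_apply \<phi> e) \<and>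
    dual_mass Q \<phi> \<le> C powr q * vol Q"
    using norming_constant_exists unfolding norming_constant_def by blast
  define B where "B = C / c"
  have B0: "B > 0" using C(1) c by (simp add: B_def)
  have "mass Q e \<le> B powr p * mass E e"
    if Q: "Q \<in> cubes" and E: "E \<in> sets lebesgue" "E \<subseteq> Q" and m: "c * vol Q \<le> vol E" for Q E e
  proof -
    let ?m = "vol Q" and ?A = "mass E e powr (1 / p)"
    have m0: "?m > 0" by (rule cube_measure(2)[OF Q])
    obtain \<phi> where \<phi>: "\<phi> \<in> dual_space s" "rho p V Q e \<le> norm (blinfun_apply \<phi> e)"
      "dual_mass Q \<phi> \<le> C powr q * ?m" using C(2)[OF Q] by blast
    have "dual_mass Q \<phi> powr (1 / q) \<le> (C powr q * ?m) powr (1 / q)"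
      using p1 dual_mass_nonneg \<phi>(3) by (intro powr_mono2) auto
    also have "\<dots> = ?m powr (1 / q) * C"
      using p1 C(1) by (simp add: powr_mult powr_powr mult.commute)
    finally have "dual_mass Q \<phi> powr (1 / q) \<le> ?m powr (1 / q) * C" .
    moreover have "dual_mass E \<phi> powr (1 / q) \<le> dual_mass Q \<phi> powr (1 / q)"
      using dual_mass_mono[OF Q \<phi>(1) E(2,1)] dual_mass_nonneg p1 by (intro powr_mono2) auto
    ultimately have W: "dual_mass E \<phi> powr (1 / q) \<le> ?m powr (1 / q) * C" by linarith
    have "rho p V Q e * (c * ?m) \<le> norm (blinfun_apply \<phi> e) * vol E"
      using m \<phi>(2) m0 c by (intro mult_mono) auto
    also have "\<dots> \<le> ?A * dual_mass E \<phi> powr (1 / q)" by (rule set_pairing[OF Q E(2,1) \<phi>(1)])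
    also have "\<dots> \<le> ?A * (?m powr (1 / q) * C)" using W by (rule mult_left_mono) simp
    finally have "rho p V Q e \<le> B * ?A * (?m powr (1 / q) / ?m)"
      using m0 c by (simp add: B_def field_simps)
    also have "?m powr (1 / q) / ?m = ?m powr (- (1 / p))"
    proof -
      have "1 / q - 1 = - (1 / p)" using p1 by (simp add: field_simps)
      then show ?thesis using powr_diff[of ?m "1 / q" 1] m0 by simp
    qed
    finally have "rho p V Q e powr p \<le> (B * ?A * ?m powr (- (1 / p))) powr p"
      using p1 rho_nonneg by (intro powr_mono2) auto
    also have "\<dots> = B powr p * mass E e * ?m powr (- 1)"
      using p1 mass_nonneg[of E e] B0 by (simp add: powr_mult powr_powr)
    finally have "?m * rho p V Q e powr p \<le> ?m * (B powr p * mass E e * ?m powr (- 1))"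
      using m0 by (intro mult_left_mono) auto
    then show ?thesis
      unfolding rho_powr[OF Q] using m0 by (simp add: powr_minus field_simps)
  qed
  then show ?thesis using B0 by (intro exI[of _ "B powr p"]) auto
qed

subsection \<open>The uniform estimate for finite sparse families\<close>

text \<open>What remains of e being the average of b f with |V f| <= G and |b| <= 1. Only scalar
  pairings occur, so the condition passes to limits where the vector integral may fail to
  exist.\<close>

definition pairing_bound :: "(real^'n \<Rightarrow> real) \<Rightarrow> (real^'n) set \<Rightarrow> 'x \<Rightarrow> bool"
  where "pairing_bound G Q e \<longleftrightarrow> (\<forall>\<phi>\<in>dual_space s. norm (blinfun_apply \<phi> e) * vol Q \<le>
    (LINT x|lebesgue. indicator Q x * (norm (W x \<phi>) * G x)))"

text \<open>Tests the pairing bound with a functional norming e and applies Hoelder's inequality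
  with weight u. The factor 2 allowed on the dual side is the loss in
  \<open>exponential_depth_integral\<close>.\<close>

lemma mass_le_weighted_average:
  assumes C: "norming_constant C" and Q: "Q \<in> cubes" and pair: "pairing_bound G Q e"
    and G: "G \<in> borel_measurable lebesgue" "\<And>x. 0 \<le> G x"
    and u: "u \<in> borel_measurable lebesgue" "\<And>x. 0 < u x"
    and iG: "integrable lebesgue (\<lambda>x. indicator Q x * (u x powr (1 - p) * G x powr p))"
    and iu: "\<And>\<phi>. \<phi> \<in> dual_space s \<Longrightarrow> integrable lebesgue (\<lambda>x. indicator Q x * (u x * norm (W x \<phi>) powr q))"
    and le: "\<And>\<phi>. \<phi> \<in> dual_space s \<Longrightarrow>
      (LINT x|lebesgue. indicator Q x * (u x * norm (W x \<phi>) powr q)) \<le> 2 * dual_mass Q \<phi>"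
  shows "mass Q e \<le> (2 powr (1 / q) * C) powr p * (LINT x|lebesgue. indicator Q x * (u x powr (1 - p) * G x powr p))"
proof -
  have C0: "C > 0" using C by (simp add: norming_constant_def)
  let ?m = "vol Q"
  define g where "g = (LINT x|lebesgue. indicator Q x * (u x powr (1 - p) * G x powr p))"
  have g0: "g \<ge> 0" unfolding g_def by (intro integral_nonneg_AE AE_I2) auto
  have m0: "?m > 0" by (rule cube_measure(2)[OF Q])
  obtain \<phi> where \<phi>: "\<phi> \<in> dual_space s" "rho p V Q e \<le> norm (blinfun_apply \<phi> e)"
    "dual_mass Q \<phi> \<le> C powr q * ?m" using C Q unfolding norming_constant_def by blast
  have "rho p V Q e * ?m \<le> norm (blinfun_apply \<phi> e) * ?m" using \<phi>(2) m0 by simp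
  also have "\<dots> \<le> (LINT x|lebesgue. indicator Q x * (norm (W x \<phi>) * G x))"
    using pair \<phi>(1) unfolding pairing_bound_def by blast
  also have "\<dots> \<le> g powr (1 / p) * (LINT x|lebesgue. indicator Q x * (u x * norm (W x \<phi>) powr q)) powr (1 / q)"
    unfolding g_def using iu[OF \<phi>(1)] \<phi>(1) G u iG fmeasurableD[OF cube_measure(1)[OF Q]]
    by (intro weighted_Hoelder) auto
  also have "\<dots> \<le> g powr (1 / p) * (2 * (C powr q * ?m)) powr (1 / q)"
  proof (intro mult_left_mono powr_mono2)
    show "(LINT x|lebesgue. indicator Q x * (u x * norm (W x \<phi>) powr q)) \<le> 2 * (C powr q * ?m)"
      using le[OF \<phi>(1)] \<phi>(3) by linarith
    show "0 \<le> (LINT x|lebesgue. indicator Q x * (u x * norm (W x \<phi>) powr q))"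
      using u by (intro integral_nonneg_AE AE_I2) (auto simp: less_imp_le)
  qed (use p1 in auto)
  also have "(2 * (C powr q * ?m)) powr (1 / q) = (2 powr (1 / q) * C) * ?m powr (1 / q)"
  proof -
    have "(C powr q) powr (1 / q) = C" using p1 C0 by (simp add: powr_powr)
    then show ?thesis by (simp only: powr_mult mult.assoc)
  qed
  finally have "rho p V Q e \<le> (2 powr (1 / q) * C) * g powr (1 / p) * (?m powr (1 / q) / ?m)"
    using m0 by (simp add: field_simps)
  also have "?m powr (1 / q) / ?m = ?m powr (- (1 / p))"
  proof -
    have "1 / q - 1 = - (1 / p)" using p1 by (simp add: field_simps)
    then show ?thesis using powr_diff[of ?m "1 / q" 1] m0 by simp
  qed
  finally have "rho p V Q e powr p \<le> ((2 powr (1 / q) * C) * g powr (1 / p) * ?m powr (- (1 / p))) powr p"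
    using p1 rho_nonneg by (intro powr_mono2) auto
  also have "\<dots> = (2 powr (1 / q) * C) powr p * g * ?m powr (- 1)"
    using p1 g0 unfolding powr_mult powr_powr by simp
  finally have "?m * rho p V Q e powr p \<le> ?m * ((2 powr (1 / q) * C) powr p * g * ?m powr (- 1))"
    using m0 by (intro mult_left_mono) auto
  then show ?thesis unfolding g_def[symmetric] rho_powr[OF Q] using m0 by (simp add: powr_minus field_simps)
qed

theorem sparse_estimate:
  assumes c: "0 < c"
  shows "\<exists>K>0. \<forall>F E G e. finite F \<longrightarrow> F \<subseteq> dyadic_cubes \<longrightarrow> sparse_family c E F \<longrightarrow>
    G \<in> borel_measurable lebesgue \<longrightarrow> (\<forall>x. 0 \<le> G x) \<longrightarrow> integrable lebesgue (\<lambda>x. G x powr p) \<longrightarrow>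
    (\<forall>Q\<in>F. pairing_bound G Q (e Q)) \<longrightarrow>
    integrable lebesgue (\<lambda>x. (\<Sum>Q\<in>F. indicator Q x * norm (V x (e Q))) powr p) \<and>
    (LINT x|lebesgue. (\<Sum>Q\<in>F. indicator Q x * norm (V x (e Q))) powr p) \<le> K * (LINT x|lebesgue. G x powr p)"
proof -
  obtain D1 where D1: "D1 > 0" "\<forall>Q\<in>cubes. \<forall>E\<in>sets lebesgue. E \<subseteq> Q \<longrightarrow>
      c * vol Q \<le> vol E \<longrightarrow> (\<forall>e. mass Q e \<le> D1 * mass E e)"
    using mass_comparison[OF c] by (elim exE conjE) (rule that)
  obtain D2 where D2: "D2 > 0" "\<forall>Q\<in>cubes. \<forall>E\<in>sets lebesgue. E \<subseteq> Q \<longrightarrow>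
      c * vol Q \<le> vol E \<longrightarrow> (\<forall>\<phi>\<in>dual_space s. dual_mass Q \<phi> \<le> D2 * dual_mass E \<phi>)"
    using dual_mass_comparison[OF c] by (elim exE conjE) (rule that)
  obtain N where N: "norming_constant N" using norming_constant_exists ..
  define B where "B = (2 powr (1 / q) * N) powr p"
  have B: "B > 0" using N by (simp add: B_def norming_constant_def)
  \<comment> \<open>The larger constant, so that one z serves both weights.\<close>
  define C where "C = max D1 D2"
  have C: "C > 0" "D1 \<le> C" "D2 \<le> C" using D1(1) by (auto simp: C_def)
  define z where "z = 1 + 1 / (2 * C)"
  have z: "z > 1" using C by (simp add: z_def)
  \<comment> \<open>Chosen with \<eta>^(1-p) = z: splitting the sum with the weights \<eta>^n then
    produces exactly the factors z^n that the weight of V absorbs.\<close>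
  define \<eta> where "\<eta> = z powr (- 1 / (p - 1))"
  have "(- 1 / (p - 1)) * (1 - p) = 1" using p1 by (simp add: field_simps)
  then have \<eta>: "0 < \<eta>" "\<eta> < 1" "\<eta> powr (1 - p) = z"
    using z p1 unfolding \<eta>_def powr_powr by (auto simp: powr_less_one)
  have \<eta>_pow: "(\<eta> ^ n) powr (1 - p) = z ^ n" for n
  proof -
    have "(\<eta> ^ n) powr (1 - p) = (\<eta> powr (1 - p)) ^ n"
      using \<eta>(1) by (simp add: powr_realpow[symmetric] powr_powr mult.commute)
    then show ?thesis by (simp add: \<eta>(3))
  qed
  \<comment> \<open>For u = z^n the factor left on the side of G is u^(1-p) = y^n. As y < 1, it sums
    geometrically over the cubes at a point.\<close>
  define y where "y = z powr (1 - p)"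
  have y: "0 < y" "y < 1" using z p1 by (auto simp: y_def powr_less_one)
  \<comment> \<open>The first factor bounds the power of the sum of the \<eta>^n, the 2 comes from
    the exponential integral for V, and B from the norming functionals.\<close>
  define L where "L = (1 / (1 - \<eta>)) powr (p - 1) * (2 * B)"
  have L: "L > 0" using \<eta> B by (simp add: L_def)
  define K where "K = L * (1 / (1 - y))"
  have main: "integrable lebesgue (\<lambda>x. (\<Sum>Q\<in>F. indicator Q x * norm (V x (e Q))) powr p) \<and>
    (LINT x|lebesgue. (\<Sum>Q\<in>F. indicator Q x * norm (V x (e Q))) powr p) \<le> K * (LINT x|lebesgue. G x powr p)"
    if F: "finite F" "F \<subseteq> dyadic_cubes" and sparse: "sparse_family c E F"
      and G: "G \<in> borel_measurable lebesgue" "\<forall>x. 0 \<le> G x" "integrable lebesgue (\<lambda>x. G x powr p)"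
      and e: "\<forall>Q\<in>F. pairing_bound G Q (e Q)"
    for F E G e
  proof -
    have disj: "disjoint_family_on E F"
      and E: "\<forall>Q\<in>F. E Q \<subseteq> Q \<and> E Q \<in> sets lebesgue \<and> c * vol Q \<le> vol (E Q)"
      using sparse by (auto simp: sparse_family_def)
    have Fc: "F \<subseteq> cubes" using F(2) dyadic_cube_in_cubes by blast
    have Fs: "F \<subseteq> sets lebesgue" using Fc cube_measure(1) by (blast intro: fmeasurableD)
    have lam: "laminar F" using laminar_dyadic_cubes F(2) unfolding laminar_def by blast
    note [measurable] = depth_measurable[OF F(1) Fs] G(1)
    have FQ [measurable]: "Q \<in> F \<Longrightarrow> Q \<in> sets lebesgue" for Q using Fs by blast
    \<comment> \<open>Both weights are instances: comparability on the sets E Q gives packing, and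
      packing controls the integral of z^n w.\<close>
    have ex: "integrable lebesgue (\<lambda>x. indicator Q x * (z ^ depth F Q x * w x))"
        "(LINT x|lebesgue. indicator Q x * (z ^ depth F Q x * w x)) \<le> 2 * (LINT x|lebesgue. indicator Q x * w x)"
      if w: "w \<in> borel_measurable lebesgue" "\<And>x. 0 \<le> w x"
        and int: "\<And>Q. Q \<in> F \<Longrightarrow> integrable lebesgue (\<lambda>x. indicator Q x * w x)"
        and D: "D \<le> C" "\<And>Q. Q \<in> F \<Longrightarrow>
          (LINT x|lebesgue. indicator Q x * w x) \<le> D * (LINT x|lebesgue. indicator (E Q) x * w x)"
        and Q: "Q \<in> F" for w D Q
    proof -
      have pack: "(\<Sum>R\<in>{R\<in>F. R \<subset> Q}. LINT x|lebesgue. indicator R x * w x)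
          \<le> C * (LINT x|lebesgue. indicator Q x * w x)" if "Q \<in> F" for Q
      proof (rule carleson_packing[OF F(1) Fc disj _ w int _ C(1) that])
        fix Q assume Q: "Q \<in> F"
        have "0 \<le> (LINT x|lebesgue. indicator (E Q) x * w x)" using w(2) by (intro integral_nonneg_AE AE_I2) auto
        then show "(LINT x|lebesgue. indicator Q x * w x) \<le> C * (LINT x|lebesgue. indicator (E Q) x * w x)"
          using D(2)[OF Q] mult_right_mono[OF D(1)] order_trans by blast
      qed (use E in auto)
      note X = exponential_depth_integral[OF F(1) lam Fs w int C(1) pack z_def Q]
      show "integrable lebesgue (\<lambda>x. indicator Q x * (z ^ depth F Q x * w x))"
        "(LINT x|lebesgue. indicator Q x * (z ^ depth F Q x * w x)) \<le> 2 * (LINT x|lebesgue. indicator Q x * w x)"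
        using X by auto
    qed
    have zV: "integrable lebesgue (\<lambda>x. indicator Q x * (z ^ depth F Q x * norm (V x e) powr p))"
        "(LINT x|lebesgue. indicator Q x * (z ^ depth F Q x * norm (V x e) powr p)) \<le> 2 * mass Q e" if Q: "Q \<in> F" for Q e
      unfolding mass_def using mass_integrable_cube Fc E D1(2)[unfolded mass_def]
      by (intro ex[OF _ _ _ C(2) _ Q]; auto)+
    have zW: "integrable lebesgue (\<lambda>x. indicator Q x * (z ^ depth F Q x * norm (W x \<phi>) powr q))"
        "(LINT x|lebesgue. indicator Q x * (z ^ depth F Q x * norm (W x \<phi>) powr q)) \<le> 2 * dual_mass Q \<phi>"
      if Q: "Q \<in> F" and \<phi>: "\<phi> \<in> dual_space s" for Q \<phi>
      unfolding dual_mass_def using dual_mass_integrable_cube \<phi> Fc E D2(2)[unfolded dual_mass_def] norm_W_measurable[OF \<phi>]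
      by (intro ex[OF _ _ _ C(3) _ Q]; auto)+
    define g where "g Q x = indicator Q x * (y ^ depth F Q x * G x powr p)" for Q x
    have yz: "y ^ n = (z ^ n) powr (1 - p)" for n
      using z by (simp add: y_def powr_realpow[symmetric] powr_powr mult.commute)
    have ig: "integrable lebesgue (g Q)" if "Q \<in> F" for Q
    proof (rule integrable_dominated[OF G(3)])
      show "g Q \<in> borel_measurable lebesgue" unfolding g_def[abs_def] using FQ[OF that] by measurable
      have "y ^ depth F Q x * G x powr p \<le> 1 * G x powr p" for x
        using y by (intro mult_right_mono power_le_one) auto
      then show "AE x in lebesgue. norm (g Q x) \<le> norm (G x powr p)"
        using y by (intro AE_I2) (auto simp: g_def indicator_def abs_mult)
    qed
    \<comment> \<open>\<open>mass_le_weighted_average\<close> with u = z^n, so that u^(1-p) is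
      y^n.\<close>
    have mass: "mass Q (e Q) \<le> B * (LINT x|lebesgue. g Q x)" if Q: "Q \<in> F" for Q
    proof -
      have gz: "g Q x = indicator Q x * ((z ^ depth F Q x) powr (1 - p) * G x powr p)" for x
        by (simp add: g_def yz)
      show ?thesis unfolding gz B_def
        using Q Fc G ig[OF Q, unfolded gz[abs_def]] z zW[OF Q] e
        by (intro mass_le_weighted_average N) (auto simp: gz)
    qed
    define H where "H x = (\<Sum>Q\<in>F. indicator Q x * norm (V x (e Q)))" for x
    have Hle: "H x powr p \<le> (1 / (1 - \<eta>)) powr (p - 1) *
        (\<Sum>Q\<in>F. indicator Q x * (z ^ depth F Q x * norm (V x (e Q)) powr p))" for x
    proof -
      let ?C = "{Q\<in>F. x \<in> Q}"
      have sum_C: "(\<Sum>Q\<in>F. indicator Q x * f Q) = (\<Sum>Q\<in>?C. f Q)" for f :: "_ \<Rightarrow> real"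
        using F(1) by (intro sum.mono_neutral_cong_right) (auto simp: indicator_def split: if_splits)
      have "H x powr p = (\<Sum>Q\<in>?C. norm (V x (e Q))) powr p" by (simp add: H_def sum_C)
      also have "\<dots> \<le> (\<Sum>Q\<in>?C. \<eta> ^ depth F Q x) powr (p - 1) *
          (\<Sum>Q\<in>?C. (\<eta> ^ depth F Q x) powr (1 - p) * norm (V x (e Q)) powr p)"
        using F(1) \<eta> by (intro weighted_sum_powr_le p1) auto
      also have "\<dots> \<le> (1 / (1 - \<eta>)) powr (p - 1) *
          (\<Sum>Q\<in>?C. (\<eta> ^ depth F Q x) powr (1 - p) * norm (V x (e Q)) powr p)"
        using sum_power_depth_le[OF F(1) lam, of \<eta> x] \<eta> p1
        by (intro mult_right_mono powr_mono2 sum_nonneg) (auto simp: sum_C)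
      finally show ?thesis by (simp add: sum_C \<eta>_pow)
    qed
    have [measurable]: "H \<in> borel_measurable lebesgue"
      unfolding H_def[abs_def] using FQ by (intro borel_measurable_sum borel_measurable_times) auto
    define R where "R x = (1 / (1 - \<eta>)) powr (p - 1) *
        (\<Sum>Q\<in>F. indicator Q x * (z ^ depth F Q x * norm (V x (e Q)) powr p))" for x
    have iR: "integrable lebesgue R" unfolding R_def using zV(1) by (intro integrable_mult_right integrable_sum) auto
    have iH: "integrable lebesgue (\<lambda>x. H x powr p)"
      by (rule integrable_dominated[OF iR]) (use Hle in \<open>auto simp: R_def intro!: order_trans[OF _ abs_ge_self]\<close>)
    have "(LINT x|lebesgue. H x powr p) \<le> (LINT x|lebesgue. R x)"
      using Hle by (intro integral_mono iH iR) (simp add: R_def)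
    also have "\<dots> = (1 / (1 - \<eta>)) powr (p - 1) *
        (\<Sum>Q\<in>F. LINT x|lebesgue. indicator Q x * (z ^ depth F Q x * norm (V x (e Q)) powr p))"
      unfolding R_def using zV(1) by (subst integral_mult_right_zero) (subst Bochner_Integration.integral_sum, auto)
    also have "\<dots> \<le> (1 / (1 - \<eta>)) powr (p - 1) * (\<Sum>Q\<in>F. 2 * (B * (LINT x|lebesgue. g Q x)))"
    proof (intro mult_left_mono sum_mono)
      fix Q assume Q: "Q \<in> F"
      show "(LINT x|lebesgue. indicator Q x * (z ^ depth F Q x * norm (V x (e Q)) powr p)) \<le> 2 * (B * (LINT x|lebesgue. g Q x))"
        using zV(2)[OF Q, of "e Q"] mass[OF Q] by linarith
    qed simp
    also have "\<dots> = L * (LINT x|lebesgue. (\<Sum>Q\<in>F. g Q x))"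
      using ig by (subst Bochner_Integration.integral_sum) (auto simp: L_def sum_distrib_left sum_distrib_right mult_ac)
    also have "\<dots> \<le> L * (LINT x|lebesgue. 1 / (1 - y) * G x powr p)"
    proof (intro mult_left_mono integral_mono)
      show "integrable lebesgue (\<lambda>x. \<Sum>Q\<in>F. g Q x)" using ig by auto
      show "integrable lebesgue (\<lambda>x. 1 / (1 - y) * G x powr p)" using G(3) by (rule integrable_mult_right)
      fix x
      have "(\<Sum>Q\<in>F. g Q x) = (\<Sum>Q\<in>F. indicator Q x * y ^ depth F Q x) * G x powr p"
        by (simp add: g_def sum_distrib_right mult.assoc)
      also have "\<dots> \<le> 1 / (1 - y) * G x powr p"
        using y by (intro mult_right_mono sum_power_depth_le F(1) lam) auto
      finally show "(\<Sum>Q\<in>F. g Q x) \<le> 1 / (1 - y) * G x powr p" .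
    qed (use L in simp)
    also have "\<dots> = K * (LINT x|lebesgue. G x powr p)" by (simp add: K_def)
    finally show ?thesis using iH by (simp add: H_def)
  qed
  have "K > 0" using L y by (simp add: K_def)
  then show ?thesis using main by (intro exI[of _ K]) blast
qed

end

section \<open>The averages and their extension to the weighted space\<close>

text \<open>The Hahn-Banach theorem for the norm itself, at the vector x - y.\<close>

lemma dual_space_separates:
  assumes s: "banach_scaling s" and eq: "\<And>\<phi>. \<phi> \<in> dual_space s \<Longrightarrow> blinfun_apply \<phi> x = blinfun_apply \<phi> y"
  shows "x = y"
proof -
  have nc: "\<forall>c x. norm (s c x) = norm c * norm x" using s by (simp add: banach_scaling_def)
  obtain \<kappa> where HB: "\<forall>q K e. (\<forall>x y. q (x + y) \<le> q x + q y) \<longrightarrow> (\<forall>c x. q (s c x) = norm c * q x) \<longrightarrow>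
    (\<forall>x. q x \<le> K * norm x) \<longrightarrow>
    (\<exists>\<phi>\<in>dual_space s. (\<forall>x. norm (blinfun_apply \<phi> x) \<le> \<kappa> * q x) \<and> q e \<le> norm (blinfun_apply \<phi> e))"
    using Hahn_Banach_dual_space[OF s] by (elim exE conjE) (rule that)
  obtain \<phi> where \<phi>: "\<phi> \<in> dual_space s" "norm (x - y) \<le> norm (blinfun_apply \<phi> (x - y))"
    using HB[rule_format, of norm 1 "x - y"] nc by (auto simp: norm_triangle_ineq)
  then show ?thesis using eq[OF \<phi>(1)] by (simp add: blinfun.diff_right)
qed

lemma bounded_linear_scaling:
  assumes s: "banach_scaling s"
  shows "bounded_linear (s c)"
proof (rule bounded_linear_intro[where K="norm c"])
  interpret vs: vector_space s using s by (simp add: banach_scaling_def)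
  have sr: "s (of_real r) x = r *\<^sub>R x" for r x using s by (simp add: banach_scaling_def)
  show "s c (x + y) = s c x + s c y" for x y by (rule vs.scale_right_distrib)
  show "s c (r *\<^sub>R x) = r *\<^sub>R s c x" for r x by (metis sr vs.scale_left_commute)
  show "norm (s c x) \<le> norm x * norm c" for x using s by (simp add: banach_scaling_def)
qed

lemma tendsto_scaling:
  assumes s: "banach_scaling s" and a: "(a \<longlongrightarrow> c) F" and b: "(b \<longlongrightarrow> x) F"
  shows "((\<lambda>i. s (a i) (b i)) \<longlongrightarrow> s c x) F"
proof -
  interpret vs: vector_space s using s by (simp add: banach_scaling_def)
  have n: "norm (s c x) = norm c * norm x" for c x using s by (simp add: banach_scaling_def)
  have "((\<lambda>i. norm (a i - c) * norm (b i)) \<longlongrightarrow> 0 * norm x) F"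
    by (intro tendsto_mult tendsto_norm b) (use tendsto_norm_zero[OF LIM_zero[OF a]] in simp)
  then have "((\<lambda>i. norm (s (a i - c) (b i))) \<longlongrightarrow> 0) F" by (simp add: n)
  from tendsto_add[OF tendsto_norm_zero_cancel[OF this] bounded_linear.tendsto[OF bounded_linear_scaling[OF s] b, of c]]
  show ?thesis by (simp add: vs.scale_left_diff_distrib)
qed

lemma strongly_measurable_scaling:
  fixes a :: "real^'n \<Rightarrow> 'k::{real_normed_field,euclidean_space}"
  assumes s: "banach_scaling s" and a: "a \<in> borel_measurable lebesgue" and f: "strongly_measurable f"
  shows "strongly_measurable (\<lambda>x. s (a x) (f x))"
  using borel_measurable_imp_strongly_measurable[OF a] f
  by (rule strongly_measurable_compose2[where h=s]) (rule tendsto_scaling[OF s])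

text \<open>Every functional sends two candidates to the integral of one scalar function, and
  functionals separate points. Hence the \<open>THE\<close> in \<open>strong_integral\<close>
  denotes the limit.\<close>

lemma strong_integral_eqI:
  fixes f :: "real^'n \<Rightarrow> 'x::banach" and s :: "'k::{real_normed_field,euclidean_space} \<Rightarrow> 'x \<Rightarrow> 'x"
  assumes s: "banach_scaling s" and I: "has_strong_integral f I"
  shows "strong_integral f = I"
proof -
  have "J = I" if J: "has_strong_integral f J" for J
  proof (rule dual_space_separates[OF s])
    fix \<phi> :: "'x \<Rightarrow>\<^sub>L 'k"
    have "bounded_linear (blinfun_apply \<phi>)" by (rule blinfun.bounded_linear_right)
    from has_strong_integral_bounded_linear[OF J this] has_strong_integral_bounded_linear[OF I this]
    show "blinfun_apply \<phi> J = blinfun_apply \<phi> I" by (rule has_bochner_integral_eq)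
  qed
  then show ?thesis
    unfolding strong_integral_def by (rule the_equality[of "has_strong_integral f", OF I])
qed

lemma strong_integral_dual:
  fixes f :: "real^'n \<Rightarrow> 'x::banach" and s :: "'k::{real_normed_field,euclidean_space} \<Rightarrow> 'x \<Rightarrow> 'x"
  assumes s: "banach_scaling s" and f: "strongly_measurable f" "integrable lebesgue (\<lambda>x. norm (f x))"
  shows "has_bochner_integral lebesgue (\<lambda>x. blinfun_apply \<phi> (f x)) (blinfun_apply \<phi> (strong_integral f) :: 'k)"
proof -
  obtain I where I: "has_strong_integral f I" using has_strong_integral_exists[OF f] by blast
  have "bounded_linear (blinfun_apply \<phi>)" by (rule blinfun.bounded_linear_right)
  from has_strong_integral_bounded_linear[OF I this] show ?thesis
    by (simp only: strong_integral_eqI[OF s I])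
qed

context Ap_space
begin

section \<open>The weighted space and truncation\<close>

lemma weighted_Lp_iff:
  "f \<in> wLp \<longleftrightarrow> strongly_measurable f \<and> integrable lebesgue (\<lambda>x. norm (V x (f x)) powr p)"
  using strongly_measurable_apply[OF V_measurable V_linear] by (auto simp: weighted_Lp_def Lp_def)

lemma weighted_norm_eq: "wnorm f = (LINT x|lebesgue. norm (V x (f x)) powr p) powr (1 / p)"
  by (simp add: weighted_norm_def Lp_norm_def)

lemma weighted_norm_powr: "wnorm f powr p = (LINT x|lebesgue. norm (V x (f x)) powr p)"
  using p1 by (simp add: weighted_norm_eq powr_powr)

lemma weighted_norm_nonneg: "0 \<le> wnorm f"
  by (simp add: weighted_norm_eq)

lemma norm_V_apply_measurable:
  "strongly_measurable f \<Longrightarrow> (\<lambda>x. norm (V x (f x))) \<in> borel_measurable lebesgue"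
  by (rule strongly_measurable_norm[OF strongly_measurable_apply[OF V_measurable V_linear]])

lemma weighted_Lp_bounded:
  assumes f: "strongly_measurable f" and g: "g \<in> wLp"
    and le: "\<And>x. norm (V x (f x)) \<le> C * norm (V x (g x))" and C: "0 \<le> C"
  shows "f \<in> wLp" "wnorm f \<le> C * wnorm g"
proof -
  note [measurable] = norm_V_apply_measurable[OF f]
  have ig: "integrable lebesgue (\<lambda>x. C powr p * norm (V x (g x)) powr p)"
    using g by (simp add: weighted_Lp_iff)
  have le': "norm (V x (f x)) powr p \<le> C powr p * norm (V x (g x)) powr p" for x
    using powr_mono2[OF _ _ le[of x], of p] p1 C by (simp add: powr_mult)
  show "f \<in> wLp" unfolding weighted_Lp_iff
    by (intro conjI f integrable_dominated[OF ig]) (use le' in auto)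
  have "(LINT x|lebesgue. norm (V x (f x)) powr p) \<le> (LINT x|lebesgue. C powr p * norm (V x (g x)) powr p)"
    by (rule integral_mono'[OF ig]) (use le' in auto)
  then have "wnorm f \<le> (C powr p * (LINT x|lebesgue. norm (V x (g x)) powr p)) powr (1 / p)"
    unfolding weighted_norm_eq using p1 by (intro powr_mono2) auto
  also have "\<dots> = C * wnorm g"
    using p1 C by (simp add: weighted_norm_eq powr_mult powr_powr)
  finally show "wnorm f \<le> C * wnorm g" .
qed

lemma weighted_Lp_add:
  assumes f: "f \<in> wLp" and g: "g \<in> wLp"
  shows "(\<lambda>x. f x + g x) \<in> wLp"
    "wnorm (\<lambda>x. f x + g x) \<le> wnorm f + wnorm g"
proof -
  have sm: "strongly_measurable f" "strongly_measurable g" using f g by (auto simp: weighted_Lp_iff)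
  note sum = strongly_measurable_add[OF sm]
  note [measurable] = norm_V_apply_measurable[OF sm(1)] norm_V_apply_measurable[OF sm(2)] norm_V_apply_measurable[OF sum]
  have int: "integrable lebesgue (\<lambda>x. (norm (V x (f x)) + norm (V x (g x))) powr p)"
    using f g p1 by (intro integrable_powr_add) (auto simp: weighted_Lp_iff)
  have le: "norm (V x (f x + g x)) powr p \<le> (norm (V x (f x)) + norm (V x (g x))) powr p" for x
    using p1 norm_triangle_ineq[of "V x (f x)" "V x (g x)"] by (intro powr_mono2) (auto simp: V_add)
  show "(\<lambda>x. f x + g x) \<in> wLp" unfolding weighted_Lp_iff
    by (intro conjI sum integrable_dominated[OF int]) (use le in auto)
  have "(LINT x|lebesgue. norm (V x (f x + g x)) powr p) \<le> (LINT x|lebesgue. (norm (V x (f x)) + norm (V x (g x))) powr p)"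
    by (rule integral_mono'[OF int]) (use le in auto)
  then have "wnorm (\<lambda>x. f x + g x) \<le> (LINT x|lebesgue. (norm (V x (f x)) + norm (V x (g x))) powr p) powr (1 / p)"
    unfolding weighted_norm_eq using p1 by (intro powr_mono2) auto
  also have "\<dots> \<le> wnorm f + wnorm g"
    unfolding weighted_norm_eq using f g by (intro Minkowski_integral p1) (auto simp: weighted_Lp_iff)
  finally show "wnorm (\<lambda>x. f x + g x) \<le> wnorm f + wnorm g" .
qed

lemma weighted_Lp_scale:
  assumes "f \<in> wLp"
  shows "(\<lambda>x. s c (f x)) \<in> wLp" "wnorm (\<lambda>x. s c (f x)) \<le> norm c * wnorm f"
proof -
  have sm: "strongly_measurable (\<lambda>x. s c (f x))"
    using assms by (intro strongly_measurable_bounded_linear[OF bounded_linear_scaling[OF scaling]]) (simp add: weighted_Lp_iff)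
  have le: "norm (V x (s c (f x))) \<le> norm c * norm (V x (f x))" for x by (simp add: V_scale norm_scale)
  show "(\<lambda>x. s c (f x)) \<in> wLp" "wnorm (\<lambda>x. s c (f x)) \<le> norm c * wnorm f"
    using weighted_Lp_bounded[OF sm assms le] by simp_all
qed

lemma weighted_Lp_diff:
  assumes f: "f \<in> wLp" and g: "g \<in> wLp"
  shows "(\<lambda>x. f x - g x) \<in> wLp"
    "wnorm (\<lambda>x. f x - g x) \<le> wnorm f + wnorm g"
proof -
  interpret vs: vector_space s using scaling by (simp add: banach_scaling_def)
  have "(\<lambda>x. s (-1) (g x)) = (\<lambda>x. - g x)" by (simp add: vs.scale_minus_left)
  then have "(\<lambda>x. - g x) \<in> wLp" "wnorm (\<lambda>x. - g x) \<le> wnorm g"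
    using weighted_Lp_scale[OF g, of "-1"] by simp_all
  then show "(\<lambda>x. f x - g x) \<in> wLp"
    "wnorm (\<lambda>x. f x - g x) \<le> wnorm f + wnorm g"
    using weighted_Lp_add[OF f, of "\<lambda>x. - g x"] by auto
qed

text \<open>Cut by the size of f, not in space: b already lives on Q, so b times the truncation is
  bounded with support in Q, hence integrable. By linearity V x maps the truncation to V x (f x) or
  to 0.\<close>

definition truncate :: "(real^'n \<Rightarrow> 'x) \<Rightarrow> nat \<Rightarrow> real^'n \<Rightarrow> 'x"
  where "truncate f N x = indicator {x. norm (f x) \<le> real N} x *\<^sub>R f x"

lemma truncate_weighted_Lp:
  assumes f: "f \<in> wLp"
  shows "truncate f N \<in> wLp"
proof (rule weighted_Lp_bounded(1)[OF _ f])
  have sm: "strongly_measurable f" using f by (simp add: weighted_Lp_iff)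
  note [measurable] = strongly_measurable_norm[OF sm]
  have "Measurable.pred lebesgue (\<lambda>x. norm (f x) \<le> real N)" by measurable
  then have "{x. norm (f x) \<le> real N} \<in> sets lebesgue" by (simp add: pred_def)
  then show "strongly_measurable (truncate f N)"
    unfolding truncate_def[abs_def] using sm by (rule strongly_measurable_indicator)
  show "norm (V x (truncate f N x)) \<le> 1 * norm (V x (f x))" for x
    by (simp add: truncate_def indicator_def V_zero)
qed simp

text \<open>At each x the truncation eventually equals f x, and |V f|^p dominates.\<close>

lemma truncate_tendsto:
  assumes f: "f \<in> wLp"
  shows "(\<lambda>N. wnorm (\<lambda>x. f x - truncate f N x)) \<longlonglongrightarrow> 0"
proof -
  have "(\<lambda>N. LINT x|lebesgue. norm (V x (f x - truncate f N x)) powr p) \<longlonglongrightarrow> (\<integral>x. 0 \<partial>(lebesgue :: (real^'n) measure))"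
  proof (rule integral_dominated_convergence[where w="\<lambda>x. norm (V x (f x)) powr p"])
    show "integrable lebesgue (\<lambda>x. norm (V x (f x)) powr p)" using f by (simp add: weighted_Lp_iff)
    show "(\<lambda>x. norm (V x (f x - truncate f N x)) powr p) \<in> borel_measurable lebesgue" for N
    proof -
      have "(\<lambda>x. f x - truncate f N x) \<in> wLp"
        by (rule weighted_Lp_diff(1)[OF f truncate_weighted_Lp[OF f]])
      then have "strongly_measurable (\<lambda>x. f x - truncate f N x)" by (simp add: weighted_Lp_iff)
      note [measurable] = norm_V_apply_measurable[OF this]
      show ?thesis by measurable
    qed
    show "AE x in lebesgue. norm (norm (V x (f x - truncate f N x)) powr p) \<le> norm (V x (f x)) powr p" for N
      by (intro AE_I2) (simp add: truncate_def indicator_def V_zero)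
    show "AE x in lebesgue. (\<lambda>N. norm (V x (f x - truncate f N x)) powr p) \<longlonglongrightarrow> 0"
    proof (intro AE_I2 tendsto_eventually)
      fix x
      obtain n where n: "norm (f x) \<le> real n" using real_arch_simple by blast
      show "\<forall>\<^sub>F N in sequentially. norm (V x (f x - truncate f N x)) powr p = 0"
        using eventually_ge_at_top[of n]
      proof eventually_elim
        case (elim N)
        then have "norm (f x) \<le> real N" using n by linarith
        then show ?case by (simp add: truncate_def V_zero)
      qed
    qed
  qed simp_all
  then have "(\<lambda>N. LINT x|lebesgue. norm (V x (f x - truncate f N x)) powr p) \<longlonglongrightarrow> 0" by simp
  then have "(\<lambda>N. (LINT x|lebesgue. norm (V x (f x - truncate f N x)) powr p) powr (1 / p)) \<longlonglongrightarrow> 0 powr (1 / p)"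
    using p1 by (intro tendsto_powr') auto
  then show ?thesis by (simp add: weighted_norm_eq)
qed

definition cut_off :: "(real^'n) set \<Rightarrow> (real^'n \<Rightarrow> 'k) \<Rightarrow> bool"
  where "cut_off Q b \<longleftrightarrow> b \<in> borel_measurable lebesgue \<and> (\<forall>x. x \<notin> Q \<longrightarrow> b x = 0) \<and> (\<forall>x. norm (b x) \<le> 1)"

lemma cut_off_norm: "cut_off Q b \<Longrightarrow> norm (b x) \<le> indicator Q x"
  by (auto simp: cut_off_def indicator_def)

abbreviation domain where "domain b \<equiv> averaging_domain s p V b"

lemma domain_iff:
  assumes b: "cut_off Q b"
  shows "g \<in> domain b \<longleftrightarrow> g \<in> wLp \<and> integrable lebesgue (\<lambda>x. norm (s (b x) (g x)))"
  using b strongly_measurable_scaling[OF scaling]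
  by (auto simp: averaging_domain_def Lp_def weighted_Lp_iff cut_off_def)

lemma truncate_domain:
  assumes Q: "Q \<in> cubes" and b: "cut_off Q b" and f: "f \<in> wLp"
  shows "truncate f N \<in> domain b"
  unfolding domain_iff[OF b]
proof
  show t: "truncate f N \<in> wLp" by (rule truncate_weighted_Lp[OF f])
  have iQ: "integrable lebesgue (\<lambda>x. real N * indicator Q x)"
    using cube_measure(1)[OF Q] by (intro integrable_mult_right integrable_real_indicator) (auto simp: fmeasurable_def)
  show "integrable lebesgue (\<lambda>x. norm (s (b x) (truncate f N x)))"
  proof (rule integrable_dominated[OF iQ])
    show "(\<lambda>x. norm (s (b x) (truncate f N x))) \<in> borel_measurable lebesgue"
      using t b by (intro strongly_measurable_norm strongly_measurable_scaling[OF scaling]) (auto simp: weighted_Lp_iff cut_off_def)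
    show "AE x in lebesgue. norm (norm (s (b x) (truncate f N x))) \<le> norm (real N * indicator Q x)"
    proof (intro AE_I2)
      fix x
      have "norm (truncate f N x) \<le> real N" by (simp add: truncate_def indicator_def)
      then have "norm (b x) * norm (truncate f N x) \<le> indicator Q x * real N"
        using cut_off_norm[OF b, of x] by (intro mult_mono) auto
      then show "norm (norm (s (b x) (truncate f N x))) \<le> norm (real N * indicator Q x)"
        by (simp add: norm_scale mult.commute)
    qed
  qed
qed

section \<open>Averages on the dense subspace\<close>

definition average :: "(real^'n) set \<Rightarrow> (real^'n \<Rightarrow> 'k) \<Rightarrow> (real^'n \<Rightarrow> 'x) \<Rightarrow> 'x"
  where "average Q b g = (1 / vol Q) *\<^sub>R strong_integral (\<lambda>y. s (b y) (g y))"

lemma averaging_term_average: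
  assumes b: "cut_off Q b"
  shows "averaging_term s Q a b g x = s (a x) (average Q b g)"
proof -
  interpret vs: vector_space s using scaling by (simp add: banach_scaling_def)
  have "(\<lambda>y. indicator Q y *\<^sub>R s (b y) (g y)) = (\<lambda>y. s (b y) (g y))"
    using b by (auto simp: cut_off_def indicator_def fun_eq_iff)
  then show ?thesis by (simp add: averaging_term_def average_def)
qed

lemma average_dual:
  assumes Q: "Q \<in> cubes" and b: "cut_off Q b" and g: "g \<in> domain b" and \<phi>: "\<phi> \<in> dual_space s"
  shows "has_bochner_integral lebesgue (\<lambda>y. b y * blinfun_apply \<phi> (g y)) (vol Q *\<^sub>R blinfun_apply \<phi> (average Q b g))"
proof -
  have "strongly_measurable (\<lambda>y. s (b y) (g y))"
    using g b unfolding domain_iff[OF b] by (intro strongly_measurable_scaling[OF scaling]) (auto simp: weighted_Lp_iff cut_off_def)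
  then have "has_bochner_integral lebesgue (\<lambda>y. blinfun_apply \<phi> (s (b y) (g y))) (blinfun_apply \<phi> (strong_integral (\<lambda>y. s (b y) (g y))))"
    using g unfolding domain_iff[OF b] by (intro strong_integral_dual[OF scaling]) auto
  moreover have "blinfun_apply \<phi> (s c e) = c * blinfun_apply \<phi> e" for c e using \<phi> by (simp add: dual_space_def)
  ultimately show ?thesis
    using cube_measure(2)[OF Q] by (simp add: average_def blinfun.scaleR_right)
qed

text \<open>Identities between averages are tested by functionals, where they become linearity of
  the scalar integral.\<close>

lemma average_eqI:
  assumes Q: "Q \<in> cubes" and b: "cut_off Q b" and g: "g \<in> domain b"
    and e: "\<And>\<phi>. \<phi> \<in> dual_space s \<Longrightarrow>
      has_bochner_integral lebesgue (\<lambda>y. b y * blinfun_apply \<phi> (g y)) (vol Q *\<^sub>R blinfun_apply \<phi> e)"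
  shows "average Q b g = e"
proof (rule dual_space_separates[OF scaling])
  fix \<phi> assume \<phi>: "\<phi> \<in> dual_space s"
  show "blinfun_apply \<phi> (average Q b g) = blinfun_apply \<phi> e"
    using has_bochner_integral_eq[OF average_dual[OF Q b g \<phi>] e[OF \<phi>]] cube_measure(2)[OF Q] by simp
qed

lemma domain_add:
  assumes b: "cut_off Q b" and f: "f \<in> domain b" and g: "g \<in> domain b"
  shows "(\<lambda>x. f x + g x) \<in> domain b"
  unfolding domain_iff[OF b]
proof
  interpret vs: vector_space s using scaling by (simp add: banach_scaling_def)
  show w: "(\<lambda>x. f x + g x) \<in> wLp" using f g unfolding domain_iff[OF b] by (intro weighted_Lp_add) auto
  have i: "integrable lebesgue (\<lambda>x. norm (s (b x) (f x)) + norm (s (b x) (g x)))"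
    using f g unfolding domain_iff[OF b] by auto
  show "integrable lebesgue (\<lambda>x. norm (s (b x) (f x + g x)))"
  proof (rule integrable_dominated[OF i])
    show "(\<lambda>x. norm (s (b x) (f x + g x))) \<in> borel_measurable lebesgue"
      using w b by (intro strongly_measurable_norm strongly_measurable_scaling[OF scaling]) (auto simp: weighted_Lp_iff cut_off_def)
    show "AE x in lebesgue. norm (norm (s (b x) (f x + g x))) \<le> norm (norm (s (b x) (f x)) + norm (s (b x) (g x)))"
      by (intro AE_I2) (simp add: vs.scale_right_distrib norm_triangle_ineq)
  qed
qed

lemma average_add:
  assumes Q: "Q \<in> cubes" and b: "cut_off Q b" and f: "f \<in> domain b" and g: "g \<in> domain b"
  shows "average Q b (\<lambda>x. f x + g x) = average Q b f + average Q b g"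
proof (rule average_eqI[OF Q b domain_add[OF b f g]])
  fix \<phi> assume \<phi>: "\<phi> \<in> dual_space s"
  show "has_bochner_integral lebesgue (\<lambda>y. b y * blinfun_apply \<phi> (f y + g y))
      (vol Q *\<^sub>R blinfun_apply \<phi> (average Q b f + average Q b g))"
    using has_bochner_integral_add[OF average_dual[OF Q b f \<phi>] average_dual[OF Q b g \<phi>]]
    by (simp add: blinfun.add_right distrib_left scaleR_add_right)
qed

lemma domain_scale:
  assumes b: "cut_off Q b" and f: "f \<in> domain b"
  shows "(\<lambda>x. s c (f x)) \<in> domain b"
proof -
  have "norm (s (b x) (s c (f x))) = norm c * norm (s (b x) (f x))" for x by (simp add: norm_scale)
  then show ?thesis using f unfolding domain_iff[OF b] by (auto intro: weighted_Lp_scale)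
qed

lemma average_scale:
  assumes Q: "Q \<in> cubes" and b: "cut_off Q b" and f: "f \<in> domain b"
  shows "average Q b (\<lambda>x. s c (f x)) = s c (average Q b f)"
proof (rule average_eqI[OF Q b domain_scale[OF b f]])
  fix \<phi> assume \<phi>: "\<phi> \<in> dual_space s"
  then have "blinfun_apply \<phi> (s c e) = c * blinfun_apply \<phi> e" for e by (simp add: dual_space_def)
  then show "has_bochner_integral lebesgue (\<lambda>y. b y * blinfun_apply \<phi> (s c (f y)))
      (vol Q *\<^sub>R blinfun_apply \<phi> (s c (average Q b f)))"
    using has_bochner_integral_mult_right[OF average_dual[OF Q b f \<phi>], of c]
    by (simp add: mult.left_commute)
qed

lemma average_diff:
  assumes Q: "Q \<in> cubes" and b: "cut_off Q b" and f: "f \<in> domain b" and g: "g \<in> domain b"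
  shows "(\<lambda>x. f x - g x) \<in> domain b" "average Q b (\<lambda>x. f x - g x) = average Q b f - average Q b g"
proof -
  interpret vs: vector_space s using scaling by (simp add: banach_scaling_def)
  show "(\<lambda>x. f x - g x) \<in> domain b" "average Q b (\<lambda>x. f x - g x) = average Q b f - average Q b g"
    using domain_add[OF b f domain_scale[OF b g, of "-1"]] average_add[OF Q b f domain_scale[OF b g, of "-1"]]
      average_scale[OF Q b g, of "-1"]
    by (simp_all add: vs.scale_minus_left)
qed

lemma pairing_integrable:
  assumes Q: "Q \<in> cubes" and f: "f \<in> wLp" and \<phi>: "\<phi> \<in> dual_space s"
  shows "integrable lebesgue (\<lambda>x. indicator Q x * (norm (W x \<phi>) * norm (V x (f x))))"
proof -
  have Qs [measurable]: "Q \<in> sets lebesgue" using cube_measure(1)[OF Q] by (rule fmeasurableD)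
  have [measurable]: "(\<lambda>x. norm (V x (f x))) \<in> borel_measurable lebesgue"
    using f by (intro norm_V_apply_measurable) (simp add: weighted_Lp_iff)
  have i: "integrable lebesgue (\<lambda>x. norm (V x (f x)) powr p)" using f by (simp add: weighted_Lp_iff)
  have "integrable lebesgue (\<lambda>x. indicator Q x * norm (V x (f x)) powr p)"
    by (rule integrable_dominated[OF i]) (auto simp: indicator_def)
  then show ?thesis
    using weighted_Hoelder(1)[OF \<phi> Qs, of "\<lambda>x. norm (V x (f x))" "\<lambda>_. 1"] dual_mass_integrable_cube[OF Q \<phi>] by simp
qed

text \<open>The functional passes under the integral, and the pairing of V^{-*} \<phi> with V g
  bounds the integrand on Q.\<close>

lemma average_pairing:
  assumes Q: "Q \<in> cubes" and b: "cut_off Q b" and g: "g \<in> domain b"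
  shows "pairing_bound (\<lambda>x. norm (V x (g x))) Q (average Q b g)"
  unfolding pairing_bound_def
proof
  fix \<phi> assume \<phi>: "\<phi> \<in> dual_space s"
  have gw: "g \<in> wLp" using g domain_iff[OF b] by blast
  note H = average_dual[OF Q b g \<phi>]
  have "norm (blinfun_apply \<phi> (average Q b g)) * vol Q = norm (LINT y|lebesgue. b y * blinfun_apply \<phi> (g y))"
    using has_bochner_integral_integral_eq[OF H] cube_measure(2)[OF Q] by (simp add: mult.commute)
  also have "\<dots> \<le> (LINT y|lebesgue. norm (b y * blinfun_apply \<phi> (g y)))" by (rule integral_norm_bound)
  also have "\<dots> \<le> (LINT x|lebesgue. indicator Q x * (norm (W x \<phi>) * norm (V x (g x))))"
  proof (rule integral_mono_AE)
    show "integrable lebesgue (\<lambda>y. norm (b y * blinfun_apply \<phi> (g y)))"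
      using H by (intro integrable_norm) (simp add: has_bochner_integral_iff)
    show "AE x in lebesgue. norm (b x * blinfun_apply \<phi> (g x)) \<le> indicator Q x * (norm (W x \<phi>) * norm (V x (g x)))"
      using AE_pairing[of \<phi> g]
    proof eventually_elim
      case (elim x)
      then show ?case using cut_off_norm[OF b, of x] by (simp add: norm_mult mult_mono)
    qed
  qed (rule pairing_integrable[OF Q gw \<phi>])
  finally show "norm (blinfun_apply \<phi> (average Q b g)) * vol Q \<le>
    (LINT x|lebesgue. indicator Q x * (norm (W x \<phi>) * norm (V x (g x))))" .
qed

text \<open>The case u = 1 of \<open>mass_le_weighted_average\<close>. It yields the boundedness of
  the operator attached to one cube.\<close>

lemma mass_pairing_bound:
  assumes C: "norming_constant C" and Q: "Q \<in> cubes" and f: "f \<in> wLp"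
    and pair: "pairing_bound (\<lambda>x. norm (V x (f x))) Q e"
  shows "mass Q e \<le> (2 powr (1 / q) * C * wnorm f) powr p"
proof -
  have Qs [measurable]: "Q \<in> sets lebesgue" using cube_measure(1)[OF Q] by (rule fmeasurableD)
  have [measurable]: "(\<lambda>x. norm (V x (f x))) \<in> borel_measurable lebesgue"
    using f by (intro norm_V_apply_measurable) (simp add: weighted_Lp_iff)
  have i: "integrable lebesgue (\<lambda>x. norm (V x (f x)) powr p)" using f by (simp add: weighted_Lp_iff)
  have i': "integrable lebesgue (\<lambda>x. indicator Q x * norm (V x (f x)) powr p)"
    by (rule integrable_dominated[OF i]) (auto simp: indicator_def)
  have "mass Q e \<le> (2 powr (1 / q) * C) powr p *
      (LINT x|lebesgue. indicator Q x * (1 powr (1 - p) * norm (V x (f x)) powr p))"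
  proof (rule mass_le_weighted_average[OF C Q pair])
    fix \<phi> assume \<phi>: "\<phi> \<in> dual_space s"
    show "integrable lebesgue (\<lambda>x. indicator Q x * (1 * norm (W x \<phi>) powr q))"
      "(LINT x|lebesgue. indicator Q x * (1 * norm (W x \<phi>) powr q)) \<le> 2 * dual_mass Q \<phi>"
      using dual_mass_integrable_cube[OF Q \<phi>] dual_mass_nonneg[of Q \<phi>] by (simp_all add: dual_mass_def)
  qed (use i' in auto)
  also have "\<dots> \<le> (2 powr (1 / q) * C) powr p * (LINT x|lebesgue. norm (V x (f x)) powr p)"
    using i' by (intro mult_left_mono integral_mono i) (auto simp: indicator_def)
  also have "\<dots> = (2 powr (1 / q) * C * wnorm f) powr p"
    by (simp only: powr_mult weighted_norm_powr)
  finally show ?thesis .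
qed

text \<open>The bound for \<open>mass\<close> becomes one for the norm, because a multiple of
  \<open>rho\<close> dominates the norm. K depends on Q, which is harmless: it serves only to extend
  the average continuously.\<close>

lemma average_bound:
  assumes Q: "Q \<in> cubes"
  shows "\<exists>K>0. \<forall>b g. cut_off Q b \<longrightarrow> g \<in> domain b \<longrightarrow> norm (average Q b g) \<le> K * wnorm g"
proof -
  obtain C where C: "norming_constant C" using norming_constant_exists ..
  define B where "B = 2 powr (1 / q) * C"
  have B: "B > 0" using C by (simp add: B_def norming_constant_def)
  obtain K where K: "K > 0" "\<And>e. norm e \<le> K * rho p V Q e" using norm_le_rho[OF Q] by blast
  let ?m = "vol Q"
  have m0: "?m > 0" by (rule cube_measure(2)[OF Q])
  have "norm (average Q b g) \<le> (K * B / ?m powr (1 / p)) * wnorm g"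
    if b: "cut_off Q b" and g: "g \<in> domain b" for b g
  proof -
    have gw: "g \<in> wLp" using g domain_iff[OF b] by blast
    have "mass Q (average Q b g) \<le> (B * wnorm g) powr p"
      unfolding B_def by (rule mass_pairing_bound[OF C Q gw average_pairing[OF Q b g]])
    then have "rho p V Q (average Q b g) \<le> ((B * wnorm g) powr p / ?m) powr (1 / p)"
      unfolding rho_mass using m0 p1 mass_nonneg by (intro powr_mono2 divide_right_mono) auto
    also have "\<dots> = B * wnorm g / ?m powr (1 / p)"
      using p1 m0 B weighted_norm_nonneg[of g] by (simp add: powr_divide powr_powr)
    finally have "K * rho p V Q (average Q b g) \<le> K * (B * wnorm g / ?m powr (1 / p))"
      using K(1) by (intro mult_left_mono) auto
    then show ?thesis using K(2)[of "average Q b g"] by simp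
  qed
  moreover have "K * B / ?m powr (1 / p) > 0" using K(1) B m0 by simp
  ultimately show ?thesis by (intro exI[of _ "K * B / ?m powr (1 / p)"]) blast
qed

text \<open>
  For unbounded \<open>f\<close> the product \<open>b f\<close> need not be integrable, since only \<open>V f\<close> is controlled.
\<close>

definition coefficient :: "(real^'n) set \<Rightarrow> (real^'n \<Rightarrow> 'k) \<Rightarrow> (real^'n \<Rightarrow> 'x) \<Rightarrow> 'x"
  where "coefficient Q b f = lim (\<lambda>N. average Q b (truncate f N))"

text \<open>Averages of differences are bounded by the weighted norm, so every sequence from the
  domain that converges to f gives the same limit. This frees \<open>coefficient\<close> from the
  particular truncation.\<close>

lemma average_tendsto:
  assumes Q: "Q \<in> cubes" and b: "cut_off Q b" and f: "f \<in> wLp"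
    and g: "\<And>N. g N \<in> domain b" and lim: "(\<lambda>N. wnorm (\<lambda>x. f x - g N x)) \<longlonglongrightarrow> 0"
  shows "(\<lambda>N. average Q b (g N)) \<longlonglongrightarrow> coefficient Q b f"
proof -
  obtain K where K: "K > 0" "\<And>g. g \<in> domain b \<Longrightarrow> norm (average Q b g) \<le> K * wnorm g"
    using average_bound[OF Q] b by metis
  have cmp: "norm (average Q b h - average Q b h') \<le> K * wnorm (\<lambda>x. f x - h x) + K * wnorm (\<lambda>x. f x - h' x)"
    if h: "h \<in> domain b" "h' \<in> domain b" for h h'
  proof -
    have w: "h \<in> wLp" "h' \<in> wLp" using h domain_iff[OF b] by auto
    have "norm (average Q b h - average Q b h') \<le> K * wnorm (\<lambda>x. h x - h' x)"
      using K(2)[OF average_diff(1)[OF Q b h]] average_diff(2)[OF Q b h] by simp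
    also have "wnorm (\<lambda>x. h x - h' x) \<le> wnorm (\<lambda>x. f x - h' x) + wnorm (\<lambda>x. f x - h x)"
      using weighted_Lp_diff(2)[OF weighted_Lp_diff(1)[OF f w(2)] weighted_Lp_diff(1)[OF f w(1)]] by simp
    finally show ?thesis using K(1) by (simp add: distrib_left add.commute)
  qed
  define t where "t N = truncate f N" for N
  have t: "t N \<in> domain b" for N unfolding t_def by (rule truncate_domain[OF Q b f])
  have tl: "(\<lambda>N. K * wnorm (\<lambda>x. f x - t N x)) \<longlonglongrightarrow> 0"
    unfolding t_def using tendsto_mult_right_zero[OF truncate_tendsto[OF f]] by simp
  have "Cauchy (\<lambda>N. average Q b (t N))"
  proof (rule metric_CauchyI)
    fix r :: real assume "r > 0"
    then have "\<forall>\<^sub>F N in sequentially. K * wnorm (\<lambda>x. f x - t N x) < r / 2"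
      using tl by (intro order_tendstoD) auto
    then obtain M where M: "\<And>N. N \<ge> M \<Longrightarrow> K * wnorm (\<lambda>x. f x - t N x) < r / 2"
      unfolding eventually_sequentially by blast
    have "dist (average Q b (t m)) (average Q b (t n)) < r" if "m \<ge> M" "n \<ge> M" for m n
      using cmp[OF t[of m] t[of n]] M[OF that(1)] M[OF that(2)] by (simp add: dist_norm)
    then show "\<exists>M. \<forall>m\<ge>M. \<forall>n\<ge>M. dist (average Q b (t m)) (average Q b (t n)) < r" by blast
  qed
  then have "convergent (\<lambda>N. average Q b (t N))" by (rule Cauchy_convergent)
  then have ct: "(\<lambda>N. average Q b (t N)) \<longlonglongrightarrow> coefficient Q b f"
    unfolding coefficient_def t_def by (simp add: convergent_LIMSEQ_iff)
  have "(\<lambda>N. K * wnorm (\<lambda>x. f x - g N x) + K * wnorm (\<lambda>x. f x - t N x)) \<longlonglongrightarrow> 0"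
    using tendsto_add[OF tendsto_mult_right_zero[OF lim, of K] tl] by simp
  then have "(\<lambda>N. average Q b (g N) - average Q b (t N)) \<longlonglongrightarrow> 0"
    by (rule tendsto_norm_zero_cancel[OF tendsto_sandwich[OF _ _ tendsto_const, rotated 2]])
      (use cmp[OF g t] in auto)
  from tendsto_add[OF this ct] show ?thesis by simp
qed

lemma coefficient_truncate:
  assumes "Q \<in> cubes" "cut_off Q b" "f \<in> wLp"
  shows "(\<lambda>N. average Q b (truncate f N)) \<longlonglongrightarrow> coefficient Q b f"
  by (rule average_tendsto[OF assms truncate_domain[OF assms] truncate_tendsto[OF assms(3)]])

lemma coefficient_eq_average:
  assumes Q: "Q \<in> cubes" and b: "cut_off Q b" and f: "f \<in> domain b"
  shows "coefficient Q b f = average Q b f"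
proof (rule LIMSEQ_unique[OF _ tendsto_const])
  have "f \<in> wLp" using f domain_iff[OF b] by blast
  then show "(\<lambda>N::nat. average Q b f) \<longlonglongrightarrow> coefficient Q b f"
    by (rule average_tendsto[OF Q b _ f]) (simp add: weighted_norm_eq V_zero)
qed

text \<open>Truncation is not additive. The sums of truncations form another admissible sequence for
  f + g, and \<open>average_tendsto\<close> identifies the limits.\<close>

lemma coefficient_add:
  assumes Q: "Q \<in> cubes" and b: "cut_off Q b" and f: "f \<in> wLp" and g: "g \<in> wLp"
  shows "coefficient Q b (\<lambda>x. f x + g x) = coefficient Q b f + coefficient Q b g"
proof (rule LIMSEQ_unique)
  note t = truncate_domain[OF Q b f] truncate_domain[OF Q b g]
  let ?h = "\<lambda>N x. truncate f N x + truncate g N x"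
  show "(\<lambda>N. average Q b (?h N)) \<longlonglongrightarrow> coefficient Q b (\<lambda>x. f x + g x)"
  proof (rule average_tendsto[OF Q b weighted_Lp_add(1)[OF f g] domain_add[OF b t]])
    have le: "wnorm (\<lambda>x. f x + g x - ?h N x) \<le>
        wnorm (\<lambda>x. f x - truncate f N x) + wnorm (\<lambda>x. g x - truncate g N x)" for N
    proof -
      have "(\<lambda>x. f x + g x - ?h N x) = (\<lambda>x. (f x - truncate f N x) + (g x - truncate g N x))"
        by (simp add: algebra_simps)
      then show ?thesis
        using weighted_Lp_add(2)[OF weighted_Lp_diff(1)[OF f truncate_weighted_Lp[OF f]]
            weighted_Lp_diff(1)[OF g truncate_weighted_Lp[OF g]], of N N] by simp
    qed
    show "(\<lambda>N. wnorm (\<lambda>x. f x + g x - ?h N x)) \<longlonglongrightarrow> 0"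
      by (rule tendsto_sandwich[OF _ always_eventually[OF allI[OF le]] tendsto_const])
        (use tendsto_add[OF truncate_tendsto[OF f] truncate_tendsto[OF g]] weighted_norm_nonneg in auto)
  qed
  show "(\<lambda>N. average Q b (?h N)) \<longlonglongrightarrow> coefficient Q b f + coefficient Q b g"
    unfolding average_add[OF Q b t] by (intro tendsto_add coefficient_truncate Q b f g)
qed

lemma coefficient_scale:
  assumes Q: "Q \<in> cubes" and b: "cut_off Q b" and f: "f \<in> wLp"
  shows "coefficient Q b (\<lambda>x. s c (f x)) = s c (coefficient Q b f)"
proof (rule LIMSEQ_unique)
  interpret vs: vector_space s using scaling by (simp add: banach_scaling_def)
  note t = truncate_domain[OF Q b f]
  show "(\<lambda>N. average Q b (\<lambda>x. s c (truncate f N x))) \<longlonglongrightarrow> coefficient Q b (\<lambda>x. s c (f x))"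
  proof (rule average_tendsto[OF Q b weighted_Lp_scale(1)[OF f] domain_scale[OF b t]])
    have le: "wnorm (\<lambda>x. s c (f x) - s c (truncate f N x)) \<le>
        norm c * wnorm (\<lambda>x. f x - truncate f N x)" for N
      using weighted_Lp_scale(2)[OF weighted_Lp_diff(1)[OF f truncate_weighted_Lp[OF f]], of c N]
      by (simp add: vs.scale_right_diff_distrib)
    show "(\<lambda>N. wnorm (\<lambda>x. s c (f x) - s c (truncate f N x))) \<longlonglongrightarrow> 0"
      by (rule tendsto_sandwich[OF _ always_eventually[OF allI[OF le]] tendsto_const])
        (use tendsto_mult_right_zero[OF truncate_tendsto[OF f]] weighted_norm_nonneg in auto)
  qed
  show "(\<lambda>N. average Q b (\<lambda>x. s c (truncate f N x))) \<longlonglongrightarrow> s c (coefficient Q b f)"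
    unfolding average_scale[OF Q b t]
    by (intro bounded_linear.tendsto[OF bounded_linear_scaling[OF scaling]] coefficient_truncate Q b f)
qed

text \<open>Truncation only decreases |V f|, so all averages obey the bound with f itself on the
  right, and a fixed right-hand side survives the limit.\<close>

lemma coefficient_pairing:
  assumes Q: "Q \<in> cubes" and b: "cut_off Q b" and f: "f \<in> wLp"
  shows "pairing_bound (\<lambda>x. norm (V x (f x))) Q (coefficient Q b f)"
  unfolding pairing_bound_def
proof (rule ballI, rule LIMSEQ_le_const2)
  fix \<phi> assume \<phi>: "\<phi> \<in> dual_space s"
  show "(\<lambda>N. norm (blinfun_apply \<phi> (average Q b (truncate f N))) * vol Q)
      \<longlonglongrightarrow> norm (blinfun_apply \<phi> (coefficient Q b f)) * vol Q"
    by (intro tendsto_intros coefficient_truncate Q b f)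
  have "norm (blinfun_apply \<phi> (average Q b (truncate f N))) * vol Q \<le>
    (LINT x|lebesgue. indicator Q x * (norm (W x \<phi>) * norm (V x (f x))))" for N
  proof -
    have "norm (blinfun_apply \<phi> (average Q b (truncate f N))) * vol Q \<le>
      (LINT x|lebesgue. indicator Q x * (norm (W x \<phi>) * norm (V x (truncate f N x))))"
      using average_pairing[OF Q b truncate_domain[OF Q b f]] \<phi> unfolding pairing_bound_def by blast
    also have "(LINT x|lebesgue. indicator Q x * (norm (W x \<phi>) * norm (V x (truncate f N x))))
        \<le> (LINT x|lebesgue. indicator Q x * (norm (W x \<phi>) * norm (V x (f x))))"
      by (rule integral_mono'[OF pairing_integrable[OF Q f \<phi>]]) (auto simp: truncate_def indicator_def V_zero)
    finally show ?thesis .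
  qed
  then show "\<exists>N. \<forall>n\<ge>N. norm (blinfun_apply \<phi> (average Q b (truncate f n))) * vol Q \<le>
    (LINT x|lebesgue. indicator Q x * (norm (W x \<phi>) * norm (V x (f x))))" by blast
qed

end

section \<open>Summation over the sparse family\<close>

text \<open>Completeness of Lebesgue measure: the exceptional set is a null set, hence
  measurable.\<close>

lemma AE_sets_lebesgue:
  assumes "AE x in lebesgue. P x"
  shows "{x. P x} \<in> sets lebesgue"
proof -
  have "{x \<in> space lebesgue. \<not> P x} \<in> null_sets lebesgue"
    using assms unfolding completion.AE_iff_null_sets .
  then have "space lebesgue - {x \<in> space lebesgue. \<not> P x} \<in> sets lebesgue"
    by (intro sets.compl_sets null_setsD2)
  moreover have "space lebesgue - {x \<in> space lebesgue. \<not> P x} = {x. P x}" by auto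
  ultimately show ?thesis by simp
qed

text \<open>Replaces the net of finite subsets by an increasing sequence, for which the convergence
  theorems of integration hold.\<close>

lemma countable_exhaustion:
  assumes "countable S"
  obtains F :: "nat \<Rightarrow> 'a set" where "\<And>i. finite (F i)" "\<And>i. F i \<subseteq> S" "mono F"
    "\<And>A. finite A \<Longrightarrow> A \<subseteq> S \<Longrightarrow> \<exists>i. A \<subseteq> F i" "filterlim F (finite_subsets_at_top S) sequentially"
proof -
  define F where "F i = {Q\<in>S. to_nat_on S Q \<le> i}" for i
  have F: "finite (F i)" "F i \<subseteq> S" for i
  proof -
    show "finite (F i)"
    proof (rule finite_imageD)
      show "finite (to_nat_on S ` F i)" by (rule finite_subset[of _ "{..i}"]) (auto simp: F_def)
      show "inj_on (to_nat_on S) (F i)" using inj_on_to_nat_on[OF assms] by (rule inj_on_subset) (auto simp: F_def)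
    qed
  qed (auto simp: F_def)
  have mono: "mono F" by (auto simp: mono_def F_def)
  have exh: "\<exists>i. A \<subseteq> F i" if "finite A" "A \<subseteq> S" for A
    using that by (intro exI[of _ "Max (to_nat_on S ` A)"]) (auto simp: F_def)
  have "filterlim F (finite_subsets_at_top S) sequentially"
    unfolding filterlim_iff eventually_finite_subsets_at_top
  proof safe
    fix P X assume X: "finite X" "X \<subseteq> S" "\<forall>Y. finite Y \<and> X \<subseteq> Y \<and> Y \<subseteq> S \<longrightarrow> P Y"
    obtain n where "X \<subseteq> F n" using exh[OF X(1,2)] by blast
    then have "P (F i)" if "i \<ge> n" for i
      using X(3) F monoD[OF mono that] by (metis order_trans)
    then show "\<forall>\<^sub>F i in sequentially. P (F i)" by (auto simp: eventually_sequentially)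
  qed
  with F mono exh show thesis by (rule that)
qed

text \<open>Monotone convergence puts the full sum in L^p, so it is finite almost everywhere;
  dominated convergence then makes the remainders small. One finite set with small remainder is
  enough for unconditional convergence, as the terms are nonnegative.\<close>

lemma nonneg_family_sum_powr:
  fixes v :: "'i \<Rightarrow> real^'n \<Rightarrow> real"
  assumes S: "countable S" and p: "0 < p" and B: "0 \<le> B"
    and meas: "\<And>Q. Q \<in> S \<Longrightarrow> v Q \<in> borel_measurable lebesgue" and nn: "\<And>Q x. 0 \<le> v Q x"
    and int: "\<And>F. finite F \<Longrightarrow> F \<subseteq> S \<Longrightarrow> integrable lebesgue (\<lambda>x. (\<Sum>Q\<in>F. v Q x) powr p)"
    and bound: "\<And>F. finite F \<Longrightarrow> F \<subseteq> S \<Longrightarrow> (LINT x|lebesgue. (\<Sum>Q\<in>F. v Q x) powr p) \<le> B"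
  shows "AE x in lebesgue. (\<lambda>Q. v Q x) summable_on S"
    and "integrable lebesgue (\<lambda>x. (\<Sum>\<^sub>\<infinity>Q\<in>S. v Q x) powr p)"
    and "(LINT x|lebesgue. (\<Sum>\<^sub>\<infinity>Q\<in>S. v Q x) powr p) \<le> B"
    and "\<epsilon> > 0 \<Longrightarrow> \<exists>F. finite F \<and> F \<subseteq> S \<and> integrable lebesgue (\<lambda>x. \<bar>(\<Sum>\<^sub>\<infinity>Q\<in>S. v Q x) - (\<Sum>Q\<in>F. v Q x)\<bar> powr p) \<and>
      (LINT x|lebesgue. \<bar>(\<Sum>\<^sub>\<infinity>Q\<in>S. v Q x) - (\<Sum>Q\<in>F. v Q x)\<bar> powr p) < \<epsilon>"
proof -
  obtain F :: "nat \<Rightarrow> 'i set" where F: "\<And>i. finite (F i)" "\<And>i. F i \<subseteq> S" "mono F"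
    "\<And>A. finite A \<Longrightarrow> A \<subseteq> S \<Longrightarrow> \<exists>i. A \<subseteq> F i" "filterlim F (finite_subsets_at_top S) sequentially"
    by (rule countable_exhaustion[OF S]) (rule that)
  define h where "h i x = (\<Sum>Q\<in>F i. v Q x)" for i x
  \<comment> \<open>This is 0 by convention where the family is not summable; the extended function
    \<open>U\<close> below detects those points.\<close>
  define H where "H x = (\<Sum>\<^sub>\<infinity>Q\<in>S. v Q x)" for x
  have h_nn: "0 \<le> h i x" for i x unfolding h_def by (intro sum_nonneg nn)
  have [measurable]: "h i \<in> borel_measurable lebesgue" for i
    unfolding h_def[abs_def] using F(2) by (intro borel_measurable_sum meas) auto
  have h_mono: "h i x \<le> h j x" if "i \<le> j" for i j x
    unfolding h_def using F(1) monoD[OF F(3) that] nn by (intro sum_mono2) auto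
  have le: "sum (\<lambda>Q. v Q x) A \<le> h i x" if "A \<subseteq> F i" for A i x
    unfolding h_def using F(1) that nn by (intro sum_mono2) auto
  define U where "U x = (SUP i. ennreal (h i x powr p))" for x
  have "(\<integral>\<^sup>+x. U x \<partial>lebesgue) = (SUP i. \<integral>\<^sup>+x. ennreal (h i x powr p) \<partial>lebesgue)"
    unfolding U_def
  proof (rule nn_integral_monotone_convergence_SUP)
    show "incseq (\<lambda>i x. ennreal (h i x powr p))"
      using h_mono h_nn p by (auto simp: incseq_def le_fun_def intro!: ennreal_leI powr_mono2)
  qed measurable
  also have "\<dots> \<le> ennreal B"
  proof (rule SUP_least)
    fix i
    have "(\<integral>\<^sup>+x. ennreal (h i x powr p) \<partial>lebesgue) = ennreal (LINT x|lebesgue. h i x powr p)"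
      using int[OF F(1,2), of i] by (intro nn_integral_eq_integral) (auto simp: h_def)
    also have "\<dots> \<le> ennreal B" using bound[OF F(1,2), of i] by (intro ennreal_leI) (simp add: h_def)
    finally show "(\<integral>\<^sup>+x. ennreal (h i x powr p) \<partial>lebesgue) \<le> ennreal B" .
  qed
  finally have UB: "(\<integral>\<^sup>+x. U x \<partial>lebesgue) \<le> ennreal B" .
  have [measurable]: "U \<in> borel_measurable lebesgue" unfolding U_def[abs_def] by measurable
  have "(\<integral>\<^sup>+x. U x \<partial>lebesgue) \<noteq> \<infinity>" using UB by (metis ennreal_neq_top infinity_ennreal_def top.extremum_uniqueI)
  then have "AE x in lebesgue. U x \<noteq> \<infinity>" by (intro nn_integral_PInf_AE) auto
  then show ae: "AE x in lebesgue. (\<lambda>Q. v Q x) summable_on S"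
  proof eventually_elim
    case (elim x)
    then obtain M where M: "M \<ge> 0" "U x = ennreal M" by (metis ennreal_cases infinity_ennreal_def)
    have hM: "h i x \<le> M powr (1 / p)" for i
    proof -
      have "ennreal (h i x powr p) \<le> ennreal M" unfolding M(2)[symmetric] U_def by (rule SUP_upper) simp
      then have "h i x powr p \<le> M" using M(1) by (simp add: ennreal_le_iff)
      then have "(h i x powr p) powr (1 / p) \<le> M powr (1 / p)" using p by (intro powr_mono2) auto
      then show ?thesis using p h_nn[of i x] by (simp add: powr_powr)
    qed
    have "sum (\<lambda>Q. v Q x) A \<le> M powr (1 / p)" if A: "finite A" "A \<subseteq> S" for A
      using F(4)[OF A] le hM order_trans by meson
    then show "(\<lambda>Q. v Q x) summable_on S"
      by (intro nonneg_bdd_above_summable_on nn bdd_aboveI2[where M="M powr (1 / p)"]) auto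
  qed
  define G where "G = {x. (\<lambda>Q. v Q x) summable_on S}"
  have aeG: "AE x in lebesgue. x \<in> G" using ae by (simp add: G_def)
  have [measurable]: "G \<in> sets lebesgue" unfolding G_def by (rule AE_sets_lebesgue[OF ae])
  have lim: "(\<lambda>i. h i x) \<longlonglongrightarrow> H x" and hH: "h i x \<le> H x" if "x \<in> G" for x i
  proof -
    have sm: "(\<lambda>Q. v Q x) summable_on S" using that by (simp add: G_def)
    from filterlim_compose[OF infsum_tendsto[OF sm] F(5)] show "(\<lambda>i. h i x) \<longlonglongrightarrow> H x"
      by (simp add: h_def H_def)
    show "h i x \<le> H x" unfolding h_def H_def using sm F(1,2) nn by (intro finite_sum_le_infsum) auto
  qed
  have [measurable]: "H \<in> borel_measurable lebesgue"
  proof (rule borel_measurable_LIMSEQ_metric)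
    show "(\<lambda>x. indicator G x * h i x) \<in> borel_measurable lebesgue" for i by measurable
    show "(\<lambda>i. indicator G x * h i x) \<longlonglongrightarrow> H x" for x
    proof (cases "x \<in> G")
      case False
      then have "H x = 0" unfolding H_def G_def by (simp add: infsum_not_exists)
      then show ?thesis using False by simp
    qed (simp add: lim)
  qed
  have HU: "AE x in lebesgue. ennreal (H x powr p) \<le> U x"
    using aeG
  proof eventually_elim
    case (elim x)
    have "(\<lambda>i. ennreal (h i x powr p)) \<longlonglongrightarrow> ennreal (H x powr p)"
      using p h_nn by (intro tendsto_ennrealI tendsto_powr' lim elim tendsto_const) auto
    then show ?case by (rule LIMSEQ_le_const2) (auto simp: U_def intro!: exI[of _ 0] SUP_upper)
  qed
  have HB: "(\<integral>\<^sup>+x. ennreal (H x powr p) \<partial>lebesgue) \<le> ennreal B"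
    using nn_integral_mono_AE[OF HU] UB by (rule order_trans)
  have iH: "integrable lebesgue (\<lambda>x. H x powr p)"
    using HB by (intro integrableI_bounded) (auto simp: le_less_trans)
  then show "integrable lebesgue (\<lambda>x. (\<Sum>\<^sub>\<infinity>Q\<in>S. v Q x) powr p)" by (simp add: H_def)
  show "(LINT x|lebesgue. (\<Sum>\<^sub>\<infinity>Q\<in>S. v Q x) powr p) \<le> B"
    using integral_real_bounded[OF B HB] by (simp add: H_def)
  assume \<epsilon>: "\<epsilon> > 0"
  have bd: "AE x in lebesgue. norm (\<bar>H x - h i x\<bar> powr p) \<le> H x powr p" for i
    using aeG by eventually_elim (use hH h_nn p in \<open>auto intro!: powr_mono2\<close>)
  have tl: "(\<lambda>i. LINT x|lebesgue. \<bar>H x - h i x\<bar> powr p) \<longlonglongrightarrow> (\<integral>x. 0 \<partial>(lebesgue :: (real^'n) measure))"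
  proof (rule integral_dominated_convergence[where w="\<lambda>x. H x powr p"])
    show "AE x in lebesgue. (\<lambda>i. \<bar>H x - h i x\<bar> powr p) \<longlonglongrightarrow> 0"
      using aeG
    proof eventually_elim
      case (elim x)
      have "(\<lambda>i. \<bar>H x - h i x\<bar> powr p) \<longlonglongrightarrow> \<bar>H x - H x\<bar> powr p"
        using p by (intro tendsto_powr' tendsto_rabs tendsto_diff tendsto_const lim elim) auto
      then show ?case by simp
    qed
  qed (use iH bd in auto)
  then obtain i where "(LINT x|lebesgue. \<bar>H x - h i x\<bar> powr p) < \<epsilon>"
    using order_tendstoD(2)[OF tl, of \<epsilon>] \<epsilon> by (auto simp: eventually_sequentially)
  moreover have "integrable lebesgue (\<lambda>x. \<bar>H x - h i x\<bar> powr p)"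
    by (rule integrable_dominated[OF iH]) (use bd[of i] in auto)
  ultimately show "\<exists>F. finite F \<and> F \<subseteq> S \<and> integrable lebesgue (\<lambda>x. \<bar>(\<Sum>\<^sub>\<infinity>Q\<in>S. v Q x) - (\<Sum>Q\<in>F. v Q x)\<bar> powr p) \<and>
      (LINT x|lebesgue. \<bar>(\<Sum>\<^sub>\<infinity>Q\<in>S. v Q x) - (\<Sum>Q\<in>F. v Q x)\<bar> powr p) < \<epsilon>"
    using F(1,2) by (intro exI[of _ "F i"]) (simp add: h_def H_def)
qed

context Ap_space
begin

text \<open>Boundedness is the single-cube estimate for the coefficient, agreement on the domain is
  \<open>coefficient_eq_average\<close>, and density comes from truncation.\<close>

lemma component_bounded_extension:
  assumes Q: "Q \<in> cubes" and a: "cut_off Q a" and b: "cut_off Q b"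
  shows "is_bounded_extension s p V (domain b) (averaging_term s Q a b) (\<lambda>f x. s (a x) (coefficient Q b f))"
proof -
  interpret vs: vector_space s using scaling by (simp add: banach_scaling_def)
  have Qs [measurable]: "Q \<in> sets lebesgue" using cube_measure(1)[OF Q] by (rule fmeasurableD)
  obtain C where C: "norming_constant C" using norming_constant_exists ..
  define B where "B = 2 powr (1 / q) * C"
  have B: "B > 0" using C by (simp add: B_def norming_constant_def)
  have T: "(\<lambda>x. s (a x) (coefficient Q b f)) \<in> wLp"
    "wnorm (\<lambda>x. s (a x) (coefficient Q b f)) \<le> B * wnorm f" if f: "f \<in> wLp" for f
  proof -
    let ?e = "coefficient Q b f"
    have sm: "strongly_measurable (\<lambda>x. s (a x) ?e)"
      using a by (intro strongly_measurable_scaling[OF scaling] strongly_measurable_const) (simp add: cut_off_def)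
    note [measurable] = norm_V_apply_measurable[OF sm]
    have le: "norm (V x (s (a x) ?e)) powr p \<le> indicator Q x * norm (V x ?e) powr p" for x
    proof -
      have "norm (V x (s (a x) ?e)) \<le> indicator Q x * norm (V x ?e)"
        using cut_off_norm[OF a, of x] by (simp add: V_scale norm_scale mult_right_mono)
      then have "norm (V x (s (a x) ?e)) powr p \<le> (indicator Q x * norm (V x ?e)) powr p"
        using p1 by (intro powr_mono2) auto
      then show ?thesis by (simp only: indicator_powr)
    qed
    show "(\<lambda>x. s (a x) ?e) \<in> wLp" unfolding weighted_Lp_iff
      by (intro conjI sm integrable_dominated[OF mass_integrable_cube[OF Q, of ?e]]) (use le in auto)
    have "(LINT x|lebesgue. norm (V x (s (a x) ?e)) powr p) \<le> mass Q ?e"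
      unfolding mass_def by (rule integral_mono'[OF mass_integrable_cube[OF Q]]) (use le in auto)
    also have "\<dots> \<le> (B * wnorm f) powr p"
      unfolding B_def by (rule mass_pairing_bound[OF C Q f coefficient_pairing[OF Q b f]])
    finally have "wnorm (\<lambda>x. s (a x) ?e) \<le> ((B * wnorm f) powr p) powr (1 / p)"
      unfolding weighted_norm_eq[of "\<lambda>x. s (a x) ?e"] using p1 by (intro powr_mono2) auto
    then show "wnorm (\<lambda>x. s (a x) ?e) \<le> B * wnorm f"
      using p1 B weighted_norm_nonneg[of f] by (simp add: powr_powr)
  qed
  have op: "bounded_operator s p V (\<lambda>f x. s (a x) (coefficient Q b f))"
    unfolding bounded_operator_def
  proof (intro conjI ballI allI exI[of _ B] AE_I2)
    fix f g x assume fg: "f \<in> wLp" "g \<in> wLp"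
    show "s (a x) (coefficient Q b (\<lambda>y. f y + g y)) = s (a x) (coefficient Q b f) + s (a x) (coefficient Q b g)"
      by (simp add: coefficient_add[OF Q b fg] vs.scale_right_distrib)
  next
    fix c f x assume f: "f \<in> wLp"
    show "s (a x) (coefficient Q b (\<lambda>y. s c (f y))) = s c (s (a x) (coefficient Q b f))"
      by (simp add: coefficient_scale[OF Q b f] mult.commute)
  qed (use T B in auto)
  have dense: "\<exists>g\<in>domain b. wnorm (\<lambda>x. f x - g x) < \<epsilon>" if f: "f \<in> wLp" and \<epsilon>: "\<epsilon> > 0" for f \<epsilon>
  proof -
    obtain N where "wnorm (\<lambda>x. f x - truncate f N x) < \<epsilon>"
      using order_tendstoD(2)[OF truncate_tendsto[OF f] \<epsilon>] by (auto simp: eventually_sequentially)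
    then show ?thesis using truncate_domain[OF Q b f] by blast
  qed
  show ?thesis
    unfolding is_bounded_extension_def
    using op dense domain_iff[OF b]
    by (auto simp: averaging_term_average[OF b] coefficient_eq_average[OF Q b])
qed

text \<open>An invertible V x is bounded below, so the majorant of the V x (t Q) controls the t Q
  themselves. Their sum then exists in the space, and V x passes through it.\<close>

lemma pointwise_tail:
  assumes inv: "invertible_op s UNIV (V x)" and v: "v summable_on S"
    and le: "\<And>Q. Q \<in> S \<Longrightarrow> norm (V x (t Q)) \<le> v Q"
  shows "(\<lambda>Q. norm (t Q)) summable_on S"
    and "finite F \<Longrightarrow> F \<subseteq> S \<Longrightarrow> norm (V x ((\<Sum>\<^sub>\<infinity>Q\<in>S. t Q) - (\<Sum>Q\<in>F. t Q))) \<le> (\<Sum>\<^sub>\<infinity>Q\<in>S. v Q) - (\<Sum>Q\<in>F. v Q)"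
proof -
  obtain K where K: "\<And>e. norm e \<le> K * norm (V x e)" using inv_adjoint_pairing(2)[of s V x, OF scaling inv] by blast
  have "norm (t Q) \<le> \<bar>K\<bar> * v Q" if "Q \<in> S" for Q
  proof -
    have "norm (t Q) \<le> \<bar>K\<bar> * norm (V x (t Q))"
      using K[of "t Q"] mult_right_mono[OF abs_ge_self[of K], of "norm (V x (t Q))"] by simp
    also have "\<dots> \<le> \<bar>K\<bar> * v Q" using le[OF that] by (rule mult_left_mono) simp
    finally show ?thesis .
  qed
  then show ts: "(\<lambda>Q. norm (t Q)) summable_on S"
    by (rule Infinite_Sum.abs_summable_on_comparison_test'[OF summable_on_cmult_right[OF v]])
  then have sm: "t summable_on S" by (rule Infinite_Sum.abs_summable_summable)
  assume F: "finite F" "F \<subseteq> S"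
  have smD: "t summable_on (S - F)" "v summable_on (S - F)"
    using sm v by (auto intro: summable_on_subset_banach)
  have vD: "(\<Sum>\<^sub>\<infinity>Q\<in>S - F. v Q) = (\<Sum>\<^sub>\<infinity>Q\<in>S. v Q) - (\<Sum>Q\<in>F. v Q)"
    using infsum_Diff[OF v _ F(2)] F(1) by simp
  have tD: "(\<Sum>\<^sub>\<infinity>Q\<in>S - F. t Q) = (\<Sum>\<^sub>\<infinity>Q\<in>S. t Q) - (\<Sum>Q\<in>F. t Q)"
    using infsum_Diff[OF sm _ F(2)] F(1) by simp
  have "V x (\<Sum>\<^sub>\<infinity>Q\<in>S - F. t Q) = (\<Sum>\<^sub>\<infinity>Q\<in>S - F. V x (t Q))"
    using infsumI[OF has_sum_bounded_linear[OF V_linear has_sum_infsum[OF smD(1)]]] by (simp add: o_def)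
  also have "norm \<dots> \<le> (\<Sum>\<^sub>\<infinity>Q\<in>S - F. norm (V x (t Q)))"
    using le by (intro norm_infsum_bound Infinite_Sum.abs_summable_on_comparison_test'[OF smD(2)]) auto
  also have "\<dots> \<le> (\<Sum>\<^sub>\<infinity>Q\<in>S - F. v Q)"
    using le by (intro infsum_mono Infinite_Sum.abs_summable_on_comparison_test'[OF smD(2)] smD(2)) auto
  finally show "norm (V x ((\<Sum>\<^sub>\<infinity>Q\<in>S. t Q) - (\<Sum>Q\<in>F. t Q))) \<le> (\<Sum>\<^sub>\<infinity>Q\<in>S. v Q) - (\<Sum>Q\<in>F. v Q)"
    by (simp only: vD tD)
qed

text \<open>T is built as a pointwise absolutely convergent sum, not as an abstract limit. Linearity
  can thus be checked at almost every point, and the remainders are dominated by those of a scalar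
  series.\<close>

theorem sparse_operator:
  assumes S: "S \<subseteq> dyadic_cubes" and sparse: "sparse_collection S"
    and a: "\<And>Q. Q \<in> S \<Longrightarrow> cut_off Q (a Q)" and b: "\<And>Q. Q \<in> S \<Longrightarrow> cut_off Q (b Q)"
  shows "\<exists>T. bounded_operator s p V T \<and>
    (\<forall>f\<in>wLp. weighted_has_sum p V (\<lambda>Q x. s (a Q x) (coefficient Q (b Q) f)) S (T f))"
proof -
  interpret vs: vector_space s using scaling by (simp add: banach_scaling_def)
  obtain c E where c: "c > 0" and E: "sparse_family c E S"
    using sparse unfolding sparse_collection_def sparse_family_def by blast
  obtain K where K: "K > 0" "\<forall>F E G e. finite F \<longrightarrow> F \<subseteq> dyadic_cubes \<longrightarrow> sparse_family c E F \<longrightarrow>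
    G \<in> borel_measurable lebesgue \<longrightarrow> (\<forall>x. 0 \<le> G x) \<longrightarrow> integrable lebesgue (\<lambda>x. G x powr p) \<longrightarrow>
    (\<forall>Q\<in>F. pairing_bound G Q (e Q)) \<longrightarrow>
    integrable lebesgue (\<lambda>x. (\<Sum>Q\<in>F. indicator Q x * norm (V x (e Q))) powr p) \<and>
    (LINT x|lebesgue. (\<Sum>Q\<in>F. indicator Q x * norm (V x (e Q))) powr p) \<le> K * (LINT x|lebesgue. G x powr p)"
    using sparse_estimate[OF c] by (elim exE conjE) (rule that)
  have Sc: "Q \<in> cubes" if "Q \<in> S" for Q using that S dyadic_cube_in_cubes by blast
  have Sm [measurable]: "Q \<in> sets lebesgue" if "Q \<in> S" for Q
    using cube_measure(1)[OF Sc[OF that]] by (rule fmeasurableD)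
  have count: "countable S" using countable_subset[OF S countable_dyadic_cubes] .
  define t where "t f Q x = s (a Q x) (coefficient Q (b Q) f)" for f Q x
  define v where "v f Q x = indicator Q x * norm (V x (coefficient Q (b Q) f))" for f Q x
  define H where "H f x = (\<Sum>\<^sub>\<infinity>Q\<in>S. v f Q x)" for f x
  \<comment> \<open>The value 0 off the set of absolute convergence makes T f a limit of cut-off
    finite sums at every point, as strong measurability demands.\<close>
  define T where "T f x = (if (\<lambda>Q. norm (t f Q x)) summable_on S then \<Sum>\<^sub>\<infinity>Q\<in>S. t f Q x else 0)" for f x
  have tv: "norm (V x (t f Q x)) \<le> v f Q x" if "Q \<in> S" for f Q x
    using cut_off_norm[OF a[OF that], of x] by (simp add: t_def v_def V_scale norm_scale mult_right_mono)
  have v_nn: "0 \<le> v f Q x" for f Q x by (simp add: v_def)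
  have v_meas: "v f Q \<in> borel_measurable lebesgue" if "Q \<in> S" for f Q
    unfolding v_def[abs_def] using Sm[OF that] by measurable
  have fin: "integrable lebesgue (\<lambda>x. (\<Sum>Q\<in>F. v f Q x) powr p)"
    "(LINT x|lebesgue. (\<Sum>Q\<in>F. v f Q x) powr p) \<le> K * wnorm f powr p"
    if f: "f \<in> wLp" and F: "finite F" "F \<subseteq> S" for f F
  proof -
    have "integrable lebesgue (\<lambda>x. (\<Sum>Q\<in>F. indicator Q x * norm (V x (coefficient Q (b Q) f))) powr p) \<and>
      (LINT x|lebesgue. (\<Sum>Q\<in>F. indicator Q x * norm (V x (coefficient Q (b Q) f))) powr p)
        \<le> K * (LINT x|lebesgue. norm (V x (f x)) powr p)"
    proof (rule K(2)[rule_format, of F E "\<lambda>x. norm (V x (f x))" "\<lambda>Q. coefficient Q (b Q) f"])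
      show "sparse_family c E F"
        using E F(2) disjoint_family_on_mono[OF F(2)] unfolding sparse_family_def by blast
      show "(\<lambda>x. norm (V x (f x))) \<in> borel_measurable lebesgue" "integrable lebesgue (\<lambda>x. norm (V x (f x)) powr p)"
        using f by (auto simp: weighted_Lp_iff norm_V_apply_measurable)
      show "pairing_bound (\<lambda>x. norm (V x (f x))) Q (coefficient Q (b Q) f)" if "Q \<in> F" for Q
        using F(2) that by (intro coefficient_pairing Sc b f) auto
    qed (use F S in auto)
    then show "integrable lebesgue (\<lambda>x. (\<Sum>Q\<in>F. v f Q x) powr p)"
      "(LINT x|lebesgue. (\<Sum>Q\<in>F. v f Q x) powr p) \<le> K * wnorm f powr p"
      by (simp_all only: v_def weighted_norm_powr)
  qed
  have p0: "0 < p" using p1 by simp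
  have K0: "0 \<le> K * wnorm f powr p" for f using K(1) by simp
  have family: "AE x in lebesgue. (\<lambda>Q. v f Q x) summable_on S"
    "integrable lebesgue (\<lambda>x. H f x powr p)"
    "(LINT x|lebesgue. H f x powr p) \<le> K * wnorm f powr p"
    "\<And>\<epsilon>. \<epsilon> > 0 \<Longrightarrow> \<exists>F. finite F \<and> F \<subseteq> S \<and> integrable lebesgue (\<lambda>x. \<bar>H f x - (\<Sum>Q\<in>F. v f Q x)\<bar> powr p) \<and>
      (LINT x|lebesgue. \<bar>H f x - (\<Sum>Q\<in>F. v f Q x)\<bar> powr p) < \<epsilon>"
    if f: "f \<in> wLp" for f
  proof -
    note nf = nonneg_family_sum_powr[where v="v f", OF count p0 K0[of f] v_meas[of _ f] v_nn fin(1)[OF f] fin(2)[OF f]]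
    show "AE x in lebesgue. (\<lambda>Q. v f Q x) summable_on S" by (rule nf(1))
    show "integrable lebesgue (\<lambda>x. H f x powr p)" unfolding H_def by (rule nf(2))
    show "(LINT x|lebesgue. H f x powr p) \<le> K * wnorm f powr p" unfolding H_def by (rule nf(3))
    show "\<exists>F. finite F \<and> F \<subseteq> S \<and> integrable lebesgue (\<lambda>x. \<bar>H f x - (\<Sum>Q\<in>F. v f Q x)\<bar> powr p) \<and>
      (LINT x|lebesgue. \<bar>H f x - (\<Sum>Q\<in>F. v f Q x)\<bar> powr p) < \<epsilon>" if "\<epsilon> > 0" for \<epsilon>
      unfolding H_def by (rule nf(4)) (assumption | rule that)+
  qed
  have good: "AE x in lebesgue. invertible_op s UNIV (V x) \<and> (\<lambda>Q. v f Q x) summable_on S"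
    if f: "f \<in> wLp" for f
    using AE_invertible family(1)[OF f] by (rule AE_conjI)
  have abs: "AE x in lebesgue. (\<lambda>Q. norm (t f Q x)) summable_on S" if f: "f \<in> wLp" for f
    using good[OF f]
  proof eventually_elim
    case (elim x)
    then show ?case by (intro pointwise_tail(1)[where v="\<lambda>Q. v f Q x"]) (auto intro: tv)
  qed
  have tail: "AE x in lebesgue. norm (V x (T f x - (\<Sum>Q\<in>F. t f Q x))) \<le> H f x - (\<Sum>Q\<in>F. v f Q x)"
    if f: "f \<in> wLp" and F: "finite F" "F \<subseteq> S" for f F
    using good[OF f] abs[OF f]
  proof eventually_elim
    case (elim x)
    have "norm (V x ((\<Sum>\<^sub>\<infinity>Q\<in>S. t f Q x) - (\<Sum>Q\<in>F. t f Q x))) \<le> (\<Sum>\<^sub>\<infinity>Q\<in>S. v f Q x) - (\<Sum>Q\<in>F. v f Q x)"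
      using elim(1) F by (intro pointwise_tail(2)) (auto intro: tv)
    then show ?case using elim(2) by (simp add: T_def H_def)
  qed
  have T_sm: "strongly_measurable (T f)" if f: "f \<in> wLp" for f
  proof -
    obtain F where F: "\<And>i. finite (F i)" "\<And>i. F i \<subseteq> S" "filterlim F (finite_subsets_at_top S) sequentially"
      by (rule countable_exhaustion[OF count]) (rule that)
    let ?G = "{x. (\<lambda>Q. norm (t f Q x)) summable_on S}"
    show ?thesis
    proof (rule strongly_measurable_LIMSEQ)
      show "strongly_measurable (\<lambda>x. indicator ?G x *\<^sub>R (\<Sum>Q\<in>F i. t f Q x))" for i
      proof (rule strongly_measurable_indicator[OF AE_sets_lebesgue[OF abs[OF f]] strongly_measurable_sum])
        fix Q assume "Q \<in> F i"
        then have "a Q \<in> borel_measurable lebesgue" using a F(2) by (auto simp: cut_off_def)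
        then show "strongly_measurable (t f Q)" unfolding t_def[abs_def]
          by (rule strongly_measurable_scaling[OF scaling _ strongly_measurable_const])
      qed
      show "(\<lambda>i. indicator ?G x *\<^sub>R (\<Sum>Q\<in>F i. t f Q x)) \<longlonglongrightarrow> T f x" for x
      proof (cases "x \<in> ?G")
        case True
        then have "(\<lambda>Q. t f Q x) summable_on S" by (auto dest: Infinite_Sum.abs_summable_summable)
        from filterlim_compose[OF infsum_tendsto[OF this] F(3)] show ?thesis using True by (simp add: T_def)
      qed (simp add: T_def)
    qed
  qed
  \<comment> \<open>The remainder estimate for the empty set.\<close>
  have T_le: "AE x in lebesgue. norm (V x (T f x)) powr p \<le> H f x powr p" if f: "f \<in> wLp" for f
    using tail[OF f finite.emptyI empty_subsetI]
  proof eventually_elim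
    case (elim x)
    then show ?case using p0 by (intro powr_mono2) auto
  qed
  have T_Lp: "T f \<in> wLp" if f: "f \<in> wLp" for f
  proof -
    note [measurable] = norm_V_apply_measurable[OF T_sm[OF f]]
    show ?thesis unfolding weighted_Lp_iff
      by (intro conjI T_sm f integrable_dominated[OF family(2)[OF f]]) (use T_le[OF f] in auto)
  qed
  have T_bound: "wnorm (T f) \<le> K powr (1 / p) * wnorm f" if f: "f \<in> wLp" for f
  proof -
    have "(LINT x|lebesgue. norm (V x (T f x)) powr p) \<le> (LINT x|lebesgue. H f x powr p)"
      by (rule integral_mono_AE'[OF family(2)[OF f] T_le[OF f]]) auto
    also have "\<dots> \<le> K * wnorm f powr p" by (rule family(3)[OF f])
    finally have "wnorm (T f) \<le> (K * wnorm f powr p) powr (1 / p)"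
      unfolding weighted_norm_eq[of "T f"] using p0 by (intro powr_mono2) auto
    then show ?thesis using p0 K(1) weighted_norm_nonneg[of f] by (simp add: powr_mult powr_powr)
  qed
  have op: "bounded_operator s p V T"
    unfolding bounded_operator_def
  proof (intro conjI ballI allI exI[of _ "K powr (1 / p)"])
    fix f g assume f: "f \<in> wLp" and g: "g \<in> wLp"
    show "AE x in lebesgue. T (\<lambda>y. f y + g y) x = T f x + T g x"
      using abs[OF f] abs[OF g] abs[OF weighted_Lp_add(1)[OF f g]]
    proof eventually_elim
      case (elim x)
      have "t (\<lambda>y. f y + g y) Q x = t f Q x + t g Q x" if "Q \<in> S" for Q
        unfolding t_def using that by (simp add: coefficient_add[OF Sc b f g] vs.scale_right_distrib)
      then have "(\<Sum>\<^sub>\<infinity>Q\<in>S. t (\<lambda>y. f y + g y) Q x) = (\<Sum>\<^sub>\<infinity>Q\<in>S. t f Q x + t g Q x)"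
        by (rule infsum_cong)
      also have "\<dots> = (\<Sum>\<^sub>\<infinity>Q\<in>S. t f Q x) + (\<Sum>\<^sub>\<infinity>Q\<in>S. t g Q x)"
        by (rule infsum_add[OF Infinite_Sum.abs_summable_summable[OF elim(1)] Infinite_Sum.abs_summable_summable[OF elim(2)]])
      finally show ?case using elim by (simp add: T_def)
    qed
  next
    fix d f assume f: "f \<in> wLp"
    show "AE x in lebesgue. T (\<lambda>y. s d (f y)) x = s d (T f x)"
      using abs[OF f] abs[OF weighted_Lp_scale(1)[OF f, of d]]
    proof eventually_elim
      case (elim x)
      have "t (\<lambda>y. s d (f y)) Q x = s d (t f Q x)" if "Q \<in> S" for Q
        unfolding t_def using that by (simp add: coefficient_scale[OF Sc b f] mult.commute)
      then have "(\<Sum>\<^sub>\<infinity>Q\<in>S. t (\<lambda>y. s d (f y)) Q x) = (\<Sum>\<^sub>\<infinity>Q\<in>S. s d (t f Q x))"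
        by (rule infsum_cong)
      also have "\<dots> = s d (\<Sum>\<^sub>\<infinity>Q\<in>S. t f Q x)"
        using infsumI[OF has_sum_bounded_linear[OF bounded_linear_scaling[OF scaling]
              has_sum_infsum[OF Infinite_Sum.abs_summable_summable[OF elim(1)]]]]
        by (simp add: o_def)
      finally show ?case using elim by (simp add: T_def)
    qed
  qed (use T_Lp T_bound in auto)
  have sum: "weighted_has_sum p V (t f) S (T f)" if f: "f \<in> wLp" for f
    unfolding weighted_has_sum_def
  proof (rule tendstoI)
    fix \<epsilon> :: real assume \<epsilon>: "\<epsilon> > 0"
    let ?R = "\<lambda>F x. \<bar>H f x - (\<Sum>Q\<in>F. v f Q x)\<bar> powr p"
    obtain F0 where F0: "finite F0" "F0 \<subseteq> S" "integrable lebesgue (?R F0)" "(LINT x|lebesgue. ?R F0 x) < \<epsilon> powr p"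
      using family(4)[OF f, of "\<epsilon> powr p"] \<epsilon> by auto
    have "dist (wnorm (\<lambda>x. T f x - (\<Sum>Q\<in>F. t f Q x))) 0 < \<epsilon>"
      if F: "finite F" "F0 \<subseteq> F" "F \<subseteq> S" for F
    proof -
      have "AE x in lebesgue. norm (V x (T f x - (\<Sum>Q\<in>F. t f Q x))) powr p \<le> ?R F0 x"
        using tail[OF f F(1,3)]
      proof eventually_elim
        case (elim x)
        \<comment> \<open>Enlarging F0 to F only shrinks the remainder, so one F0 controls the whole
          net of finite sets.\<close>
        have "(\<Sum>Q\<in>F0. v f Q x) \<le> (\<Sum>Q\<in>F. v f Q x)" using F v_nn by (intro sum_mono2) auto
        then show ?case using elim p0 by (intro powr_mono2) auto
      qed
      then have "(LINT x|lebesgue. norm (V x (T f x - (\<Sum>Q\<in>F. t f Q x))) powr p) \<le> (LINT x|lebesgue. ?R F0 x)"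
        by (intro integral_mono_AE'[OF F0(3)]) auto
      then have "(LINT x|lebesgue. norm (V x (T f x - (\<Sum>Q\<in>F. t f Q x))) powr p) < \<epsilon> powr p"
        using F0(4) by linarith
      then have "wnorm (\<lambda>x. T f x - (\<Sum>Q\<in>F. t f Q x)) < (\<epsilon> powr p) powr (1 / p)"
        unfolding weighted_norm_eq using p0 by (intro powr_less_mono2) auto
      then show ?thesis using \<epsilon> p0 weighted_norm_nonneg by (simp add: powr_powr)
    qed
    then show "\<forall>\<^sub>F F in finite_subsets_at_top S. dist (wnorm (\<lambda>x. T f x - (\<Sum>Q\<in>F. t f Q x))) 0 < \<epsilon>"
      unfolding eventually_finite_subsets_at_top using F0(1,2) by blast
  qed
  have "t f = (\<lambda>Q x. s (a Q x) (coefficient Q (b Q) f))" for f by (simp add: t_def fun_eq_iff)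
  then show ?thesis using op sum by (intro exI[of _ T]) simp
qed

end

theorem corollary8p4:
  fixes s :: "'k::{real_normed_field,euclidean_space} \<Rightarrow> 'x::banach \<Rightarrow> 'x"
    and p :: real
    and V :: "real^'n \<Rightarrow> 'x \<Rightarrow> 'x"
    and S :: "(real^'n) set set"
    and a b :: "(real^'n) set \<Rightarrow> real^'n \<Rightarrow> 'k"
  assumes "banach_scaling s"
    and "1 < p"
    and "Ap_weight s p V"
    and "S \<subseteq> dyadic_cubes" and "sparse_collection S"
    and "\<And>Q. Q \<in> S \<Longrightarrow> a Q \<in> borel_measurable lebesgue"
    and "\<And>Q. Q \<in> S \<Longrightarrow> b Q \<in> borel_measurable lebesgue"
    and "\<And>Q x. Q \<in> S \<Longrightarrow> x \<notin> Q \<Longrightarrow> a Q x = 0"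
    and "\<And>Q x. Q \<in> S \<Longrightarrow> x \<notin> Q \<Longrightarrow> b Q x = 0"
    and "\<And>Q x. Q \<in> S \<Longrightarrow> norm (a Q x) \<le> 1"
    and "\<And>Q x. Q \<in> S \<Longrightarrow> norm (b Q x) \<le> 1"
  shows "\<exists>TQ T.
    (\<forall>Q\<in>S. is_bounded_extension s p V (averaging_domain s p V (b Q)) (averaging_term s Q (a Q) (b Q)) (TQ Q)) \<and>
    bounded_operator s p V T \<and>
    (\<forall>f\<in>weighted_Lp p V. weighted_has_sum p V (\<lambda>Q. TQ Q f) S (T f))"
proof -
  interpret Ap_space s p V using assms(1-3) by unfold_locales
  have ab: "cut_off Q (a Q)" "cut_off Q (b Q)" if "Q \<in> S" for Q
    using assms(6-11) that by (auto simp: cut_off_def)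
  have ext: "is_bounded_extension s p V (averaging_domain s p V (b Q)) (averaging_term s Q (a Q) (b Q))
      (\<lambda>f x. s (a Q x) (coefficient Q (b Q) f))" if "Q \<in> S" for Q
    using that assms(4) dyadic_cube_in_cubes by (intro component_bounded_extension ab) auto
  obtain T where T: "bounded_operator s p V T"
    "\<forall>f\<in>weighted_Lp p V. weighted_has_sum p V (\<lambda>Q x. s (a Q x) (coefficient Q (b Q) f)) S (T f)"
    using sparse_operator[OF assms(4,5) ab] by blast
  show ?thesis
    by (rule exI[of _ "\<lambda>Q f x. s (a Q x) (coefficient Q (b Q) f)"], rule exI[of _ T]) (use ext T in simp)
qed

end
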